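(* Let $\Omega\subseteq\mathbb{R}^n$ be a bounded John domain, let $\alpha\in[0,1]$ with $1-\alpha<n$, and let $w$ be a nonnegative measurable function on $\mathbb{R}^n$. Assume the following. (i) If $\alpha\in[0,1)$: there exists a constant $K<\infty$ such that $$\left(\frac{1}{|Q|}\int_Q w(x)^{\frac{n}{n-1+\alpha}}\,dx\right)^{\frac{n-1+\alpha}{n}}\left(\operatorname*{ess\,sup}_{x\in Q}\frac{1}{w(x)}\right)<K$$ for every $n$-dimensional cube $Q\subset\mathbb{R}^n$, with $K$ independent of $Q$. (ii) If $\alpha=1$: there exists a constant $C_0$ such that $Mw(x)\le C_0\,w(x)$ for almost every $x\in\Omega$ (that is, $w\in A_1$). Then there is a constant $C$, independent of $f$, such that $$\inf_{a\in\mathbb{R}}\|(f(x)-a)\,w(x)\|_{L^{n/(n-1+\alpha)}(\Omega)}\le C\,\|\nabla f(x)\,d(x)^\alpha\,w(x)\|_{L^1(\Omega)}$$ for all locally Lipschitz functions $f$ on $\Omega$.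
   Context: For a domain $\Omega\subset\mathbb{R}^n$ and $x\in\Omega$, $d(x)$ denotes the distance from $x$ to the boundary $\partial\Omega$. A bounded domain $\Omega\subset\mathbb{R}^n$ is a John domain if, for a fixed $x_0\in\Omega$, there exist constants $\delta>0$ and $K_0<\infty$, depending only on $\Omega$ and $x_0$, such that for every $y\in\Omega$ there is a rectifiable curve $\gamma(\cdot,y):[0,1]\to\Omega$ with $\gamma(0,y)=y$, $\gamma(1,y)=x_0$, $d(\gamma(s,y))\ge\delta s$ and $|\dot\gamma(s,y)|\le K_0$, where $\dot\gamma(s,y)=\frac{\partial\gamma}{\partial s}(s,y)$. $M$ denotes the Hardy-Littlewood maximal function on $\mathbb{R}^n$, and $|Q|$ is the Lebesgue measure of $Q$. The gradient of a locally Lipschitz function exists almost everywhere. The right-hand side of the conclusion may be $+\infty$, in which case the inequality is trivial. *)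

theory Defs
  imports "HOL-Analysis.Analysis" "HOL-Probability.Essential_Supremum"
begin

definition bdry_dist :: "'a::metric_space set \<Rightarrow> 'a \<Rightarrow> real" where
  "bdry_dist \<Omega> x = infdist x (frontier \<Omega>)"

definition rectifiable_path :: "(real \<Rightarrow> 'a::metric_space) \<Rightarrow> bool" where
  "rectifiable_path \<gamma> \<longleftrightarrow> path \<gamma> \<and>
     (\<exists>L. \<forall>(t::nat \<Rightarrow> real) N. mono t \<longrightarrow> range t \<subseteq> {0..1} \<longrightarrow>
        (\<Sum>i<N. dist (\<gamma> (t i)) (\<gamma> (t (Suc i)))) \<le> L)"

text \<open>The velocity of a rectifiable curve exists only almost everywhere, and its bound is required
  almost everywhere. The last clause says that the curve is the integral of its velocity, i.e. is
  absolutely continuous. It cannot be dropped: every rectifiable curve has Cantor-type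
  parametrizations with zero velocity almost everywhere, so the bound would say nothing. A curve
  that is differentiable everywhere with bounded velocity satisfies all clauses.\<close>
definition velocity_bounded_by :: "(real \<Rightarrow> 'a::euclidean_space) \<Rightarrow> real \<Rightarrow> bool" where
  "velocity_bounded_by \<gamma> K \<longleftrightarrow>
     (AE s in lebesgue. s \<in> {0..1} \<longrightarrow>
        \<gamma> differentiable at s \<and> norm (vector_derivative \<gamma> (at s)) \<le> K) \<and>
     (\<forall>t\<in>{0..1}. ((\<lambda>s. vector_derivative \<gamma> (at s)) has_integral (\<gamma> t - \<gamma> 0)) {0..t})"

definition bounded_john_domain :: "'a::euclidean_space set \<Rightarrow> bool" where
  "bounded_john_domain \<Omega> \<longleftrightarrow> open \<Omega> \<and> connected \<Omega> \<and> bounded \<Omega> \<and>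
     (\<exists>x0\<in>\<Omega>. \<exists>\<delta>>0. \<exists>K0. \<forall>y\<in>\<Omega>. \<exists>\<gamma>.
        rectifiable_path \<gamma> \<and> path_image \<gamma> \<subseteq> \<Omega> \<and> pathstart \<gamma> = y \<and> pathfinish \<gamma> = x0 \<and>
        (\<forall>s\<in>{0..1}. bdry_dist \<Omega> (\<gamma> s) \<ge> \<delta> * s) \<and> velocity_bounded_by \<gamma> K0)"

definition locally_lipschitz_on :: "'a::metric_space set \<Rightarrow> ('a \<Rightarrow> 'b::metric_space) \<Rightarrow> bool" where
  "locally_lipschitz_on S f \<longleftrightarrow> (\<forall>x\<in>S. \<exists>r>0. \<exists>L. L-lipschitz_on (cball x r \<inter> S) f)"

text \<open>Unspecified where \<open>f\<close> is not differentiable, which for locally Lipschitz \<open>f\<close> is a null set.\<close>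
definition gradient :: "('a::real_inner \<Rightarrow> real) \<Rightarrow> 'a \<Rightarrow> 'a" where
  "gradient f x = (THE D. GDERIV f x :> D)"

text \<open>Real powers of extended nonnegative numbers, used only for positive exponents.\<close>
definition epowr :: "ennreal \<Rightarrow> real \<Rightarrow> ennreal" where
  "epowr x r = (if x = top then top else ennreal (enn2real x powr r))"

text \<open>For \<open>0 < p < \<infinity>\<close>; the value may be \<open>\<infinity>\<close>.\<close>
definition Lp_norm :: "real \<Rightarrow> 'a::euclidean_space set \<Rightarrow> ('a \<Rightarrow> 'b::real_normed_vector) \<Rightarrow> ennreal" where
  "Lp_norm p S g = epowr (\<integral>\<^sup>+x\<in>S. ennreal (norm (g x) powr p) \<partial>lebesgue) (1 / p)"

definition average :: "'a::euclidean_space set \<Rightarrow> ('a \<Rightarrow> ennreal) \<Rightarrow> ennreal" where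
  "average Q g = (\<integral>\<^sup>+x\<in>Q. g x \<partial>lebesgue) / emeasure lebesgue Q"

text \<open>Nondegenerate closed cubes with sides parallel to the axes.\<close>
definition cubes :: "(real ^ 'n) set set" where
  "cubes = {Q. \<exists>a l. l > 0 \<and> Q = cbox a (a + (\<chi> i. l))}"

text \<open>The centred maximal function over balls. The uncentred variant and the variants over cubes
  are comparable to it up to factors depending on the dimension only.\<close>
definition hl_maximal :: "('a::euclidean_space \<Rightarrow> real) \<Rightarrow> 'a \<Rightarrow> ennreal" where
  "hl_maximal w x = (SUP r\<in>{0<..}. average (ball x r) (\<lambda>y. ennreal \<bar>w y\<bar>))"

end

theory Submission
  imports Defs
begin

text \<open>Fix \<open>y \<in> \<Omega>\<close> and a John curve \<open>\<gamma>\<close> from \<open>y\<close> to \<open>x0\<close>. For small \<open>z\<close> the perturbed curve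
  \<open>s \<mapsto> \<gamma> s + s z\<close> runs from \<open>y\<close> to \<open>x0 + z\<close> inside \<open>\<Omega>\<close>. Integrating \<open>\<nabla>f\<close> along it, averaging over
  \<open>z\<close> and substituting \<open>x = \<gamma> s + s z\<close> bounds the oscillation of \<open>f\<close> at \<open>y\<close> by
  \<open>T|\<nabla>f| y = \<integral>\<^sub>0\<^sup>1 \<integral> s\<^bsup>-n\<^esup> |\<nabla>f x| dx ds\<close>, where \<open>|x - y| \<le> K s\<close> and \<open>r s \<le> d x\<close>; the kernel does not
  depend on the curve. Both weight hypotheses say that \<open>\<mu> = w\<^bsup>p\<^esup> dx\<close> satisfies
  \<open>\<mu> (B(x, \<rho>)) \<le> C \<rho>\<^bsup>n\<^esup> w(x)\<^bsup>p\<^esup>\<close> for almost every \<open>x\<close>. With Tonelli this gives the weak type bound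
  \<open>\<integral>\<^sub>E T G d\<mu> \<le> C \<mu>(E)\<^bsup>1 - 1/p\<^esup> \<integral> G d\<^bsup>\<alpha>\<^esup> w\<close>, and the strong inequality follows by Maz'ya's truncation
  method: apply the weak bound to the dyadic truncations of \<open>f - b\<close>, with \<open>b\<close> a median of \<open>f\<close> on a ball
  about \<open>x0\<close>. Rademacher's theorem makes the pointwise gradient available.\<close>

text \<open>A single curve is a null set, so a gradient known only almost everywhere says nothing
  along it. The perturbation thickens the curve: for \<open>s > 0\<close> the map
  \<open>z \<mapsto> \<gamma> s + s z\<close> pulls null sets back to null sets, so by Tonelli
  almost every perturbed curve meets the exceptional set only in a null set of times. The John
  margin \<open>2 r s\<close> is halved: one half is spent on the perturbation by \<open>z\<close>
  of norm below \<open>r\<close>, the other half leaves \<open>r s \<le> d x\<close>. This caps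
  \<open>s\<close> by \<open>d x / r\<close>, which is the source of the factor
  \<open>d x powr \<alpha>\<close>. The endpoints \<open>x0 + z\<close> would contribute values of
  \<open>f\<close>. For a truncation above a median these vanish on a set of at least half of all
  \<open>z\<close>, at the price of a factor 2; truncations below the median are treated through
  \<open>- f\<close>. For \<alpha> = 0 the operator T behaves like the Riesz potential of order 1,
  which on L^1 has only the weak type at the exponent p. This is why the estimate of T stops at the
  weak bound; truncation uses that gradients, unlike general G, split over disjoint layers, and one
  argument then serves all \<alpha>.\<close>

section \<open>Rademacher's theorem\<close>

text \<open>Continuous induction: the set of \<open>x\<close> for which the bound holds on \<open>[c, x]\<close> is closed, and from
  each of its points below \<open>d\<close> one can move further right, so no covering theorem is needed.\<close>

lemma mono_slope_right:
  fixes G :: "real \<Rightarrow> real"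
  assumes mono: "mono G" and cont: "continuous_on UNIV G" and K: "closed K" and q: "q \<ge> 0"
    and slope: "\<And>x. x \<in> K \<Longrightarrow> \<exists>\<^sub>F h in at_right 0. (G (x + h) - G x) / h > q"
    and cd: "c \<le> d"
  shows "q * measure lborel (K \<inter> {c..d}) \<le> G d - G c"
proof -
  define m where "m x = measure lborel (K \<inter> {c..x})" for x
  have fin: "emeasure lborel (K \<inter> {a..b}) < \<infinity>" for a b
    using emeasure_mono[of "K \<inter> {a..b}" "{a..b}" lborel]
    by (auto intro: le_less_trans simp: emeasure_lborel_Icc_eq)
  have mle: "m x \<le> m y" "m y \<le> m x + (y - x)" if "x \<le> y" for x y
  proof -
    show "m x \<le> m y" unfolding m_def
      using that K fin by (intro measure_mono_fmeasurable) (auto intro!: fmeasurableI)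
    have "m y \<le> measure lborel ((K \<inter> {c..x}) \<union> {x..y})" unfolding m_def
      using that K fin
      by (intro measure_mono_fmeasurable fmeasurable.Un) (auto intro!: fmeasurableI simp: fmeasurable_def)
    also have "\<dots> \<le> m x + measure lborel {x..y}" unfolding m_def
      using K by (intro measure_Un_le) auto
    finally show "m y \<le> m x + (y - x)" using that by simp
  qed
  have "1-lipschitz_on UNIV m"
  proof (rule lipschitz_onI)
    fix x y show "dist (m x) (m y) \<le> 1 * dist x y"
      using mle[of x y] mle[of y x] by (cases "x \<le> y") (auto simp: dist_real_def)
  qed simp
  then have mc: "continuous_on UNIV m" by (rule lipschitz_on_continuous_on)
  define S where "S = {c..d} \<inter> {x. q * m x \<le> G x - G c}"
  have "compact S" unfolding S_def
    by (intro compact_Int_closed closed_Collect_le continuous_intros mc cont) auto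
  moreover have "c \<in> S"
  proof -
    have "m c \<le> measure lborel {c}" unfolding m_def
      using K by (intro measure_mono_fmeasurable) (auto simp: fmeasurable_def)
    then have "m c = 0" by (simp add: m_def measure_le_0_iff)
    then show ?thesis using cd by (simp add: S_def)
  qed
  ultimately obtain s where s: "s \<in> S" and smax: "\<And>x. x \<in> S \<Longrightarrow> x \<le> s"
    using compact_attains_sup[of S] by blast
  have "s = d"
  proof (rule ccontr)
    assume "s \<noteq> d"
    then have sd: "s < d" "c \<le> s" using s by (auto simp: S_def)
    \<comment> \<open>At a point of \<open>K\<close> some short step of length \<open>h\<close>
      raises \<open>G\<close> by more than \<open>q h\<close>, while \<open>m\<close> grows by at
      most \<open>h\<close>. Off the closed set \<open>K\<close>, \<open>m\<close> stays constant
      for a while and \<open>G\<close> does not decrease.\<close>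
    have "\<exists>h>0. s + h \<in> S"
    proof (cases "s \<in> K")
      case True
      have "\<forall>\<^sub>F h in at_right (0::real). 0 < h \<and> h < d - s"
        using sd by (auto simp: eventually_at_right_field intro!: exI[of _ "d - s"])
      then obtain h where h: "(G (s + h) - G s) / h > q" "0 < h" "h < d - s"
          using frequently_ex[OF frequently_eventually_frequently[OF slope[OF True]]] by blast
      have "q * m (s + h) \<le> q * (m s + h)" using mle(2)[of s "s+h"] h q by (intro mult_left_mono) auto
      also have "\<dots> = q * m s + q * h" by (simp add: algebra_simps)
      also have "q * h \<le> G (s + h) - G s" using h by (simp add: field_simps)
      finally have "s + h \<in> S" using s h sd by (auto simp: S_def)
      then show ?thesis using h by auto
    next
      case False
      then obtain e where e: "e > 0" "ball s e \<subseteq> - K"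
        using K by (metis ComplI open_Compl open_contains_ball)
      define h where "h = min (e/2) (d - s)"
      have h: "h > 0" "h < e" "h \<le> d - s" using e sd by (auto simp: h_def)
      have "K \<inter> {c..s+h} = K \<inter> {c..s}"
      proof -
        have "x \<le> s" if "x \<in> K" "x \<le> s + h" for x
        proof (rule ccontr)
          assume "\<not> x \<le> s"
          then have "x \<in> ball s e" using that h by (auto simp: dist_real_def)
          then show False using e that by auto
        qed
        then show ?thesis using h by force
      qed
      then have "m (s + h) = m s" by (simp add: m_def)
      moreover have "G s \<le> G (s + h)" using mono h by (simp add: monoD)
      ultimately have "s + h \<in> S" using s h sd by (auto simp: S_def)
      then show ?thesis using h by auto
    qed
    then show False using smax by force
  qed
  then show ?thesis using s by (simp add: S_def m_def)
qed

lemma measure_lborel_uminus: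
  assumes "A \<in> sets borel" shows "measure lborel (uminus ` A) = measure lborel (A :: real set)"
proof -
  have "emeasure lborel A = emeasure (distr lborel borel uminus) A" by (simp add: lborel_distr_uminus)
  also have "\<dots> = emeasure lborel (uminus ` A)"
    using assms by (subst emeasure_distr) (auto simp: vimage_def image_def intro!: arg_cong[of _ _ "emeasure lborel"] bexI[of _ "- _"])
  finally show ?thesis by (simp add: measure_def)
qed

text \<open>The reflection \<open>x \<mapsto> - G (- x)\<close> is again increasing and turns left
  slopes into right slopes.\<close>

lemma mono_slope_left:
  fixes G :: "real \<Rightarrow> real"
  assumes mono: "mono G" and cont: "continuous_on UNIV G" and K: "closed K" and q: "q \<ge> 0"
    and slope: "\<And>x. x \<in> K \<Longrightarrow> \<exists>\<^sub>F h in at_left 0. (G (x + h) - G x) / h > q"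
    and cd: "c \<le> d"
  shows "q * measure lborel (K \<inter> {c..d}) \<le> G d - G c"
proof -
  have "q * measure lborel (uminus ` K \<inter> {-d..-c}) \<le> - G (-(-c)) - - G (-(-d))"
  proof (rule mono_slope_right[of "\<lambda>x. - G (-x)"])
    show "mono (\<lambda>x. - G (-x))" using mono by (auto simp: mono_def)
    show "continuous_on UNIV (\<lambda>x. - G (-x))"
      by (intro continuous_intros continuous_on_compose2[OF cont]) auto
    show "closed (uminus ` K)" using K by (rule closed_negations)
    fix x assume "x \<in> uminus ` K"
    then have "-x \<in> K" by auto
    from slope[OF this] have "\<exists>\<^sub>F h in at_right 0. (G (- x + - h) - G (- x)) / - h > q"
      unfolding frequently_def at_left_minus[of 0] eventually_filtermap by simp
    then show "\<exists>\<^sub>F h in at_right 0. (- G (- (x + h)) - - G (- x)) / h > q"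
      by (simp add: field_simps minus_divide_left[symmetric] diff_divide_distrib)
  qed (use q cd in auto)
  also have "uminus ` K \<inter> {-d..-c} = uminus ` (K \<inter> {c..d})"
    by (simp add: image_Int)
  also have "measure lborel \<dots> = measure lborel (K \<inter> {c..d})"
    using K by (intro measure_lborel_uminus) auto
  finally show ?thesis by simp
qed

text \<open>Cover \<open>K\<close> by nonoverlapping intervals of total length at most |K| + e.
  Adding up the density bounds gives |K| <= \<theta> (|K| + e), which is less than |K| for small e
  unless |K| = 0. This takes the place of Lebesgue's density theorem.\<close>

lemma measure_zero_if_density_le:
  fixes K :: "real set"
  assumes K: "compact K" and \<theta>: "0 \<le> \<theta>" "\<theta> < 1"
    and dens: "\<And>c d. c \<le> d \<Longrightarrow> measure lborel (K \<inter> {c..d}) \<le> \<theta> * (d - c)"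
  shows "measure lborel K = 0"
proof (rule ccontr)
  assume "measure lborel K \<noteq> 0"
  then have pos: "measure lborel K > 0" by (simp add: zero_less_measure_iff)
  obtain a b where ab: "K \<subseteq> cbox a b" using K by (meson bounded_subset_cbox_symmetric compact_imp_bounded)
  have Km: "K \<in> lmeasurable" using K by (rule lmeasurable_compact)
  have Kfin: "emeasure lborel (K \<inter> {c..d}) < top" for c d
    using emeasure_mono[of "K \<inter> {c..d}" "{c..d}" lborel]
    by (auto intro: le_less_trans simp: emeasure_lborel_Icc_eq)
  \<comment> \<open>The requirement is \<theta> e < (1 - \<theta>) |K|; as \<theta> < 1, halving the
    right side is enough.\<close>
  define e where "e = (1 - \<theta>) * measure lborel K / 2"
  have e: "e > 0" using pos \<theta> by (simp add: e_def)
  obtain D where D: "countable D" "\<And>I. I \<in> D \<Longrightarrow> I \<subseteq> cbox a b \<and> I \<noteq> {} \<and> (\<exists>c d. I = cbox c d)"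
    "pairwise (\<lambda>A B. interior A \<inter> interior B = {}) D"
    "K \<subseteq> \<Union>D" "\<Union>D \<in> lmeasurable" "measure lebesgue (\<Union>D) \<le> measure lebesgue K + e"
    using measurable_outer_intervals_bounded[OF Km ab e] by metis
  define E where "E = \<Union>(interior ` D)"
  have cD: "emeasure lborel (K \<inter> interior I) \<le> ennreal \<theta> * emeasure lborel (interior I)" if "I \<in> D" for I
  proof -
    obtain c d where "I = cbox c d" "I \<noteq> {}" using D(2) \<open>I \<in> D\<close> by blast
    then have I: "I = {c..d}" "c \<le> d" by auto
    have "emeasure lborel (K \<inter> interior I) \<le> emeasure lborel (K \<inter> {c..d})"
      using K I by (intro emeasure_mono) (auto simp: borel_compact)
    also have "\<dots> = measure lborel (K \<inter> {c..d})"
      using Kfin[of c d] by (simp add: emeasure_eq_ennreal_measure top.not_eq_extremum)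
    also have "\<dots> \<le> ennreal (\<theta> * (d - c))" using dens[OF I(2)] by (rule ennreal_leI)
    also have "\<dots> = ennreal \<theta> * emeasure lborel (interior I)" 
      using I \<theta> by (simp add: ennreal_mult interior_atLeastAtMost_real)
    finally show ?thesis .
  qed
  have disj: "disjoint_family_on (\<lambda>I. interior I) D" "disjoint_family_on (\<lambda>I. K \<inter> interior I) D"
    using D(3) by (auto simp: disjoint_family_on_def pairwise_def)
  \<comment> \<open>The intervals may share endpoints, so the sum runs over their disjoint
    interiors; the countably many endpoints form a null set.\<close>
  have null: "(\<Union>I\<in>D. I - interior I) \<in> null_sets lborel"
  proof (intro null_sets_UN' D)
    fix I assume "I \<in> D"
    then obtain c d where "I = cbox c d" using D(2) by blast
    then have I: "I = {c..d}" by simp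
    then have "I - interior I \<subseteq> {c, d}" by (auto simp: interior_atLeastAtMost_real)
    then show "I - interior I \<in> null_sets lborel"
      by (meson countable_imp_null_set_lborel countable_finite finite.emptyI finite.insertI finite_subset)
  qed
  have "emeasure lborel K \<le> emeasure lborel ((\<Union>I\<in>D. K \<inter> interior I) \<union> (\<Union>I\<in>D. I - interior I))"
  proof (rule emeasure_mono)
    show "(\<Union>I\<in>D. K \<inter> interior I) \<union> (\<Union>I\<in>D. I - interior I) \<in> sets lborel"
      using K by (intro sets.Un null_setsD2[OF null] sets.countable_UN' D) (auto simp: borel_compact)
  qed (use D(4) in auto)
  also have "\<dots> = emeasure lborel (\<Union>I\<in>D. K \<inter> interior I)"
    using K by (intro emeasure_Un_null_set null sets.countable_UN' D) (auto simp: borel_compact)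
  also have "\<dots> = (\<integral>\<^sup>+I. emeasure lborel (K \<inter> interior I) \<partial>count_space D)"
    using K D disj by (intro emeasure_UN_countable) (auto simp: borel_compact)
  also have "\<dots> \<le> (\<integral>\<^sup>+I. ennreal \<theta> * emeasure lborel (interior I) \<partial>count_space D)"
    using cD by (intro nn_integral_mono) auto
  also have "\<dots> = ennreal \<theta> * emeasure lborel E"
    unfolding E_def using D disj by (subst emeasure_UN_countable) (auto simp: nn_integral_cmult)
  also have "emeasure lborel E \<le> emeasure lebesgue (\<Union>D)"
  proof -
    have "E \<in> sets borel" unfolding E_def by (intro borel_open open_UN) auto
    then have "emeasure lborel E = emeasure lebesgue E" by simp
    also have "\<dots> \<le> emeasure lebesgue (\<Union>D)"
      using D(5) interior_subset by (intro emeasure_mono) (auto simp: E_def)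
    finally show ?thesis .
  qed
  finally have le: "emeasure lborel K \<le> ennreal \<theta> * emeasure lebesgue (\<Union>D)" by (simp add: mult_left_mono)
  have "ennreal (measure lebesgue K) = emeasure lebesgue K" using Km by (rule emeasure_eq_measure2[symmetric])
  also have "\<dots> = emeasure lborel K" using K by (simp add: borel_compact)
  also note le
  also have "emeasure lebesgue (\<Union>D) = ennreal (measure lebesgue (\<Union>D))" using D(5) by (rule emeasure_eq_measure2)
  also have "ennreal \<theta> * \<dots> = ennreal (\<theta> * measure lebesgue (\<Union>D))" using \<theta> by (simp add: ennreal_mult)
  finally have "measure lebesgue K \<le> \<theta> * measure lebesgue (\<Union>D)" using \<theta> by (simp add: ennreal_le_iff)
  also have "\<dots> \<le> \<theta> * (measure lebesgue K + e)" using D(6) \<theta> by (intro mult_left_mono) auto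
  also have "\<dots> < measure lebesgue K"
  proof -
    have "\<theta> * e \<le> e" using \<theta> e by (simp add: mult_le_cancel_right1)
    moreover have "e < (1 - \<theta>) * measure lebesgue K"
      using e unfolding e_def using K by (simp add: borel_compact)
    ultimately show ?thesis by (simp add: algebra_simps)
  qed
  finally show False by simp
qed

text \<open>Up to the boundary case of equality, the set where the upper Dini derivative in
  direction \<open>e\<close> exceeds \<open>q\<close>; \<open>S\<close> selects the right side, the
  left side or both. Applied to \<open>- f\<close> and \<open>- p\<close> it catches slopes below
  \<open>p\<close>.\<close>

definition upper_slope_set :: "real set \<Rightarrow> ('a::real_normed_vector \<Rightarrow> real) \<Rightarrow> 'a \<Rightarrow> real \<Rightarrow> 'a set" where
  "upper_slope_set S f e q = {x. \<exists>\<^sub>F h in at 0 within S. (f (x + h *\<^sub>R e) - f x) / h > q}"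

lemma frequently_at_0_within:
  fixes S :: "real set"
  shows "(\<exists>\<^sub>F h in at 0 within S. P h) \<longleftrightarrow> (\<forall>n::nat. \<exists>h\<in>S. h \<noteq> 0 \<and> \<bar>h\<bar> < 1 / real (Suc n) \<and> P h)"
proof -
  have "(\<exists>\<^sub>F h in at 0 within S. P h) \<longleftrightarrow> (\<forall>d>0. \<exists>h\<in>S. h \<noteq> 0 \<and> \<bar>h\<bar> < d \<and> P h)"
    unfolding frequently_def eventually_at by (auto simp: dist_real_def)
  also have "\<dots> \<longleftrightarrow> (\<forall>n::nat. \<exists>h\<in>S. h \<noteq> 0 \<and> \<bar>h\<bar> < 1 / real (Suc n) \<and> P h)"
  proof safe
    fix d :: real assume *: "\<forall>n::nat. \<exists>h\<in>S. h \<noteq> 0 \<and> \<bar>h\<bar> < 1 / real (Suc n) \<and> P h" "d > 0"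
    then obtain n where "1 / real (Suc n) < d" by (metis nat_approx_posE)
    moreover obtain h where "h \<in> S" "h \<noteq> 0" "\<bar>h\<bar> < 1 / real (Suc n)" "P h" using * by blast
    ultimately show "\<exists>h\<in>S. h \<noteq> 0 \<and> \<bar>h\<bar> < d \<and> P h" by force
  qed (metis of_nat_0_less_iff zero_less_Suc zero_less_divide_1_iff)
  finally show ?thesis .
qed

text \<open>For continuous \<open>f\<close> the set is a G_delta: the union over \<open>h\<close> is
  uncountable but consists of open sets, and the intersection over the radii is countable.\<close>

lemma upper_slope_set_borel:
  fixes f :: "'a::real_normed_vector \<Rightarrow> real"
  assumes "continuous_on UNIV f"
  shows "upper_slope_set S f e q \<in> sets borel"
proof -
  have "upper_slope_set S f e q =
    (\<Inter>n::nat. \<Union>h\<in>{h\<in>S. h \<noteq> 0 \<and> \<bar>h\<bar> < 1 / real (Suc n)}. {x. q < (f (x + h *\<^sub>R e) - f x) / h})"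
    unfolding upper_slope_set_def frequently_at_0_within by auto
  moreover have "open {x. q < (f (x + h *\<^sub>R e) - f x) / h}" for h
    unfolding divide_inverse
    by (intro open_Collect_less continuous_intros continuous_on_compose2[OF assms]) auto
  ultimately show ?thesis by (simp only:) (intro sets.countable_INT'; auto intro!: borel_open open_UN)
qed

lemma slope_abs_le:
  fixes f :: "'a::real_normed_vector \<Rightarrow> real"
  assumes "L-lipschitz_on UNIV f" "h \<noteq> 0"
  shows "\<bar>(f (x + h *\<^sub>R e) - f x) / h\<bar> \<le> L * norm e"
proof -
  have "\<bar>f (x + h *\<^sub>R e) - f x\<bar> \<le> L * (\<bar>h\<bar> * norm e)"
    using lipschitz_onD[OF assms(1), of "x + h *\<^sub>R e" x] by (simp add: dist_norm)
  then show ?thesis using assms(2) by (simp add: abs_divide divide_le_eq mult_ac)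
qed

text \<open>For an \<open>L\<close>-Lipschitz \<open>F\<close> the functions L x + F x and L x - F x
  are increasing. On a compact part \<open>K\<close> of the exceptional set they have arbitrarily
  short steps of slope above L + q and L - p. In the sum of the two growth bounds \<open>F\<close>
  cancels: (2 L + q - p) |K \<inter> [c, d]| <= 2 L (d - c). So \<open>K\<close> has density at most
  a constant below 1 in every interval.\<close>

lemma slope_gap_null_one_sided:
  fixes F :: "real \<Rightarrow> real"
  assumes lip: "L-lipschitz_on UNIV F" and pq: "p < q"
    and S: "S = {0<..} \<or> S = {..<0}" and T: "T = {0<..} \<or> T = {..<0}"
  shows "upper_slope_set S F 1 q \<inter> upper_slope_set T (\<lambda>x. - F x) 1 (- p) \<in> null_sets lborel" (is "?N \<in> _")
proof -
  have L0: "L \<ge> 0" using lip by (rule lipschitz_on_nonneg)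
  have cont: "continuous_on UNIV F" using lip by (rule lipschitz_on_continuous_on)
  have N: "?N \<in> sets borel"
    by (intro sets.Int upper_slope_set_borel continuous_intros cont)
  have Fle: "F y - F x \<le> L * (y - x)" "F x - F y \<le> L * (y - x)" if "x \<le> y" for x y
    using lipschitz_onD[OF lip, of x y] that by (auto simp: dist_real_def abs_if split: if_splits)
  have lin: "((c + h) * L + s * F (c + h) - (c * L + s * F c)) / h = L + s * ((F (c + h) - F c) / h)"
    if "h \<noteq> 0" for c h s using that by (simp add: field_simps)
  have mono_slope: "(L + q') * measure lborel (K \<inter> {c..d}) \<le> (d * L + s * F d) - (c * L + s * F c)"
    if K: "closed K" "K \<subseteq> upper_slope_set R (\<lambda>x. s * F x) 1 q'" and cd: "c \<le> d" and s: "\<bar>s\<bar> = 1"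
      and R: "R = {0<..} \<or> R = {..<0}" and q': "L + q' \<ge> 0" for K s R c d q'
  proof -
    have mono: "mono (\<lambda>x. x * L + s * F x)"
    proof (rule monoI)
      fix x y :: real assume "x \<le> y"
      with Fle[OF this] s show "x * L + s * F x \<le> y * L + s * F y"
        by (auto simp: abs_if algebra_simps split: if_splits)
    qed
    have fr: "\<exists>\<^sub>F h in at 0 within R. L + q' < ((x + h) * L + s * F (x + h) - (x * L + s * F x)) / h"
      if "x \<in> K" for x
    proof -
      have "\<exists>\<^sub>F h in at 0 within R. q' < (s * F (x + h) - s * F x) / h"
        using K that by (auto simp: upper_slope_set_def)
      then have "\<exists>\<^sub>F h in at 0 within R. q' < (s * F (x + h) - s * F x) / h \<and> h \<noteq> 0"
        by (rule frequently_eventually_frequently) (auto simp: eventually_at intro!: exI[of _ 1])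
      then show ?thesis
        by (rule frequently_elim1) (subst lin, auto simp: right_diff_distrib)
    qed
    have c: "continuous_on UNIV (\<lambda>x. x * L + s * F x)" by (intro continuous_intros cont)
    show ?thesis
      using R mono_slope_right[OF mono c K(1) q' _ cd] mono_slope_left[OF mono c K(1) q' _ cd] fr by blast
  qed
  have comp: "measure lborel K = 0" if K: "compact K" "K \<subseteq> ?N" for K
  proof (cases "K = {}")
    case False
    then obtain x where x: "x \<in> ?N" using K by auto
    \<comment> \<open>Together with \<open>p < q\<close>, the bounds \<open>q < L\<close> and
      \<open>- p < L\<close> make L - p and L + q nonnegative, as the growth bound demands.\<close>
    have "q < L"
    proof -
      obtain h where "h \<noteq> 0" "q < (F (x + h) - F x) / h"
        using x unfolding upper_slope_set_def frequently_at_0_within by auto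
      then show ?thesis using slope_abs_le[OF lip, of h x 1] by (auto simp: abs_if split: if_splits)
    qed
    have "- p < L"
    proof -
      obtain h where "h \<noteq> 0" "- p < (- F (x + h) - - F x) / h"
        using x unfolding upper_slope_set_def frequently_at_0_within by auto
      then show ?thesis using slope_abs_le[OF lip, of h x 1]
        by (auto simp: abs_if diff_divide_distrib split: if_splits)
    qed
    have K': "closed K" using K by (simp add: compact_imp_closed)
    show ?thesis
    proof (rule measure_zero_if_density_le[OF K(1), of "2 * L / (2 * L + (q - p))"])
      fix c d :: real assume cd: "c \<le> d"
      have "(L + q) * measure lborel (K \<inter> {c..d}) \<le> (d * L + 1 * F d) - (c * L + 1 * F c)"
        using K \<open>- p < L\<close> pq by (intro mono_slope[OF K' _ cd _ S]) auto
      moreover have "(L + - p) * measure lborel (K \<inter> {c..d}) \<le> (d * L + -1 * F d) - (c * L + -1 * F c)"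
        using K \<open>q < L\<close> pq by (intro mono_slope[OF K' _ cd _ T]) auto
      ultimately have "(2 * L + (q - p)) * measure lborel (K \<inter> {c..d}) \<le> 2 * L * (d - c)"
        by (simp add: algebra_simps)
      then show "measure lborel (K \<inter> {c..d}) \<le> 2 * L / (2 * L + (q - p)) * (d - c)"
        using pq L0 by (simp add: field_simps)
    qed (use pq L0 in \<open>auto simp: field_simps\<close>)
  qed auto
  have N': "?N \<in> sets lebesgue" using N by simp
  \<comment> \<open>Inner regularity: up to measure \<open>e\<close> the set is closed, and a closed
    set is a countable union of compact ones.\<close>
  have "emeasure lebesgue ?N \<le> ennreal e" if e0: "e > 0" for e
  proof -
    obtain C where C: "closed C" "C \<subseteq> ?N" "?N - C \<in> lmeasurable" "emeasure lebesgue (?N - C) < ennreal e"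
      using sets_lebesgue_inner_closed[OF N' e0] .
    have "C \<inter> cball 0 (real n) \<in> null_sets lborel" for n
    proof -
      have c: "compact (C \<inter> cball 0 (real n))" using C by (simp add: closed_Int_compact)
      then have "emeasure lborel (C \<inter> cball 0 (real n)) = ennreal (measure lborel (C \<inter> cball 0 (real n)))"
        using emeasure_compact_finite[OF c] by (intro emeasure_eq_ennreal_measure) auto
      also have "\<dots> = 0" using comp[OF c] C by auto
      finally show ?thesis using c by (auto simp: null_sets_def borel_compact)
    qed
    then have "(\<Union>n. C \<inter> cball 0 (real n)) \<in> null_sets lborel" by (intro null_sets_UN) auto
    moreover have "(\<Union>n. C \<inter> cball 0 (real n)) = C"
      using real_arch_simple by auto
    ultimately have "C \<in> null_sets lebesgue" by (simp add: null_sets_completionI)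
    then have "emeasure lebesgue ((?N - C) \<union> C) = emeasure lebesgue (?N - C)"
      using fmeasurableD[OF C(3)] by (rule emeasure_Un_null_set[rotated])
    moreover have "(?N - C) \<union> C = ?N" using C by auto
    ultimately show ?thesis using C(4) by (metis less_imp_le)
  qed
  then have "emeasure lebesgue ?N = 0"
    by (metis ennreal_le_epsilon add_0 le_zero_eq)
  then have "?N \<in> null_sets lebesgue" using N' by (rule null_setsI)
  then show ?thesis using N by (simp only: null_sets_completion_iff sets_lborel)
qed

text \<open>The large and the small slopes may occur on different sides of the point. The one-sided
  sets combine in four ways, which is why \<open>S\<close> and \<open>T\<close> were chosen
  independently.\<close>

lemma slope_gap_null_real:
  fixes F :: "real \<Rightarrow> real"
  assumes lip: "L-lipschitz_on UNIV F" and pq: "p < q"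
  shows "upper_slope_set UNIV F 1 q \<inter> upper_slope_set UNIV (\<lambda>x. - F x) 1 (- p) \<in> null_sets lborel"
proof -
  have un: "upper_slope_set UNIV f e q = upper_slope_set {0<..} f e q \<union> upper_slope_set {..<0} f e q" for f e q
    unfolding upper_slope_set_def frequently_def at_eq_sup_left_right eventually_sup by auto
  show ?thesis unfolding un Int_Un_distrib Int_Un_distrib2
    by (intro null_sets.Un slope_gap_null_one_sided[OF lip pq]) auto
qed

text \<open>Averaging the translation invariance of the measure over \<open>t \<in> [0, 1]\<close> replaces a change of
  variables that would make \<open>e\<close> a coordinate direction.\<close>

lemma null_sets_lborel_if_null_on_lines:
  fixes N :: "'a::euclidean_space set"
  assumes N[measurable]: "N \<in> sets borel" and lines: "\<And>x. {t::real. x + t *\<^sub>R e \<in> N} \<in> null_sets lborel"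
  shows "N \<in> null_sets lborel"
proof -
  have shift: "emeasure lborel N = (\<integral>\<^sup>+x. indicator N (x + t *\<^sub>R e) \<partial>lborel)" for t :: real
  proof -
    have "emeasure lborel N = (\<integral>\<^sup>+x. indicator N x \<partial>distr lborel borel ((+) (t *\<^sub>R e)))"
      by (simp add: lborel_distr_plus)
    also have "\<dots> = (\<integral>\<^sup>+x. indicator N (x + t *\<^sub>R e) \<partial>lborel)"
      by (subst nn_integral_distr) (auto simp: add.commute)
    finally show ?thesis .
  qed
  have "emeasure lborel N = (\<integral>\<^sup>+t. emeasure lborel N * indicator {0..1::real} t \<partial>lborel)"
    by (simp add: nn_integral_cmult_indicator)
  also have "\<dots> = (\<integral>\<^sup>+t. (\<integral>\<^sup>+x. indicator N (x + t *\<^sub>R e) * indicator {0..1::real} t \<partial>lborel) \<partial>lborel)"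
    by (intro nn_integral_cong, subst shift, subst nn_integral_multc) auto
  also have "\<dots> = (\<integral>\<^sup>+x. (\<integral>\<^sup>+t. indicator N (x + t *\<^sub>R e) * indicator {0..1::real} t \<partial>lborel) \<partial>lborel)"
    by (intro lborel_pair.Fubini'[symmetric]) auto
  also have "\<dots> = (\<integral>\<^sup>+(x::'a). 0 \<partial>lborel)"
  proof (rule nn_integral_cong)
    fix x
    have "(\<integral>\<^sup>+t. indicator N (x + t *\<^sub>R e) * indicator {0..1::real} t \<partial>lborel)
        \<le> (\<integral>\<^sup>+t. indicator {t. x + t *\<^sub>R e \<in> N} t \<partial>lborel)"
      by (intro nn_integral_mono) (auto split: split_indicator)
    also have "\<dots> = 0" using lines[of x] by (subst nn_integral_indicator) auto
    finally show "(\<integral>\<^sup>+t. indicator N (x + t *\<^sub>R e) * indicator {0..1::real} t \<partial>lborel) = 0" by simp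
  qed
  finally show ?thesis by (simp add: null_sets_def)
qed

text \<open>On every line parallel to \<open>e\<close> the function is Lipschitz, so a given gap
  \<open>p < q\<close> in its slopes occurs only on a null set of the line, hence of the space.
  Outside the countable union over rational gaps the lower and upper limits of the quotients
  agree.\<close>

lemma lipschitz_AE_directional_derivative:
  fixes f :: "'a::euclidean_space \<Rightarrow> real"
  assumes lip: "L-lipschitz_on UNIV f"
  shows "AE x in lborel. \<exists>D. ((\<lambda>h. (f (x + h *\<^sub>R e) - f x) / h) \<longlongrightarrow> D) (at 0)"
proof -
  have cont: "continuous_on UNIV f" using lip by (rule lipschitz_on_continuous_on)
  define N where "N p q = upper_slope_set UNIV f e q \<inter> upper_slope_set UNIV (\<lambda>x. - f x) e (- p)" for p q
  have null: "N p q \<in> null_sets lborel" if "p < q" for p q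
  proof (rule null_sets_lborel_if_null_on_lines[where e = e])
    show "N p q \<in> sets borel" unfolding N_def
      by (intro sets.Int upper_slope_set_borel continuous_intros cont)
    fix x
    have "(L * norm e)-lipschitz_on UNIV (\<lambda>t. f (x + t *\<^sub>R e))"
    proof (rule lipschitz_onI)
      fix s t :: real
      show "dist (f (x + s *\<^sub>R e)) (f (x + t *\<^sub>R e)) \<le> L * norm e * dist s t"
        using lipschitz_onD[OF lip, of "x + s *\<^sub>R e" "x + t *\<^sub>R e"]
        by (simp add: dist_norm scaleR_diff_left[symmetric] mult_ac)
    qed (use lipschitz_on_nonneg[OF lip] in auto)
    from slope_gap_null_real[OF this that]
    show "{t. x + t *\<^sub>R e \<in> N p q} \<in> null_sets lborel"
      unfolding N_def upper_slope_set_def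
      by (simp add: algebra_simps Collect_conj_eq)
  qed
  have "AE x in lborel. \<forall>p\<in>\<rat>. \<forall>q\<in>\<rat>. p < q \<longrightarrow> x \<notin> N p q"
    using null by (auto simp: AE_ball_countable countable_rat AE_not_in)
  then show ?thesis
  proof eventually_elim
    case (elim x)
    define \<phi> where "\<phi> h = (f (x + h *\<^sub>R e) - f x) / h" for h
    have bd: "\<bar>\<phi> h\<bar> \<le> L * norm e" if "h \<noteq> 0" for h
      unfolding \<phi>_def by (rule slope_abs_le[OF lip that])
    have bdE: "\<forall>\<^sub>F h in at 0. \<bar>\<phi> h\<bar> \<le> L * norm e"
      using bd by (auto simp: eventually_at intro!: exI[of _ 1])
    \<comment> \<open>\<open>Inf A\<close> is the upper limit of the quotients. A value
      \<open>a\<close> below it leaves room for rationals \<open>a < p < q < Inf A\<close>;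
      quotients above \<open>q\<close> occur arbitrarily close to 0, so quotients below
      \<open>p\<close> cannot.\<close>
    define A where "A = {q. \<forall>\<^sub>F h in at 0. \<phi> h \<le> q}"
    have "L * norm e \<in> A" unfolding A_def using bdE by (auto elim!: eventually_mono)
    have bddA: "- (L * norm e) \<le> q" if "q \<in> A" for q
    proof -
      have "\<forall>\<^sub>F h in at (0::real). \<phi> h \<le> q \<and> \<bar>\<phi> h\<bar> \<le> L * norm e"
        using that bdE unfolding A_def by (auto intro: eventually_conj)
      then obtain h where "\<phi> h \<le> q" "\<bar>\<phi> h\<bar> \<le> L * norm e"
        using eventually_happens[of _ "at (0::real)"] by auto
      then show ?thesis by linarith
    qed
    have bdd: "bdd_below A" using bddA by (auto intro!: bdd_belowI)
    have "(\<phi> \<longlongrightarrow> Inf A) (at 0)"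
    proof (rule order_tendstoI)
      fix a assume "Inf A < a"
      then obtain q where "q \<in> A" "q < a" using \<open>_ \<in> A\<close> by (metis bdd cInf_less_iff empty_iff)
      then show "\<forall>\<^sub>F h in at 0. \<phi> h < a" unfolding A_def by (auto elim!: eventually_mono)
    next
      fix a assume "a < Inf A"
      then obtain p where p: "p \<in> \<rat>" "a < p" "p < Inf A" using Rats_dense_in_real by blast
      then obtain q where q: "q \<in> \<rat>" "p < q" "q < Inf A" using Rats_dense_in_real by blast
      have "q \<notin> A" using q bdd by (metis cInf_lower not_le)
      then have "\<exists>\<^sub>F h in at 0. q < \<phi> h"
        unfolding A_def by (auto simp: frequently_def not_less elim!: eventually_mono)
      then have "x \<in> upper_slope_set UNIV f e q" by (simp add: upper_slope_set_def \<phi>_def)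
      then have "x \<notin> upper_slope_set UNIV (\<lambda>x. - f x) e (- p)" using elim p q by (auto simp: N_def)
      then have "\<not> (\<exists>\<^sub>F h in at 0. - p < - \<phi> h)"
        by (simp add: upper_slope_set_def \<phi>_def minus_divide_left)
      then have "\<forall>\<^sub>F h in at 0. p \<le> \<phi> h" by (simp add: frequently_def not_less)
      then show "\<forall>\<^sub>F h in at 0. a < \<phi> h" using p by (auto elim!: eventually_mono)
    qed
    then show ?case unfolding \<phi>_def by blast
  qed
qed

section \<open>Linearity in the direction and full differentiability\<close>

definition has_dir_deriv :: "('a::real_normed_vector \<Rightarrow> real) \<Rightarrow> 'a \<Rightarrow> 'a \<Rightarrow> real \<Rightarrow> bool" where
  "has_dir_deriv f e x D \<longleftrightarrow> ((\<lambda>h. (f (x + h *\<^sub>R e) - f x) / h) \<longlongrightarrow> D) (at 0)"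

lemma has_dir_deriv_unique: "has_dir_deriv f e x D \<Longrightarrow> has_dir_deriv f e x D' \<Longrightarrow> D = D'"
  unfolding has_dir_deriv_def by (rule tendsto_unique[rotated]) auto

lemma has_dir_deriv_scale:
  assumes "has_dir_deriv f e x D" shows "has_dir_deriv f (c *\<^sub>R e) x (c * D)"
proof (cases "c = 0")
  case False
  have "filterlim (\<lambda>h. h * c) (at 0) (at (0::real))"
    using False by (auto simp: filterlim_at eventually_at intro!: exI[of _ 1] tendsto_eq_intros)
  from filterlim_compose[OF assms[unfolded has_dir_deriv_def] this]
  have "((\<lambda>h. c * ((f (x + (h * c) *\<^sub>R e) - f x) / (h * c))) \<longlongrightarrow> c * D) (at 0)"
    by (intro tendsto_intros)
  then show ?thesis using False by (simp add: has_dir_deriv_def)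
qed (simp add: has_dir_deriv_def)

text \<open>With \<open>M'\<close> above the bound of |h|, the function 1 + h / M' is a nonnegative
  density that gives every box its volume. Boxes determine Lebesgue measure and densities are unique
  almost everywhere, so this density equals 1.\<close>

lemma AE_zero_if_integral_boxes_zero:
  fixes h :: "'a::euclidean_space \<Rightarrow> real"
  assumes h[measurable]: "h \<in> borel_measurable borel" and bd: "AE x in lborel. \<bar>h x\<bar> \<le> M"
    and zero: "\<And>l u. (\<integral>x. indicator (box l u) x * h x \<partial>lborel) = 0"
  shows "AE x in lborel. h x = 0"
proof -
  define M' where "M' = \<bar>M\<bar> + 1"
  have M': "M' > 0" by (simp add: M'_def)
  define k where "k x = 1 + h x / M'" for x
  have k[measurable]: "k \<in> borel_measurable borel" unfolding k_def by measurable
  have k0: "AE x in lborel. 0 \<le> k x"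
    using bd by eventually_elim (use M' in \<open>auto simp: k_def M'_def field_simps abs_if split: if_splits\<close>)
  have "lborel = density lborel (\<lambda>x. ennreal (k x))"
  proof (rule lborel_eqI)
    fix l u :: 'a assume lu: "\<And>b. b \<in> Basis \<Longrightarrow> l \<bullet> b \<le> u \<bullet> b"
    have fin: "emeasure lborel (box l u) < \<infinity>" by (simp add: emeasure_lborel_box_eq)
    have ind: "integrable lborel (indicator (box l u) :: 'a \<Rightarrow> real)"
      using fin by (simp add: integrable_indicator_iff)
    have "integrable lborel (\<lambda>x. M * indicator (box l u) x)" using ind by simp
    then have inh: "integrable lborel (\<lambda>x. indicator (box l u) x * h x)"
    proof (rule Bochner_Integration.integrable_bound)
      show "AE x in lborel. norm (indicator (box l u) x * h x) \<le> norm (M * indicator (box l u) x)"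
        using bd by eventually_elim (auto split: split_indicator)
    qed measurable
    have eq: "k x * indicator (box l u) x = indicator (box l u) x + (indicator (box l u) x * h x) / M'" for x
      using M' by (auto simp: k_def split: split_indicator)
    have "emeasure (density lborel (\<lambda>x. ennreal (k x))) (box l u)
      = (\<integral>\<^sup>+x. ennreal (k x * indicator (box l u) x) \<partial>lborel)"
      by (subst emeasure_density) (auto intro!: nn_integral_cong split: split_indicator)
    also have "\<dots> = ennreal (\<integral>x. k x * indicator (box l u) x \<partial>lborel)"
    proof (rule nn_integral_eq_integral)
      show "integrable lborel (\<lambda>x. k x * indicator (box l u) x)"
        unfolding eq using ind inh by auto
      show "AE x in lborel. 0 \<le> k x * indicator (box l u) x"
        using k0 by eventually_elim (auto split: split_indicator)
    qed
    also have "(\<integral>x. k x * indicator (box l u) x \<partial>lborel) = measure lborel (box l u)"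
      unfolding eq using ind inh zero[of l u] by (subst Bochner_Integration.integral_add) auto
    also have "\<dots> = (\<Prod>b\<in>Basis. (u - l) \<bullet> b)" using lu by simp
    finally show "emeasure (density lborel (\<lambda>x. ennreal (k x))) (box l u) = ennreal (\<Prod>b\<in>Basis. (u - l) \<bullet> b)" .
  qed simp
  then have "density lborel (\<lambda>x. ennreal (k x)) = density lborel (\<lambda>x::'a. 1)" by (simp add: density_1)
  then have "AE x in lborel. ennreal (k x) = 1"
    by (intro sigma_finite_measure.density_unique[OF sigma_finite_lborel]) auto
  with k0 show ?thesis
    by eventually_elim (use M' in \<open>auto simp: k_def ennreal_eq_1\<close>)
qed

text \<open>A difference quotient in direction \<open>u + v\<close> is one in direction \<open>u\<close> plus a translate by \<open>t u\<close> of
  one in direction \<open>v\<close>. After integration over a box the translation moves to the box, where it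
  disappears in the limit.\<close>

lemma AE_dir_deriv_add:
  fixes f :: "'a::euclidean_space \<Rightarrow> real"
  assumes lip: "L-lipschitz_on UNIV f"
  shows "AE x in lborel. \<forall>D E. has_dir_deriv f u x D \<longrightarrow> has_dir_deriv f v x E \<longrightarrow> has_dir_deriv f (u + v) x (D + E)"
proof -
  have L0: "L \<ge> 0" using lip by (rule lipschitz_on_nonneg)
  have fc: "continuous_on UNIV f" using lip by (rule lipschitz_on_continuous_on)
  have [measurable]: "f \<in> borel_measurable borel" using fc by (rule borel_measurable_continuous_onI)
  define t where "t n = 1 / real (Suc n)" for n
  have t: "t n > 0" "t n \<le> 1" for n by (auto simp: t_def)
  have t0: "filterlim t (at 0) sequentially"
    unfolding filterlim_at t_def using LIMSEQ_inverse_real_of_nat by (auto simp: inverse_eq_divide)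
  define q where "q n e x = (f (x + t n *\<^sub>R e) - f x) / t n" for n e x
  \<comment> \<open>A Borel function on the whole space that equals the directional derivative
    wherever that exists, hence almost everywhere.\<close>
  define g where "g e x = lim (\<lambda>n. q n e x)" for e x
  have q[measurable]: "q n e \<in> borel_measurable borel" for n e unfolding q_def by measurable
  have g[measurable]: "g e \<in> borel_measurable borel" for e
    unfolding g_def by (rule borel_measurable_lim_metric) measurable
  have qb: "\<bar>q n e x\<bar> \<le> L * norm e" for n e x
    unfolding q_def using t[of n] by (intro slope_abs_le[OF lip]) auto
  have gd: "AE x in lborel. has_dir_deriv f e x (g e x) \<and> (\<lambda>n. q n e x) \<longlonglongrightarrow> g e x" for e
    using lipschitz_AE_directional_derivative[OF lip, of e]
  proof eventually_elim
    case (elim x)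
    then obtain D where D: "((\<lambda>h. (f (x + h *\<^sub>R e) - f x) / h) \<longlongrightarrow> D) (at 0)" by blast
    from filterlim_compose[OF D t0] have "(\<lambda>n. q n e x) \<longlonglongrightarrow> D" by (simp add: q_def)
    moreover from this have "g e x = D" unfolding g_def by (rule limI)
    ultimately show ?case using D by (simp add: has_dir_deriv_def)
  qed
  have gb: "AE x in lborel. \<bar>g e x\<bar> \<le> L * norm e" for e
    using gd[of e]
  proof eventually_elim
    case (elim x)
    then have "(\<lambda>n. \<bar>q n e x\<bar>) \<longlonglongrightarrow> \<bar>g e x\<bar>" by (intro tendsto_intros) auto
    then show ?case by (rule LIMSEQ_le_const2) (use qb in auto)
  qed
  define h where "h x = g (u + v) x - g u x - g v x" for x
  have "AE x in lborel. h x = 0"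
  proof (rule AE_zero_if_integral_boxes_zero)
    show "h \<in> borel_measurable borel" unfolding h_def by measurable
    show "AE x in lborel. \<bar>h x\<bar> \<le> L * norm (u + v) + L * norm u + L * norm v"
      using gb[of "u + v"] gb[of u] gb[of v] by eventually_elim (auto simp: h_def)
    fix a b :: 'a
    define B where "B = box a b"
    have [measurable]: "B \<in> sets borel" by (simp add: B_def)
    obtain R where R: "\<And>x. x \<in> B \<Longrightarrow> norm x \<le> R" using bounded_box[of a b] unfolding B_def bounded_iff by blast
    \<comment> \<open>Because \<open>t n \<le> 1\<close>, this ball contains \<open>B\<close> and
      all its translates by \<open>t n\<close> times \<open>u\<close>; a multiple of its indicator
      dominates every integrand below.\<close>
    define C where "C = cball (0::'a) (R + norm u)"
    have [measurable]: "C \<in> sets borel" by (simp add: C_def)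
    have BC: "x \<in> C" if "x - t n *\<^sub>R u \<in> B" for x n
    proof -
      have "norm x \<le> norm (x - t n *\<^sub>R u) + norm (t n *\<^sub>R u)" by (metis diff_add_cancel norm_triangle_ineq)
      moreover have "norm (t n *\<^sub>R u) \<le> norm u" using t[of n] by (simp add: mult_left_le_one_le)
      ultimately show ?thesis using R[OF that] by (simp add: C_def)
    qed
    have BC': "B \<subseteq> C" using R by (force simp: C_def intro: order_trans)
    have Cint: "integrable lborel (\<lambda>x. L * norm e * indicator C x)" for e :: 'a
      using emeasure_compact_finite[of C] by (simp add: C_def integrable_indicator_iff)
    have conv1: "(\<lambda>n. \<integral>x. indicator B x * q n e x \<partial>lborel) \<longlonglongrightarrow> (\<integral>x. indicator B x * g e x \<partial>lborel)"
      and i1: "integrable lborel (\<lambda>x. indicator B x * g e x)" for e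
    proof -
      have a: "AE x in lborel. (\<lambda>n. indicator B x * q n e x) \<longlonglongrightarrow> indicator B x * g e x"
        using gd[of e] by eventually_elim (auto intro!: tendsto_intros)
      have b: "AE x in lborel. norm (indicator B x * q n e x) \<le> L * norm e * indicator C x" for n
        using qb BC' L0 by (auto split: split_indicator)
      show "(\<lambda>n. \<integral>x. indicator B x * q n e x \<partial>lborel) \<longlonglongrightarrow> (\<integral>x. indicator B x * g e x \<partial>lborel)"
        by (rule integral_dominated_convergence[OF _ _ Cint a b]) auto
      show "integrable lborel (\<lambda>x. indicator B x * g e x)"
        by (rule integrable_dominated_convergence[OF _ _ Cint a b]) auto
    qed
    have iq: "integrable lborel (\<lambda>x. indicator B (x - s) * q n e x)" if "\<And>x. x - s \<in> B \<Longrightarrow> x \<in> C" for n e s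
      by (rule Bochner_Integration.integrable_bound[OF Cint[of e]]) (use qb that L0 in \<open>auto split: split_indicator\<close>)
    have shift: "(\<integral>x. indicator B x * q n v (x + t n *\<^sub>R u) \<partial>lborel) = (\<integral>x. indicator B (x - t n *\<^sub>R u) * q n v x \<partial>lborel)" for n
    proof -
      have "(\<integral>x. indicator B (x - t n *\<^sub>R u) * q n v x \<partial>lborel)
        = (\<integral>x. indicator B (x - t n *\<^sub>R u) * q n v x \<partial>distr lborel borel ((+) (t n *\<^sub>R u)))"
        by (simp add: lborel_distr_plus)
      also have "\<dots> = (\<integral>x. indicator B x * q n v (x + t n *\<^sub>R u) \<partial>lborel)"
        by (subst integral_distr) (auto simp: add.commute)
      finally show ?thesis by simp
    qed
    have conv2: "(\<lambda>n. \<integral>x. indicator B (x - t n *\<^sub>R u) * q n v x \<partial>lborel) \<longlonglongrightarrow> (\<integral>x. indicator B x * g v x \<partial>lborel)"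
    proof (rule integral_dominated_convergence[OF _ _ Cint[of v]])
      \<comment> \<open>The indicators of the translated boxes converge to that of \<open>B\<close>
        off the frontier of the box.\<close>
      have "frontier B \<in> null_sets lborel"
        using negligible_convex_frontier[of B] by (auto simp: B_def negligible_iff_null_sets null_sets_completion_iff)
      then have "AE x in lborel. x \<notin> frontier B" by (rule AE_not_in)
      with gd[of v] show "AE x in lborel. (\<lambda>n. indicator B (x - t n *\<^sub>R u) * q n v x) \<longlonglongrightarrow> indicator B x * g v x"
      proof eventually_elim
        case (elim x)
        have c: "(\<lambda>n. x - t n *\<^sub>R u) \<longlonglongrightarrow> x"
          using t0 by (auto simp: filterlim_at intro!: tendsto_eq_intros)
        have "\<forall>\<^sub>F n in sequentially. (indicator B x :: real) = indicator B (x - t n *\<^sub>R u)"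
        proof (cases "x \<in> B")
          case True
          have "\<forall>\<^sub>F n in sequentially. x - t n *\<^sub>R u \<in> B"
            using topological_tendstoD[OF c _ True] by (simp add: B_def open_box)
          then show ?thesis by eventually_elim (use True in auto)
        next
          case False
          then have "x \<in> - closure B" using elim by (auto simp: frontier_def B_def interior_open[OF open_box])
          then have "\<forall>\<^sub>F n in sequentially. x - t n *\<^sub>R u \<in> - closure B"
            by (intro topological_tendstoD[OF c]) auto
          then show ?thesis by eventually_elim (use False closure_subset[of B] in \<open>auto split: split_indicator\<close>)
        qed
        then have "(\<lambda>n. indicator B (x - t n *\<^sub>R u) :: real) \<longlonglongrightarrow> indicator B x"
          by (rule Lim_transform_eventually[OF tendsto_const])
        then show ?case using elim by (intro tendsto_intros) auto
      qed
      show "AE x in lborel. norm (indicator B (x - t n *\<^sub>R u) * q n v x) \<le> L * norm v * indicator C x" for n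
        using qb BC[of _ n] L0 by (intro AE_I2) (auto split: split_indicator)
    qed auto
    have split: "(\<integral>x. indicator B x * q n (u + v) x \<partial>lborel)
        = (\<integral>x. indicator B x * q n u x \<partial>lborel) + (\<integral>x. indicator B (x - t n *\<^sub>R u) * q n v x \<partial>lborel)" for n
    proof -
      have eq: "indicator B x * q n (u + v) x = indicator B x * q n u x + indicator B x * q n v (x + t n *\<^sub>R u)" for x
        by (simp add: q_def algebra_simps add_divide_distrib diff_divide_distrib)
      have "integrable lborel (\<lambda>x. indicator B x * q n v (x + t n *\<^sub>R u))"
        by (rule Bochner_Integration.integrable_bound[OF Cint[of v]]) (use qb BC' L0 in \<open>auto split: split_indicator\<close>)
      then show ?thesis unfolding eq shift[symmetric]
        using iq[of 0 n u] BC' by (intro Bochner_Integration.integral_add) auto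
    qed
    have "(\<integral>x. indicator B x * g (u + v) x \<partial>lborel)
        = (\<integral>x. indicator B x * g u x \<partial>lborel) + (\<integral>x. indicator B x * g v x \<partial>lborel)"
      using conv1[of "u + v"] tendsto_add[OF conv1[of u] conv2] unfolding split by (rule LIMSEQ_unique)
    then show "(\<integral>x. indicator (box a b) x * h x \<partial>lborel) = 0"
      unfolding B_def[symmetric] h_def using i1 by (simp add: right_diff_distrib)
  qed
  with gd[of "u + v"] gd[of u] gd[of v] show ?thesis
  proof eventually_elim
    case (elim x)
    show ?case
    proof (intro allI impI)
      fix D E assume "has_dir_deriv f u x D" "has_dir_deriv f v x E"
      then have "D = g u x" "E = g v x" using elim has_dir_deriv_unique by blast+
      moreover have "g (u + v) x = g u x + g v x" using elim by (simp add: h_def)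
      ultimately show "has_dir_deriv f (u + v) x (D + E)" using elim by simp
    qed
  qed
qed

text \<open>Difference quotients of an \<open>L\<close>-Lipschitz function change by at most
  \<open>L\<close> times the change of direction. By compactness of the sphere finitely many
  directions in \<open>U\<close> approximate all unit vectors, and along finitely many directions
  convergence is uniform.\<close>

lemma GDERIV_if_has_dir_deriv_dense:
  fixes f :: "'a::euclidean_space \<Rightarrow> real"
  assumes lip: "L-lipschitz_on UNIV f" and dense: "\<And>S. open S \<Longrightarrow> S \<noteq> {} \<Longrightarrow> \<exists>u\<in>U. u \<in> S"
    and dir: "\<And>u. u \<in> U \<Longrightarrow> has_dir_deriv f u x (u \<bullet> d)"
  shows "GDERIV f x :> d"
  unfolding gderiv_def has_derivative_at_alt
proof (intro conjI allI impI)
  show "bounded_linear (\<lambda>h. h \<bullet> d)" by (rule bounded_linear_inner_left)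
  fix e :: real assume e: "e > 0"
  have L0: "L \<ge> 0" using lip by (rule lipschitz_on_nonneg)
  \<comment> \<open>Replacing a unit vector \<open>w\<close> by a nearby \<open>u\<close> costs
    \<open>L \<eta>\<close> in the quotient of \<open>f\<close> and \<open>\<eta> * norm d\<close>
    in the linear term; together they may use up e / 2. The summand 1 prevents division by
    zero.\<close>
  define \<eta> where "\<eta> = e / (2 * (L + norm d + 1))"
  have \<eta>: "\<eta> > 0" unfolding \<eta>_def using e L0 by (intro divide_pos_pos) (auto intro: add_nonneg_pos)
  have \<eta>2: "(L + norm d) * \<eta> \<le> e / 2"
  proof -
    have "(L + norm d) * \<eta> \<le> (L + norm d + 1) * \<eta>" using \<eta> by (simp add: algebra_simps)
    also have "\<dots> = e / 2"
    proof -
      have "L + norm d + 1 > 0" using L0 by (simp add: add_nonneg_pos)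
      then show ?thesis unfolding \<eta>_def by (subst times_divide_eq_right) (simp add: field_simps)
    qed
    finally show ?thesis .
  qed
  have "sphere 0 1 \<subseteq> (\<Union>u\<in>U. ball u \<eta>)"
  proof
    fix w :: 'a
    obtain u where "u \<in> U" "u \<in> ball w \<eta>" using dense[of "ball w \<eta>"] \<eta> by force
    then show "w \<in> (\<Union>u\<in>U. ball u \<eta>)" by (auto simp: dist_commute)
  qed
  then obtain V where V: "V \<subseteq> U" "finite V" "sphere 0 1 \<subseteq> (\<Union>u\<in>V. ball u \<eta>)"
    using compactE_image[of "sphere (0::'a) 1" U "\<lambda>u. ball u \<eta>"] compact_sphere by auto
  have "\<forall>\<^sub>F t in at (0::real). \<forall>u\<in>V. \<bar>(f (x + t *\<^sub>R u) - f x) / t - u \<bullet> d\<bar> < e / 2"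
  proof (rule eventually_ball_finite[OF V(2)], safe)
    fix u assume "u \<in> V"
    then have "((\<lambda>t. (f (x + t *\<^sub>R u) - f x) / t) \<longlongrightarrow> u \<bullet> d) (at 0)"
      using dir V unfolding has_dir_deriv_def by blast
    from tendstoD[OF this, of "e / 2"] show "\<forall>\<^sub>F t in at 0. \<bar>(f (x + t *\<^sub>R u) - f x) / t - u \<bullet> d\<bar> < e / 2"
      using e by (simp add: dist_real_def)
  qed
  then obtain \<delta> where \<delta>: "\<delta> > 0"
    "\<And>t u. t \<noteq> 0 \<Longrightarrow> \<bar>t\<bar> < \<delta> \<Longrightarrow> u \<in> V \<Longrightarrow> \<bar>(f (x + t *\<^sub>R u) - f x) / t - u \<bullet> d\<bar> < e / 2"
    unfolding eventually_at by (auto simp: dist_real_def)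
  show "\<exists>\<delta>>0. \<forall>y. norm (y - x) < \<delta> \<longrightarrow> norm (f y - f x - (y - x) \<bullet> d) \<le> e * norm (y - x)"
  proof (intro exI[of _ \<delta>] conjI allI impI \<delta>)
    fix y assume y: "norm (y - x) < \<delta>"
    show "norm (f y - f x - (y - x) \<bullet> d) \<le> e * norm (y - x)"
    proof (cases "y = x")
      case False
      define t where "t = norm (y - x)"
      define w where "w = (y - x) /\<^sub>R t"
      have t: "t > 0" using False by (simp add: t_def)
      have yw: "y = x + t *\<^sub>R w" using t by (simp add: w_def)
      have "w \<in> sphere 0 1" using t by (simp add: w_def t_def)
      then obtain u where u: "u \<in> V" "norm (w - u) < \<eta>" using V(3) by (auto simp: dist_norm norm_minus_commute)
      have 1: "\<bar>f y - f (x + t *\<^sub>R u)\<bar> \<le> L * (t * \<eta>)"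
      proof -
        have "\<bar>f y - f (x + t *\<^sub>R u)\<bar> \<le> L * norm (t *\<^sub>R (w - u))"
          using lipschitz_onD[OF lip, of y "x + t *\<^sub>R u"] by (simp add: yw dist_norm scaleR_diff_right)
        also have "\<dots> \<le> L * (t * \<eta>)" using u t L0 by (intro mult_left_mono) auto
        finally show ?thesis .
      qed
      have 2: "\<bar>f (x + t *\<^sub>R u) - f x - t * (u \<bullet> d)\<bar> \<le> t * (e / 2)"
      proof -
        have "f (x + t *\<^sub>R u) - f x - t * (u \<bullet> d) = t * ((f (x + t *\<^sub>R u) - f x) / t - u \<bullet> d)"
          using t by (simp add: field_simps)
        then show ?thesis using \<delta>(2)[of t u] t y u by (simp add: abs_mult t_def)
      qed
      have 3: "\<bar>t * (u \<bullet> d) - t * (w \<bullet> d)\<bar> \<le> t * (\<eta> * norm d)"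
      proof -
        have "\<bar>(w - u) \<bullet> d\<bar> \<le> norm (w - u) * norm d" by (rule Cauchy_Schwarz_ineq2)
        also have "\<dots> \<le> \<eta> * norm d" using u by (intro mult_right_mono) auto
        finally have "\<bar>u \<bullet> d - w \<bullet> d\<bar> \<le> \<eta> * norm d" by (simp add: inner_diff_left abs_minus_commute)
        then have "t * \<bar>u \<bullet> d - w \<bullet> d\<bar> \<le> t * (\<eta> * norm d)" using t by (intro mult_left_mono) auto
        moreover have "\<bar>t * (u \<bullet> d) - t * (w \<bullet> d)\<bar> = t * \<bar>u \<bullet> d - w \<bullet> d\<bar>"
          using t by (simp add: right_diff_distrib[symmetric] abs_mult)
        ultimately show ?thesis by simp
      qed
      have "(y - x) \<bullet> d = t * (w \<bullet> d)" by (simp add: yw)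
      then have "\<bar>f y - f x - (y - x) \<bullet> d\<bar> \<le> L * (t * \<eta>) + t * (e / 2) + t * (\<eta> * norm d)"
        using 1 2 3 by linarith
      also have "\<dots> = t * ((L + norm d) * \<eta> + e / 2)" by (simp add: algebra_simps)
      also have "\<dots> \<le> t * e" using \<eta>2 t by (intro mult_left_mono) auto
      finally show ?thesis by (simp add: t_def mult.commute)
    qed simp
  qed
qed

text \<open>Almost everywhere the derivatives along the basis exist and determine, linearly, those
  along countably many prescribed directions. Density of these directions upgrades this to a full
  derivative.\<close>

lemma Rademacher:
  fixes f :: "'a::euclidean_space \<Rightarrow> real"
  assumes lip: "L-lipschitz_on UNIV f"
  shows "AE x in lborel. \<exists>d. GDERIV f x :> d"
proof -
  obtain U :: "'a set" where U: "countable U" "\<And>S. open S \<Longrightarrow> S \<noteq> {} \<Longrightarrow> \<exists>u\<in>U. u \<in> S"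
    using countable_dense_setE by metis
  \<comment> \<open>The exceptional set may depend on \<open>c\<close>; afterwards \<open>c\<close>
    ranges only over the coordinates of countably many vectors \<open>u\<close>.\<close>
  have lin: "AE x in lborel. \<forall>D. (\<forall>i\<in>Basis. has_dir_deriv f i x (D i)) \<longrightarrow>
      has_dir_deriv f (\<Sum>i\<in>F. c i *\<^sub>R i) x (\<Sum>i\<in>F. c i * D i)" if "finite F" "F \<subseteq> Basis" for F and c :: "'a \<Rightarrow> real"
    using that
  proof (induction F)
    case empty
    then show ?case by (simp add: has_dir_deriv_def)
  next
    case (insert j F)
    have "AE x in lborel. \<forall>D. (\<forall>i\<in>Basis. has_dir_deriv f i x (D i)) \<longrightarrow>
      has_dir_deriv f (\<Sum>i\<in>F. c i *\<^sub>R i) x (\<Sum>i\<in>F. c i * D i)" using insert by auto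
    with AE_dir_deriv_add[OF lip, of "c j *\<^sub>R j" "\<Sum>i\<in>F. c i *\<^sub>R i"] show ?case
    proof eventually_elim
      case (elim x)
      show ?case
      proof (intro allI impI)
        fix D assume D: "\<forall>i\<in>Basis. has_dir_deriv f i x (D i)"
        then have "has_dir_deriv f (c j *\<^sub>R j) x (c j * D j)" using insert by (intro has_dir_deriv_scale) auto
        then show "has_dir_deriv f (\<Sum>i\<in>insert j F. c i *\<^sub>R i) x (\<Sum>i\<in>insert j F. c i * D i)"
          using elim D insert by simp
      qed
    qed
  qed
  have "AE x in lborel. \<forall>u\<in>U. \<forall>D. (\<forall>i\<in>Basis. has_dir_deriv f i x (D i)) \<longrightarrow>
      has_dir_deriv f u x (\<Sum>i\<in>Basis. (u \<bullet> i) * D i)"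
    using lin[OF finite_Basis order_refl, of "\<lambda>i. _ \<bullet> i"] U(1)
    by (simp add: AE_ball_countable euclidean_representation)
  moreover have "AE x in lborel. \<forall>i\<in>Basis. \<exists>D. has_dir_deriv f i x D"
    unfolding has_dir_deriv_def
    by (intro AE_finite_allI lipschitz_AE_directional_derivative[OF lip]) auto
  ultimately show ?thesis
  proof eventually_elim
    case (elim x)
    then obtain D where "\<And>i. i \<in> Basis \<Longrightarrow> has_dir_deriv f i x (D i)" by metis
    with elim(1) have "has_dir_deriv f u x (\<Sum>i\<in>Basis. (u \<bullet> i) * D i)" if "u \<in> U" for u using that by blast
    then have "GDERIV f x :> (\<Sum>i\<in>Basis. D i *\<^sub>R i)"
      by (intro GDERIV_if_has_dir_deriv_dense[OF lip U(2)]) (auto simp: inner_sum_right mult.commute)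
    then show ?case ..
  qed
qed

section \<open>Locally Lipschitz functions on open sets\<close>

lemma locally_lipschitz_onE:
  fixes f :: "'a::euclidean_space \<Rightarrow> real"
  assumes "open \<Omega>" "locally_lipschitz_on \<Omega> f" "x \<in> \<Omega>"
  obtains r L where "r > 0" "cball x r \<subseteq> \<Omega>" "L-lipschitz_on (cball x r) f"
proof -
  obtain r L where r: "r > 0" "L-lipschitz_on (cball x r \<inter> \<Omega>) f"
    using assms unfolding locally_lipschitz_on_def by blast
  obtain s where s: "s > 0" "cball x s \<subseteq> \<Omega>" using assms by (meson open_contains_cball)
  show ?thesis
  proof
    show "L-lipschitz_on (cball x (min r s)) f"
      using r(2) by (rule lipschitz_on_subset) (use s in auto)
  qed (use r s in auto)
qed

text \<open>By Lindelof's theorem countably many balls on whose closures \<open>f\<close> is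
  Lipschitz cover the domain. Composing \<open>f\<close> with the nearest-point projection onto such
  a closed ball gives a globally Lipschitz function that agrees with \<open>f\<close> on the open
  ball, so Rademacher's theorem applies.\<close>

lemma locally_lipschitz_AE_GDERIV:
  fixes f :: "'a::euclidean_space \<Rightarrow> real"
  assumes \<Omega>: "open \<Omega>" and f: "locally_lipschitz_on \<Omega> f"
  shows "AE x in lborel. x \<in> \<Omega> \<longrightarrow> GDERIV f x :> gradient f x"
proof -
  define \<F> where "\<F> = {ball x r | x r. \<exists>L. r > 0 \<and> cball x r \<subseteq> \<Omega> \<and> L-lipschitz_on (cball x r) f}"
  obtain \<F>' where F': "\<F>' \<subseteq> \<F>" "countable \<F>'" "\<Union>\<F>' = \<Union>\<F>"
    using Lindelof[of \<F>] by (auto simp: \<F>_def)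
  have cover: "\<Omega> \<subseteq> \<Union>\<F>"
  proof
    fix x assume "x \<in> \<Omega>"
    from locally_lipschitz_onE[OF \<Omega> f this] obtain r L where "r > 0" "cball x r \<subseteq> \<Omega>" "L-lipschitz_on (cball x r) f" .
    then have "ball x r \<in> \<F>" "x \<in> ball x r" by (auto simp: \<F>_def)
    then show "x \<in> \<Union>\<F>" by blast
  qed
  have loc: "AE x in lborel. x \<in> B \<longrightarrow> (\<exists>d. GDERIV f x :> d)" if "B \<in> \<F>" for B
  proof -
    from that obtain a r L where B: "B = ball a r" "r > 0" "L-lipschitz_on (cball a r) f"
      unfolding \<F>_def by blast
    define g where "g = f \<circ> closest_point (cball a r)"
    have ne: "cball a r \<noteq> {}" using B(2) by simp
    have "L-lipschitz_on UNIV g"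
    proof (rule lipschitz_onI)
      fix x y
      have "dist (g x) (g y) \<le> L * dist (closest_point (cball a r) x) (closest_point (cball a r) y)"
        unfolding g_def o_def using closest_point_in_set[OF closed_cball ne]
        by (intro lipschitz_onD[OF B(3)])
      also have "\<dots> \<le> L * dist x y"
        using lipschitz_on_nonneg[OF B(3)] closest_point_lipschitz[OF convex_cball closed_cball ne]
        by (intro mult_left_mono)
      finally show "dist (g x) (g y) \<le> L * dist x y" .
    qed (use lipschitz_on_nonneg[OF B(3)] in auto)
    from Rademacher[OF this] show ?thesis
    proof eventually_elim
      case (elim x)
      show ?case
      proof
        assume x: "x \<in> B"
        obtain d where "(g has_derivative (\<lambda>h. h \<bullet> d)) (at x)" using elim by (auto simp: gderiv_def)
        then have "(f has_derivative (\<lambda>h. h \<bullet> d)) (at x)"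
        proof (rule has_derivative_transform_within_open)
          show "open B" "x \<in> B" using B x by auto
          show "g y = f y" if "y \<in> B" for y
            using that by (simp add: g_def B closest_point_self)
        qed
        then show "\<exists>d. GDERIV f x :> d" by (auto simp: gderiv_def)
      qed
    qed
  qed
  have "AE x in lborel. \<forall>B\<in>\<F>'. x \<in> B \<longrightarrow> (\<exists>d. GDERIV f x :> d)"
    unfolding AE_ball_countable[OF F'(2)] using loc F'(1) by blast
  then show ?thesis
  proof eventually_elim
    case (elim x)
    show ?case
    proof
      assume "x \<in> \<Omega>"
      then obtain B where "B \<in> \<F>'" "x \<in> B" using cover F'(3) by blast
      then obtain d where d: "GDERIV f x :> d" using elim by blast
      show "GDERIV f x :> gradient f x"
        unfolding gradient_def
      proof (rule theI[where P = "\<lambda>D. GDERIV f x :> D", OF d])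
        fix d' assume "GDERIV f x :> d'"
        then have "(\<lambda>h. h \<bullet> d') = (\<lambda>h. h \<bullet> d)" using d unfolding gderiv_def by (rule has_derivative_unique)
        then show "d' = d" by (metis vector_eq_ldot)
      qed
    qed
  qed
qed

section \<open>Integration along John curves\<close>

text \<open>After a shift, the integral of G (s + t) - G s over [0, 1] is the integral of
  \<open>G\<close> over [1, 1 + t] minus that over [0, t]. These differ from t G 1 and t G 0 by at
  most L t^2 each, which leaves 2 L t after division by t.\<close>

lemma lipschitz_increment_le_mean_slope:
  fixes G :: "real \<Rightarrow> real"
  assumes lip: "L-lipschitz_on UNIV G" and t: "0 < t" "t \<le> 1"
  shows "\<bar>G 1 - G 0\<bar> \<le> (\<integral>s. indicator {0..1} s * \<bar>(G (s + t) - G s) / t\<bar> \<partial>lborel) + 2 * L * t"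
proof -
  have cont: "continuous_on A G" for A
    using lipschitz_on_continuous_on[OF lip] by (rule continuous_on_subset) simp
  have [measurable]: "G \<in> borel_measurable borel" using cont by (intro borel_measurable_continuous_onI)
  have L0: "L \<ge> 0" using lip by (rule lipschitz_on_nonneg)
  have Gi: "integrable lborel (\<lambda>s. indicator {a..b} s * G s)" for a b
    using borel_integrable_compact[of "{a..b}" G] cont by simp
  have Gi': "integrable lborel (\<lambda>s. indicator {0..1} s * G (s + t))"
    using borel_integrable_compact[of "{0..1}" "\<lambda>s. G (s + t)"]
    by (simp add: continuous_on_compose2[OF cont[of UNIV]] continuous_intros)
  have shift: "(\<integral>s. indicator {0..1} s * G (s + t) \<partial>lborel) = (\<integral>s. indicator {t..1+t} s * G s \<partial>lborel)"
  proof -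
    have "(\<integral>s. indicator {t..1+t} s * G s \<partial>lborel) = (\<integral>s. indicator {t..1+t} s * G s \<partial>distr lborel borel ((+) t))"
      by (simp add: lborel_distr_plus)
    also have "\<dots> = (\<integral>s. indicator {0..1} s * G (s + t) \<partial>lborel)"
      by (subst integral_distr) (auto simp: add.commute indicator_def intro!: Bochner_Integration.integral_cong)
    finally show ?thesis by simp
  qed
  \<comment> \<open>The intervals [t, 1 + t] and [0, 1] differ exactly by these two end pieces of
    length \<open>t\<close>.\<close>
  define I J :: "real \<Rightarrow> real" where "I = indicator {1<..1+t}" and "J = indicator {0..<t}"
  have [measurable]: "I \<in> borel_measurable borel" "J \<in> borel_measurable borel" unfolding I_def J_def by measurable
  have intI: "integrable lborel I" "integrable lborel J" "integral\<^sup>L lborel I = t" "integral\<^sup>L lborel J = t"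
    using t by (auto simp: I_def J_def integrable_indicator_iff)
  have GI: "integrable lborel (\<lambda>s. I s * G s)" "integrable lborel (\<lambda>s. J s * G s)"
  proof -
    show "integrable lborel (\<lambda>s. I s * G s)"
      by (rule Bochner_Integration.integrable_bound[OF Gi[of 1 "1+t"]]) (auto simp: I_def split: split_indicator)
    show "integrable lborel (\<lambda>s. J s * G s)"
      by (rule Bochner_Integration.integrable_bound[OF Gi[of 0 t]]) (auto simp: J_def split: split_indicator)
  qed
  have "(\<integral>s. indicator {0..1} s * (G (s + t) - G s) \<partial>lborel)
      = (\<integral>s. indicator {t..1+t} s * G s \<partial>lborel) - (\<integral>s. indicator {0..1} s * G s \<partial>lborel)"
    unfolding shift[symmetric] using Gi[of 0 1] Gi'
    by (subst Bochner_Integration.integral_diff[symmetric]) (auto simp: right_diff_distrib)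
  also have "\<dots> = (\<integral>s. indicator {t..1+t} s * G s - indicator {0..1} s * G s \<partial>lborel)"
    using Gi by (subst Bochner_Integration.integral_diff) auto
  also have "\<dots> = (\<integral>s. I s * G s - J s * G s \<partial>lborel)"
    using t by (intro Bochner_Integration.integral_cong) (auto simp: I_def J_def indicator_def)
  also have "\<dots> = (\<integral>s. (I s * (G s - G 1) - J s * (G s - G 0)) + (I s * G 1 - J s * G 0) \<partial>lborel)"
    by (intro Bochner_Integration.integral_cong) (auto simp: algebra_simps)
  also have "\<dots> = (\<integral>s. I s * (G s - G 1) - J s * (G s - G 0) \<partial>lborel) + (\<integral>s. I s * G 1 - J s * G 0 \<partial>lborel)"
    using GI intI by (intro Bochner_Integration.integral_add) (auto simp: right_diff_distrib)
  also have "(\<integral>s. I s * G 1 - J s * G 0 \<partial>lborel) = t * (G 1 - G 0)"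
    using intI by (simp add: right_diff_distrib)
  finally have eq: "t * (G 1 - G 0) = (\<integral>s. indicator {0..1} s * (G (s + t) - G s) \<partial>lborel)
      - (\<integral>s. I s * (G s - G 1) - J s * (G s - G 0) \<partial>lborel)" by simp
  have err: "\<bar>\<integral>s. I s * (G s - G 1) - J s * (G s - G 0) \<partial>lborel\<bar> \<le> 2 * L * t * t"
  proof -
    have b: "\<bar>I s * (G s - G 1) - J s * (G s - G 0)\<bar> \<le> L * t * (I s + J s)" for s
    proof -
      have "\<bar>G s - G 1\<bar> \<le> L * t" if "s \<in> {1<..1+t}"
        using lipschitz_onD[OF lip, of s 1] that mult_left_mono[of "\<bar>s - 1\<bar>" t L] L0 by (auto simp: dist_real_def)
      then have 1: "\<bar>I s * (G s - G 1)\<bar> \<le> L * t * I s" by (auto simp: I_def split: split_indicator)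
      have "\<bar>G s - G 0\<bar> \<le> L * t" if "s \<in> {0..<t}"
        using lipschitz_onD[OF lip, of s 0] that mult_left_mono[of "\<bar>s\<bar>" t L] L0 by (auto simp: dist_real_def)
      then have 2: "\<bar>J s * (G s - G 0)\<bar> \<le> L * t * J s" by (auto simp: J_def split: split_indicator)
      show ?thesis using 1 2 by (simp add: distrib_left)
    qed
    have "norm (\<integral>s. I s * (G s - G 1) - J s * (G s - G 0) \<partial>lborel) \<le> (\<integral>s. L * t * (I s + J s) \<partial>lborel)"
    proof (rule Bochner_Integration.integral_norm_bound_integral)
      show "integrable lborel (\<lambda>s. I s * (G s - G 1) - J s * (G s - G 0))"
        using GI intI by (simp add: right_diff_distrib)
      show "integrable lborel (\<lambda>s. L * t * (I s + J s))" using intI by simp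
    qed (use b in auto)
    then show ?thesis using intI by simp
  qed
  have pi: "integrable lborel (\<lambda>s. indicator {0..1} s * (G (s + t) - G s))"
    using Gi[of 0 1] Gi' by (simp add: right_diff_distrib)
  have "\<bar>\<integral>s. indicator {0..1} s * (G (s + t) - G s) \<partial>lborel\<bar> \<le> (\<integral>s. \<bar>indicator {0..1} s * (G (s + t) - G s)\<bar> \<partial>lborel)"
    by (rule integral_abs_bound)
  also have "\<dots> = (\<integral>s. t * (indicator {0..1} s * \<bar>(G (s + t) - G s) / t\<bar>) \<partial>lborel)"
    using t by (intro Bochner_Integration.integral_cong) (auto simp: abs_mult split: split_indicator)
  finally have 3: "\<bar>\<integral>s. indicator {0..1} s * (G (s + t) - G s) \<partial>lborel\<bar>
    \<le> t * (\<integral>s. indicator {0..1} s * \<bar>(G (s + t) - G s) / t\<bar> \<partial>lborel)" by simp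
  have "t * \<bar>G 1 - G 0\<bar> = \<bar>t * (G 1 - G 0)\<bar>" using t by (simp add: abs_mult)
  also have "\<dots> \<le> t * (\<integral>s. indicator {0..1} s * \<bar>(G (s + t) - G s) / t\<bar> \<partial>lborel) + 2 * L * t * t"
    unfolding eq using err 3 by linarith
  also have "\<dots> = t * ((\<integral>s. indicator {0..1} s * \<bar>(G (s + t) - G s) / t\<bar> \<partial>lborel) + 2 * L * t)"
    by (simp add: algebra_simps)
  finally show ?thesis using t by simp
qed

text \<open>In the mean slope bound let t tend to 0 along 1 / (n + 1): the error 2 L t disappears,
  and reverse Fatou, with \<open>L\<close> on [0, 1] as majorant, moves the upper limit under the
  integral. The hypothesis bounds difference quotients instead of a derivative, since that is what
  differentiability of \<open>f\<close> supplies along a merely Lipschitz curve.\<close>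

lemma lipschitz_increment_le_nn_integral:
  fixes G :: "real \<Rightarrow> real" and k :: "real \<Rightarrow> ennreal"
  assumes lip: "L-lipschitz_on UNIV G"
    and slope: "AE s in lborel. s \<in> {0<..<1} \<longrightarrow> (\<forall>e>0. \<forall>\<^sub>F h in at_right 0. ennreal \<bar>(G (s + h) - G s) / h\<bar> \<le> k s + ennreal e)"
  shows "ennreal \<bar>G 1 - G 0\<bar> \<le> (\<integral>\<^sup>+s. k s * indicator {0..1} s \<partial>lborel)"
proof -
  have cont: "continuous_on UNIV G" using lipschitz_on_continuous_on[OF lip] .
  have [measurable]: "G \<in> borel_measurable borel" using cont by (intro borel_measurable_continuous_onI)
  have L0: "L \<ge> 0" using lip by (rule lipschitz_on_nonneg)
  define t where "t n = 1 / real (Suc n)" for n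
  have t: "0 < t n" "t n \<le> 1" for n by (auto simp: t_def)
  have t0: "t \<longlonglongrightarrow> 0" unfolding t_def using LIMSEQ_inverse_real_of_nat by (simp add: inverse_eq_divide)
  have tr: "filterlim t (at_right 0) sequentially"
    unfolding filterlim_at using t0 t(1) by (simp add: less_imp_neq[THEN not_sym])
  define D where "D n s = indicator {0..1} s * \<bar>(G (s + t n) - G s) / t n\<bar>" for n s
  have Dm[measurable]: "D n \<in> borel_measurable borel" for n unfolding D_def by measurable
  have Db: "0 \<le> D n s" "D n s \<le> L * indicator {0..1} s" for n s
    using slope_abs_le[OF lip, of "t n" s 1] t[of n] by (auto simp: D_def split: split_indicator)
  have Di: "integrable lborel (D n)" for n
  proof (rule Bochner_Integration.integrable_bound)
    show "integrable lborel (\<lambda>s. L * indicator {0..1::real} s)" by (auto simp: integrable_indicator_iff)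
    show "AE x in lborel. norm (D n x) \<le> norm (L * indicator {0..1} x)" using Db L0 by (auto split: split_indicator)
  qed measurable
  have ge: "ennreal (\<bar>G 1 - G 0\<bar> - 2 * L * t n) \<le> (\<integral>\<^sup>+s. ennreal (D n s) \<partial>lborel)" for n
  proof -
    have "\<bar>G 1 - G 0\<bar> - 2 * L * t n \<le> integral\<^sup>L lborel (D n)"
      using lipschitz_increment_le_mean_slope[OF lip t(1,2)[of n]] by (simp add: D_def[abs_def])
    then have "ennreal (\<bar>G 1 - G 0\<bar> - 2 * L * t n) \<le> ennreal (integral\<^sup>L lborel (D n))" by (rule ennreal_leI)
    then show ?thesis using Db Di by (simp add: nn_integral_eq_integral)
  qed
  have "(\<lambda>n. ennreal (\<bar>G 1 - G 0\<bar> - 2 * L * t n)) \<longlonglongrightarrow> ennreal (\<bar>G 1 - G 0\<bar> - 2 * L * 0)"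
    by (intro tendsto_intros t0)
  then have "ennreal \<bar>G 1 - G 0\<bar> = limsup (\<lambda>n. ennreal (\<bar>G 1 - G 0\<bar> - 2 * L * t n))"
    using lim_imp_Limsup[OF sequentially_bot] by force
  also have "\<dots> \<le> limsup (\<lambda>n. \<integral>\<^sup>+s. ennreal (D n s) \<partial>lborel)"
    by (intro Limsup_mono always_eventually allI ge)
  also have "\<dots> \<le> (\<integral>\<^sup>+s. limsup (\<lambda>n. ennreal (D n s)) \<partial>lborel)"
  proof (rule nn_integral_limsup)
    show "AE s in lborel. ennreal (D n s) \<le> ennreal (L * indicator {0..1} s)" for n
      using Db by (intro AE_I2 ennreal_leI) auto
    have "(\<integral>\<^sup>+s. ennreal (L * indicator {0..1::real} s) \<partial>lborel) = (\<integral>\<^sup>+s. ennreal L * indicator {0..1::real} s \<partial>lborel)"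
      by (intro nn_integral_cong) (auto split: split_indicator)
    then show "(\<integral>\<^sup>+s. ennreal (L * indicator {0..1::real} s) \<partial>lborel) < \<infinity>"
      by (simp add: nn_integral_cmult_indicator)
  qed measurable
  also have "\<dots> \<le> (\<integral>\<^sup>+s. k s * indicator {0..1} s \<partial>lborel)"
  proof (rule nn_integral_mono_AE)
    have "AE s in lborel. s \<notin> {0, 1::real}"
      by (intro AE_not_in countable_imp_null_set_lborel) auto
    with slope show "AE s in lborel. limsup (\<lambda>n. ennreal (D n s)) \<le> k s * indicator {0..1} s"
    proof eventually_elim
      case (elim s)
      show ?case
      proof (cases "s \<in> {0..1}")
        case True
        then have s: "s \<in> {0<..<1}" using elim by auto
        show ?thesis
        proof (rule ennreal_le_epsilon)
          fix e :: real assume "e > 0"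
          then have "\<forall>\<^sub>F h in at_right 0. ennreal \<bar>(G (s + h) - G s) / h\<bar> \<le> k s + ennreal e"
            using elim s by blast
          then have "\<forall>\<^sub>F n in sequentially. ennreal (D n s) \<le> k s + ennreal e"
            using filterlim_iff[THEN iffD1, OF tr] True by (fastforce simp: D_def)
          then show "limsup (\<lambda>n. ennreal (D n s)) \<le> k s * indicator {0..1} s + ennreal e"
            using True by (simp add: Limsup_bounded)
        qed
      qed (simp add: D_def Limsup_const)
    qed
  qed
  finally show ?thesis .
qed

text \<open>In a finite cover by balls of half the radius, two points of \<open>C\<close> closer
  than \<epsilon> share a full ball, where a local constant applies. For points farther apart the
  bound \<open>M\<close> of |f| gives the constant 2 M / \<epsilon>.\<close>

lemma locally_lipschitz_on_compact:
  fixes f :: "'a::euclidean_space \<Rightarrow> real"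
  assumes \<Omega>: "open \<Omega>" and f: "locally_lipschitz_on \<Omega> f" and C: "compact C" "C \<subseteq> \<Omega>"
  shows "\<exists>L. L-lipschitz_on C f"
proof -
  have "\<forall>x\<in>C. \<exists>r L. r > 0 \<and> cball x r \<subseteq> \<Omega> \<and> L-lipschitz_on (cball x r) f"
  proof
    fix x assume "x \<in> C"
    then have "x \<in> \<Omega>" using C by auto
    from locally_lipschitz_onE[OF \<Omega> f this]
    show "\<exists>r L. r > 0 \<and> cball x r \<subseteq> \<Omega> \<and> L-lipschitz_on (cball x r) f" by blast
  qed
  then obtain r L where rL: "\<And>x. x \<in> C \<Longrightarrow> r x > 0" "\<And>x. x \<in> C \<Longrightarrow> (L x)-lipschitz_on (cball x (r x)) f"
    by metis
  have "C \<subseteq> (\<Union>x\<in>C. ball x (r x / 2))" using rL by force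
  then obtain D where D: "D \<subseteq> C" "finite D" "C \<subseteq> (\<Union>x\<in>D. ball x (r x / 2))"
    using compactE_image[OF C(1), of C "\<lambda>x. ball x (r x / 2)"] by auto
  have "continuous_on C f"
  proof (rule continuous_at_imp_continuous_on, rule ballI)
    fix x assume x: "x \<in> C"
    have "continuous_on (ball x (r x)) f"
      using rL(2)[OF x] by (meson ball_subset_cball continuous_on_subset lipschitz_on_continuous_on)
    then show "isCont f x" using rL(1)[OF x] by (simp add: continuous_on_eq_continuous_at)
  qed
  then obtain M where M: "\<And>x. x \<in> C \<Longrightarrow> \<bar>f x\<bar> \<le> M"
    using compact_imp_bounded[OF compact_continuous_image[OF _ C(1)]] by (force simp: bounded_iff)
  define \<epsilon> where "\<epsilon> = Min (insert 1 ((\<lambda>x. r x / 2) ` D))"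
  have \<epsilon>: "\<epsilon> > 0" "\<And>x. x \<in> D \<Longrightarrow> \<epsilon> \<le> r x / 2"
  proof -
    have fin: "finite (insert 1 ((\<lambda>x. r x / 2) ` D))" using D(2) by simp
    have "y > 0" if "y \<in> insert 1 ((\<lambda>x. r x / 2) ` D)" for y
      using that rL(1) D(1) by fastforce
    then show "\<epsilon> > 0" unfolding \<epsilon>_def using Min_in[OF fin] by blast
    show "\<epsilon> \<le> r x / 2" if "x \<in> D" for x
      unfolding \<epsilon>_def using that by (intro Min_le[OF fin]) auto
  qed
  define K where "K = (\<Sum>x\<in>D. L x) + 2 * \<bar>M\<bar> / \<epsilon>"
  have L0: "0 \<le> L x" if "x \<in> D" for x using rL(2) D(1) that lipschitz_on_nonneg by blast
  then have LK: "L x + 2 * \<bar>M\<bar> / \<epsilon> \<le> K" if "x \<in> D" for x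
    unfolding K_def using D(2) that by (auto intro!: member_le_sum)
  have K0: "2 * \<bar>M\<bar> / \<epsilon> \<le> K" unfolding K_def using L0 by (simp add: sum_nonneg)
  have M\<epsilon>: "2 * \<bar>M\<bar> / \<epsilon> \<ge> 0" using \<epsilon> by simp
  have "K-lipschitz_on C f"
  proof (rule lipschitz_onI)
    fix x y assume xy: "x \<in> C" "y \<in> C"
    show "dist (f x) (f y) \<le> K * dist x y"
    proof (cases "dist x y < \<epsilon>")
      case True
      obtain a where a: "a \<in> D" "dist a x < r a / 2" using D(3) xy by (auto simp: subset_iff)
      have "dist a y \<le> dist a x + dist x y" by (rule dist_triangle)
      then have "dist a y \<le> r a" using True a \<epsilon>(2)[OF a(1)] by linarith
      moreover have "dist a x \<le> r a" using a(2) zero_le_dist[of a x] by linarith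
      ultimately have "x \<in> cball a (r a)" "y \<in> cball a (r a)" by auto
      then have "dist (f x) (f y) \<le> L a * dist x y" using rL(2) D(1) a(1) by (meson lipschitz_onD subsetD)
      also have "\<dots> \<le> K * dist x y" using LK[OF a(1)] M\<epsilon> by (intro mult_right_mono) auto
      finally show ?thesis .
    next
      case False
      have "dist (f x) (f y) \<le> 2 * \<bar>M\<bar>" using M[OF xy(1)] M[OF xy(2)] by (simp add: dist_real_def)
      also have "\<dots> = 2 * \<bar>M\<bar> / \<epsilon> * \<epsilon>" using \<epsilon> by simp
      also have "\<dots> \<le> K * dist x y" using False K0 M\<epsilon> \<epsilon>(1) order_trans[OF M\<epsilon> K0] by (intro mult_mono) auto
      finally show ?thesis .
    qed
  qed (use K0 M\<epsilon> in auto)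
  then show ?thesis ..
qed

text \<open>The value \<open>s powr - real DIM('a)\<close> is the inverse Jacobian of
  \<open>z \<mapsto> \<gamma> s + s z\<close>. The side conditions retain of the curve only its
  starting point, its speed and its distance from the boundary.\<close>

definition john_kernel :: "real \<Rightarrow> real \<Rightarrow> 'a::euclidean_space set \<Rightarrow> real \<Rightarrow> 'a \<Rightarrow> 'a \<Rightarrow> ennreal" where
  "john_kernel K r \<Omega> s x y =
    (if 0 < s \<and> s \<le> 1 \<and> x \<in> \<Omega> \<and> dist x y \<le> K * s \<and> r * s \<le> bdry_dist \<Omega> x
     then ennreal (s powr - real DIM('a)) else 0)"

definition john_op :: "real \<Rightarrow> real \<Rightarrow> 'a::euclidean_space set \<Rightarrow> ('a \<Rightarrow> ennreal) \<Rightarrow> 'a \<Rightarrow> ennreal" where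
  "john_op K r \<Omega> G y = (\<integral>\<^sup>+s. (\<integral>\<^sup>+x. john_kernel K r \<Omega> s x y * G x \<partial>lborel) \<partial>lborel)"

lemma nn_integral_lborel_affine:
  fixes H :: "'a::euclidean_space \<Rightarrow> ennreal"
  assumes [measurable]: "H \<in> borel_measurable borel" and s: "s > 0"
  shows "(\<integral>\<^sup>+z. H (c + s *\<^sub>R z) \<partial>lborel) = ennreal (s powr - real DIM('a)) * (\<integral>\<^sup>+x. H x \<partial>lborel)"
proof -
  have "(\<integral>\<^sup>+x. H x \<partial>lborel)
      = (\<integral>\<^sup>+x. H x \<partial>density (distr lborel borel (\<lambda>z. c + s *\<^sub>R z)) (\<lambda>_. ennreal (\<bar>s\<bar> ^ DIM('a))))"
    using lborel_affine[of s c] s by simp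
  also have "\<dots> = (\<integral>\<^sup>+z. ennreal (\<bar>s\<bar> ^ DIM('a)) * H (c + s *\<^sub>R z) \<partial>lborel)"
    by (simp add: nn_integral_density nn_integral_distr)
  also have "\<dots> = ennreal (s ^ DIM('a)) * (\<integral>\<^sup>+z. H (c + s *\<^sub>R z) \<partial>lborel)"
    using s by (simp add: nn_integral_cmult)
  finally have "ennreal (s powr - real DIM('a)) * (\<integral>\<^sup>+x. H x \<partial>lborel)
    = ennreal (s powr - real DIM('a) * s ^ DIM('a)) * (\<integral>\<^sup>+z. H (c + s *\<^sub>R z) \<partial>lborel)"
    by (simp add: ennreal_mult' mult.assoc)
  also have "s powr - real DIM('a) * s ^ DIM('a) = 1"
    using s by (simp add: powr_minus powr_realpow)
  finally show ?thesis by simp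
qed

lemma nn_integral_ball_affine:
  fixes G :: "'a::euclidean_space \<Rightarrow> ennreal"
  assumes [measurable]: "G \<in> borel_measurable borel" and s: "s > 0"
  shows "(\<integral>\<^sup>+z. indicator (ball 0 r) z * G (a + s *\<^sub>R z) \<partial>lborel)
    = ennreal (s powr - real DIM('a)) * (\<integral>\<^sup>+x. indicator (ball a (s * r)) x * G x \<partial>lborel)"
proof -
  have "indicator (ball 0 r) z = (indicator (ball a (s * r)) (a + s *\<^sub>R z) :: ennreal)" for z
    using s by (auto simp: dist_norm split: split_indicator)
  moreover have [measurable]: "ball a (s * r) \<in> sets borel" by simp
  have "(\<lambda>x. indicator (ball a (s * r)) x * G x) \<in> borel_measurable borel" by measurable
  ultimately show ?thesis
    using nn_integral_lborel_affine[of "\<lambda>x. indicator (ball a (s * r)) x * G x" s a] s by simp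
qed

lemma john_kernel_measurable:
  assumes \<Omega>: "open \<Omega>"
  shows "(\<lambda>x. john_kernel K r \<Omega> s x y) \<in> borel_measurable borel"
    "(\<lambda>(s, x, y). john_kernel K r \<Omega> s x y) \<in> borel_measurable (borel \<Otimes>\<^sub>M (borel \<Otimes>\<^sub>M borel))"
proof -
  have [measurable]: "\<Omega> \<in> sets borel" using \<Omega> by simp
  have [measurable]: "bdry_dist \<Omega> \<in> borel_measurable borel"
    unfolding bdry_dist_def by (intro borel_measurable_continuous_onI continuous_intros)
  show 2: "(\<lambda>(s, x, y). john_kernel K r \<Omega> s x y) \<in> borel_measurable (borel \<Otimes>\<^sub>M (borel \<Otimes>\<^sub>M borel))"
    unfolding john_kernel_def by measurable
  show "(\<lambda>x. john_kernel K r \<Omega> s x y) \<in> borel_measurable borel"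
    unfolding john_kernel_def by measurable
qed

text \<open>A ball about a point of \<open>\<Omega>\<close> that leaves \<open>\<Omega>\<close> is
  connected, so it meets the frontier, at a distance less than \<open>R\<close> from the
  centre.\<close>

lemma ball_subset_if_bdry_dist_ge:
  fixes x :: "'a::euclidean_space"
  assumes "x \<in> \<Omega>" "R \<le> bdry_dist \<Omega> x"
  shows "ball x R \<subseteq> \<Omega>"
proof (rule ccontr)
  assume ns: "\<not> ball x R \<subseteq> \<Omega>"
  then have "R > 0" by (metis ball_empty empty_subsetI not_le)
  then have "ball x R \<inter> frontier \<Omega> \<noteq> {}"
    using ns assms(1) centre_in_ball[of x R] by (intro connected_Int_frontier connected_ball) blast+
  then obtain z where "z \<in> frontier \<Omega>" "dist x z < R" by auto
  then show False using infdist_le[of z "frontier \<Omega>" x] assms(2) by (simp add: bdry_dist_def)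
qed

text \<open>Differentiability of \<open>\<gamma>\<close> plays no role: at points where \<open>f\<close> is differentiable, the Lipschitz
  bound for the perturbed curve already bounds the difference quotients of \<open>f\<close> along it.\<close>

lemma john_op_lower_bound:
  fixes f :: "'a::euclidean_space \<Rightarrow> real" and G :: "'a \<Rightarrow> ennreal"
  assumes \<Omega>: "open \<Omega>" and f: "locally_lipschitz_on \<Omega> f"
    and G[measurable]: "G \<in> borel_measurable borel"
    and grad: "AE x in lborel. x \<in> \<Omega> \<longrightarrow> (\<exists>d. GDERIV f x :> d \<and> ennreal (norm d) \<le> G x)"
    and \<gamma>: "K0-lipschitz_on {0..1} \<gamma>" "\<gamma> 0 = y" "\<gamma> 1 = x0"
      "\<And>s. s \<in> {0..1} \<Longrightarrow> \<gamma> s \<in> \<Omega> \<and> 2 * r * s \<le> bdry_dist \<Omega> (\<gamma> s)"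
    and r: "r > 0"
    and H: "H \<in> sets borel" "H \<subseteq> ball 0 r" "\<And>z. z \<in> H \<Longrightarrow> f (x0 + z) = 0"
      "emeasure lborel (ball (0::'a) r) \<le> 2 * emeasure lborel H"
  shows "ennreal \<bar>f y\<bar> * emeasure lborel (ball (0::'a) r) \<le> ennreal (2 * (K0 + r)) * john_op (K0 + r) r \<Omega> G y"
proof -
  note H(1)[measurable]
  \<comment> \<open>By time \<open>s\<close> the curve has moved at most \<open>K0 s\<close> away
    from \<open>y\<close>, and the perturbation adds less than \<open>r s\<close>.\<close>
  define K where "K = K0 + r"
  have K0: "K0 \<ge> 0" using \<gamma>(1) by (rule lipschitz_on_nonneg)
  have K: "K > 0" using K0 r by (simp add: K_def)
  define B where "B = ball (0::'a) r"
  have [measurable]: "B \<in> sets borel" by (simp add: B_def)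
  \<comment> \<open>Clamping the time to [0, 1] extends the curves to the line, because the
    increment bound asks for a Lipschitz function on \<open>UNIV\<close>.\<close>
  define c :: "real \<Rightarrow> real" where "c s = max 0 (min 1 s)" for s
  have c01: "c s \<in> {0..1}" for s by (auto simp: c_def)
  have cid: "c s = s" if "s \<in> {0..1}" for s using that by (auto simp: c_def)
  have clip: "\<bar>c s - c t\<bar> \<le> \<bar>s - t\<bar>" for s t by (auto simp: c_def max_def min_def)
  define p where "p z s = \<gamma> (c s) + c s *\<^sub>R z" for z s
  have \<gamma>lip: "K0-lipschitz_on UNIV (\<lambda>s. \<gamma> (c s))"
  proof (rule lipschitz_onI)
    fix s t
    have "dist (\<gamma> (c s)) (\<gamma> (c t)) \<le> K0 * dist (c s) (c t)"
      using lipschitz_onD[OF \<gamma>(1)] c01 by blast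
    also have "\<dots> \<le> K0 * dist s t" using clip K0 by (intro mult_left_mono) (auto simp: dist_real_def)
    finally show "dist (\<gamma> (c s)) (\<gamma> (c t)) \<le> K0 * dist s t" .
  qed (rule K0)
  have [measurable]: "(\<lambda>s. \<gamma> (c s)) \<in> borel_measurable borel"
    using lipschitz_on_continuous_on[OF \<gamma>lip] by (rule borel_measurable_continuous_onI)
  have [measurable]: "c \<in> borel_measurable borel" unfolding c_def[abs_def] by measurable
  have plip: "K-lipschitz_on UNIV (p z)" if "z \<in> B" for z
  proof (rule lipschitz_onI)
    fix s t
    have "dist (p z s) (p z t) = norm ((\<gamma> (c s) - \<gamma> (c t)) + (c s - c t) *\<^sub>R z)"
      by (simp add: p_def dist_norm algebra_simps)
    also have "\<dots> \<le> norm (\<gamma> (c s) - \<gamma> (c t)) + norm ((c s - c t) *\<^sub>R z)" by (rule norm_triangle_ineq)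
    also have "\<dots> \<le> K0 * \<bar>s - t\<bar> + \<bar>s - t\<bar> * r"
      using lipschitz_onD[OF \<gamma>lip, of s t] clip[of s t] that
      by (intro add_mono) (auto simp: dist_norm B_def intro!: mult_mono)
    finally show "dist (p z s) (p z t) \<le> K * dist s t" by (simp add: K_def dist_real_def algebra_simps)
  qed (use K in simp)
  \<comment> \<open>The perturbation uses up less than \<open>r s\<close> of the distance
    \<open>2 r s\<close> to the boundary.\<close>
  have bd: "x \<in> \<Omega>" "r * s \<le> bdry_dist \<Omega> x" if s: "0 < s" "s \<le> 1" and x: "dist (\<gamma> s) x < s * r" for s x
  proof -
    have g: "\<gamma> s \<in> \<Omega>" "2 * r * s \<le> bdry_dist \<Omega> (\<gamma> s)" using \<gamma>(4) s by auto
    have "x \<in> ball (\<gamma> s) (2 * r * s)" using x mult_pos_pos[OF s(1) r] by (simp add: mult_ac)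
    then show "x \<in> \<Omega>" using ball_subset_if_bdry_dist_ge[OF g] by blast
    have "bdry_dist \<Omega> (\<gamma> s) \<le> bdry_dist \<Omega> x + dist (\<gamma> s) x"
      unfolding bdry_dist_def by (rule infdist_triangle)
    then show "r * s \<le> bdry_dist \<Omega> x" using g(2) x by (simp add: algebra_simps)
  qed
  have p\<Omega>: "p z s \<in> \<Omega>" if "z \<in> B" for z s
  proof (cases "c s = 0")
    case True
    then show ?thesis using \<gamma>(4)[of 0] by (simp add: p_def)
  next
    case False
    then have "0 < c s" "c s \<le> 1" using c01[of s] by auto
    moreover have "dist (\<gamma> (c s)) (p z s) < c s * r"
      using that \<open>0 < c s\<close> by (simp add: p_def dist_norm B_def)
    ultimately show ?thesis by (rule bd(1))
  qed
  obtain N where N: "N \<in> null_sets lborel"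
    "\<And>x. x \<notin> N \<Longrightarrow> x \<in> \<Omega> \<Longrightarrow> \<exists>d. GDERIV f x :> d \<and> ennreal (norm d) \<le> G x"
    using grad by (force elim: AE_E3)
  have [measurable]: "N \<in> sets borel" using N(1) by auto
  have "(\<integral>\<^sup>+z. (\<integral>\<^sup>+s. indicator N (p z s) * indicator {0<..1} s \<partial>lborel) \<partial>lborel)
      = (\<integral>\<^sup>+s. (\<integral>\<^sup>+z. indicator N (p z s) * indicator {0<..1} s \<partial>lborel) \<partial>lborel)"
    unfolding p_def by (rule lborel_pair.Fubini') measurable
  also have "\<dots> = (\<integral>\<^sup>+(s::real). 0 \<partial>lborel)"
  proof (rule nn_integral_cong)
    fix s :: real
    show "(\<integral>\<^sup>+z. indicator N (p z s) * indicator {0<..1} s \<partial>lborel) = 0"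
    proof (cases "s \<in> {0<..1}")
      case True
      then have "(\<integral>\<^sup>+z. indicator N (p z s) * indicator {0<..1} s \<partial>lborel) = (\<integral>\<^sup>+z. indicator N (\<gamma> s + s *\<^sub>R z) \<partial>lborel)"
        by (simp add: p_def cid)
      also have "\<dots> = 0" using True N(1) by (subst nn_integral_lborel_affine) auto
      finally show ?thesis .
    qed simp
  qed
  finally have z0: "(\<integral>\<^sup>+z. (\<integral>\<^sup>+s. indicator N (p z s) * indicator {0<..1} s \<partial>lborel) \<partial>lborel) = 0" by simp
  \<comment> \<open>Tonelli has reversed the quantifiers. For each \<open>s\<close> in (0, 1] only a
    null set of \<open>z\<close> puts \<open>p z s\<close> into \<open>N\<close>; hence for almost
    every \<open>z\<close> the curve \<open>p z\<close> avoids \<open>N\<close> at almost all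
    times.\<close>
  have "AE z in lborel. (\<integral>\<^sup>+s. indicator N (p z s) * indicator {0<..1} s \<partial>lborel) = 0"
    by (rule nn_integral_0_iff_AE[THEN iffD1, OF _ z0]) (unfold p_def, measurable)
  then have bound: "AE z in lborel. z \<in> H \<longrightarrow>
      ennreal \<bar>f y\<bar> \<le> (\<integral>\<^sup>+s. ennreal K * G (p z s) * indicator {0..1} s \<partial>lborel)"
  proof eventually_elim
    case (elim z)
    show ?case
    proof
      assume zH: "z \<in> H"
      then have z: "z \<in> B" using H(2) by (auto simp: B_def)
      have sN: "AE s in lborel. indicator N (p z s) * indicator {0<..1} s = (0::ennreal)"
        by (rule nn_integral_0_iff_AE[THEN iffD1, OF _ elim]) (unfold p_def, measurable)
      \<comment> \<open>Some Lipschitz constant \<open>M\<close> of \<open>f\<close> along the curve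
        must exist, but its size does not enter the resulting bound.\<close>
      have "compact (p z ` {0..1})"
        using plip[OF z] by (intro compact_continuous_image) (auto intro: continuous_on_subset lipschitz_on_continuous_on)
      then obtain M where M: "M-lipschitz_on (p z ` {0..1}) f"
        using locally_lipschitz_on_compact[OF \<Omega> f, of "p z ` {0..1}"] p\<Omega>[OF z] by auto
      have pim: "p z s \<in> p z ` {0..1}" for s
        using c01[of s] by (intro image_eqI[of _ _ "c s"]) (auto simp: p_def cid)
      have glip: "(M * K)-lipschitz_on UNIV (\<lambda>s. f (p z s))"
      proof (rule lipschitz_onI)
        fix s t
        have "dist (f (p z s)) (f (p z t)) \<le> M * dist (p z s) (p z t)" using pim by (intro lipschitz_onD[OF M])
        also have "\<dots> \<le> M * (K * dist s t)"
          using lipschitz_onD[OF plip[OF z], of s t] lipschitz_on_nonneg[OF M] by (intro mult_left_mono) auto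
        finally show "dist (f (p z s)) (f (p z t)) \<le> M * K * dist s t" by (simp add: mult.assoc)
      qed (use lipschitz_on_nonneg[OF M] K in simp)
      have "ennreal \<bar>f (p z 1) - f (p z 0)\<bar> \<le> (\<integral>\<^sup>+s. ennreal K * G (p z s) * indicator {0..1} s \<partial>lborel)"
      proof (rule lipschitz_increment_le_nn_integral[OF glip])
        show "AE s in lborel. s \<in> {0<..<1} \<longrightarrow> (\<forall>e>0. \<forall>\<^sub>F h in at_right 0.
            ennreal \<bar>(f (p z (s + h)) - f (p z s)) / h\<bar> \<le> ennreal K * G (p z s) + ennreal e)"
          using sN
        proof eventually_elim
          case (elim s)
          show ?case
          proof (intro impI allI)
            fix e :: real assume s: "s \<in> {0<..<1}" and e: "0 < e"
            then have "p z s \<notin> N" using elim by (auto split: split_indicator_asm)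
            then obtain d where d: "GDERIV f (p z s) :> d" "ennreal (norm d) \<le> G (p z s)"
              using N(2) p\<Omega>[OF z] by blast
            have eK: "e / K > 0" using e K by simp
            from d(1) obtain \<delta> where \<delta>: "\<delta> > 0"
              "\<And>x. norm (x - p z s) < \<delta> \<Longrightarrow> norm (f x - f (p z s) - (x - p z s) \<bullet> d) \<le> e / K * norm (x - p z s)"
              unfolding gderiv_def has_derivative_at_alt using eK by blast
            have "\<forall>\<^sub>F h in at_right 0. 0 < h \<and> h < \<delta> / K"
              using \<delta>(1) K by (auto simp: eventually_at_right_field intro!: exI[of _ "\<delta> / K"])
            then show "\<forall>\<^sub>F h in at_right 0.
                ennreal \<bar>(f (p z (s + h)) - f (p z s)) / h\<bar> \<le> ennreal K * G (p z s) + ennreal e"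
            proof eventually_elim
              case (elim h)
              define x where "x = p z (s + h)"
              have nx: "norm (x - p z s) \<le> K * h"
                using lipschitz_onD[OF plip[OF z], of "s + h" s] elim by (simp add: x_def dist_norm)
              also have "K * h < \<delta>" using elim K by (simp add: field_simps)
              finally have "\<bar>f x - f (p z s) - (x - p z s) \<bullet> d\<bar> \<le> e / K * norm (x - p z s)"
                using \<delta>(2) by simp
              moreover have "\<bar>(x - p z s) \<bullet> d\<bar> \<le> norm (x - p z s) * norm d" by (rule Cauchy_Schwarz_ineq2)
              ultimately have "\<bar>f x - f (p z s)\<bar> \<le> (norm d + e / K) * norm (x - p z s)"
                by (simp add: algebra_simps abs_if split: if_splits)
              also have "\<dots> \<le> (norm d + e / K) * (K * h)" using nx eK by (intro mult_left_mono) auto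
              also have "\<dots> = (K * norm d + e) * h" using K by (simp add: field_simps)
              finally have "\<bar>(f x - f (p z s)) / h\<bar> \<le> K * norm d + e"
                using elim by (simp add: abs_divide divide_le_eq)
              then have "ennreal \<bar>(f x - f (p z s)) / h\<bar> \<le> ennreal (K * norm d + e)" by (rule ennreal_leI)
              also have "\<dots> = ennreal K * ennreal (norm d) + ennreal e"
                using K e by (simp add: ennreal_mult)
              also have "\<dots> \<le> ennreal K * G (p z s) + ennreal e"
                using d(2) by (intro add_mono mult_left_mono) auto
              finally show ?case by (simp add: x_def)
            qed
          qed
        qed
      qed
      moreover have "p z 0 = y" "p z 1 = x0 + z" using \<gamma> by (auto simp: p_def cid)
      ultimately show "ennreal \<bar>f y\<bar> \<le> (\<integral>\<^sup>+s. ennreal K * G (p z s) * indicator {0..1} s \<partial>lborel)"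
        using H(3)[OF zH] by simp
    qed
  qed
  have pm[measurable]: "(\<lambda>(z, s). p z s) \<in> borel_measurable (borel \<Otimes>\<^sub>M borel)"
    unfolding p_def by measurable
  \<comment> \<open>\<open>H\<close> fills at least half of the ball, at the cost of a factor 2.
    Enlarging the domain of integration from \<open>H\<close> to the whole ball then removes
    \<open>H\<close> from the estimate.\<close>
  have "ennreal \<bar>f y\<bar> * emeasure lborel (ball (0::'a) r) \<le> ennreal \<bar>f y\<bar> * (2 * emeasure lborel H)"
    using H(4) by (intro mult_left_mono) auto
  also have "\<dots> = 2 * (\<integral>\<^sup>+z. ennreal \<bar>f y\<bar> * indicator H z \<partial>lborel)"
    by (subst nn_integral_cmult_indicator) (auto simp: mult.left_commute)
  also have "(\<integral>\<^sup>+z. ennreal \<bar>f y\<bar> * indicator H z \<partial>lborel)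
      \<le> (\<integral>\<^sup>+z. (\<integral>\<^sup>+s. indicator B z * (ennreal K * G (p z s) * indicator {0..1} s) \<partial>lborel) \<partial>lborel)"
  proof (rule nn_integral_mono_AE)
    show "AE z in lborel. ennreal \<bar>f y\<bar> * indicator H z
        \<le> (\<integral>\<^sup>+s. indicator B z * (ennreal K * G (p z s) * indicator {0..1} s) \<partial>lborel)"
      using bound
    proof eventually_elim
      case (elim z)
      show ?case using elim H(2) by (auto simp: B_def split: split_indicator)
    qed
  qed
  also have "\<dots> = (\<integral>\<^sup>+s. (\<integral>\<^sup>+z. indicator B z * (ennreal K * G (p z s) * indicator {0..1} s) \<partial>lborel) \<partial>lborel)"
    by (rule lborel_pair.Fubini') measurable
  also have "\<dots> \<le> (\<integral>\<^sup>+s. ennreal K * (\<integral>\<^sup>+x. john_kernel K r \<Omega> s x y * G x \<partial>lborel) \<partial>lborel)"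
  proof (rule nn_integral_mono_AE)
    have "AE s in lborel. s \<noteq> (0::real)" by (rule AE_lborel_singleton)
    then show "AE s in lborel. (\<integral>\<^sup>+z. indicator B z * (ennreal K * G (p z s) * indicator {0..1} s) \<partial>lborel)
        \<le> ennreal K * (\<integral>\<^sup>+x. john_kernel K r \<Omega> s x y * G x \<partial>lborel)"
    proof eventually_elim
      case (elim s)
      show ?case
      proof (cases "s \<in> {0..1}")
        case True
        then have s: "0 < s" "s \<le> 1" using elim by auto
        have "(\<integral>\<^sup>+z. indicator B z * (ennreal K * G (p z s) * indicator {0..1} s) \<partial>lborel)
            = (\<integral>\<^sup>+z. indicator (ball 0 r) z * (ennreal K * G (\<gamma> s + s *\<^sub>R z)) \<partial>lborel)"
          using True by (simp add: p_def cid B_def)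
        also have "\<dots> = ennreal (s powr - real DIM('a)) * (\<integral>\<^sup>+x. indicator (ball (\<gamma> s) (s * r)) x * (ennreal K * G x) \<partial>lborel)"
          using s by (intro nn_integral_ball_affine) simp_all
        also have "\<dots> = (\<integral>\<^sup>+x. ennreal (s powr - real DIM('a)) * (indicator (ball (\<gamma> s) (s * r)) x * (ennreal K * G x)) \<partial>lborel)"
          by (intro nn_integral_cmult[symmetric] borel_measurable_times_ennreal borel_measurable_indicator) simp_all
        also have "\<dots> \<le> (\<integral>\<^sup>+x. ennreal K * (john_kernel K r \<Omega> s x y * G x) \<partial>lborel)"
        proof (rule nn_integral_mono)
          fix x
          show "ennreal (s powr - real DIM('a)) * (indicator (ball (\<gamma> s) (s * r)) x * (ennreal K * G x)) \<le> ennreal K * (john_kernel K r \<Omega> s x y * G x)"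
          proof (cases "x \<in> ball (\<gamma> s) (s * r)")
            case x: True
            then have xs: "dist (\<gamma> s) x < s * r" by simp
            have "dist x y \<le> dist x (\<gamma> s) + dist (\<gamma> s) y" by (rule dist_triangle)
            also have "dist (\<gamma> s) y \<le> K0 * s"
              using lipschitz_onD[OF \<gamma>(1), of s 0] s \<gamma>(2) by (simp add: dist_real_def)
            finally have "dist x y \<le> K * s" using xs by (simp add: K_def dist_commute algebra_simps)
            then show ?thesis using s bd[OF s xs] x by (simp add: john_kernel_def mult_ac)
          qed simp
        qed
        also have "\<dots> = ennreal K * (\<integral>\<^sup>+x. john_kernel K r \<Omega> s x y * G x \<partial>lborel)"
          by (intro nn_integral_cmult borel_measurable_times_ennreal) (simp_all add: john_kernel_measurable(1)[OF \<Omega>])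
        finally show ?thesis .
      qed simp
    qed
  qed
  also have "\<dots> = ennreal K * john_op K r \<Omega> G y"
    unfolding john_op_def 
  proof (rule nn_integral_cmult)
    have "(\<lambda>(s, x). john_kernel K r \<Omega> s x y * G x) \<in> borel_measurable (borel \<Otimes>\<^sub>M borel)"
    proof -
      have "(\<lambda>q. (fst q, snd q, y)) \<in> borel \<Otimes>\<^sub>M borel \<rightarrow>\<^sub>M borel \<Otimes>\<^sub>M (borel \<Otimes>\<^sub>M borel)" by measurable
      from measurable_compose[OF this john_kernel_measurable(2)[OF \<Omega>]]
      have [measurable]: "(\<lambda>q. john_kernel K r \<Omega> (fst q) (snd q) y) \<in> borel_measurable (borel \<Otimes>\<^sub>M borel)" by simp
      show ?thesis unfolding case_prod_beta by measurable
    qed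
    then show "(\<lambda>s. \<integral>\<^sup>+x. john_kernel K r \<Omega> s x y * G x \<partial>lborel) \<in> borel_measurable lborel"
      by measurable
  qed
  finally show ?thesis using K by (simp add: K_def[symmetric] ennreal_mult mult.assoc mult_left_mono)
qed

section \<open>Weighted weak type bound\<close>

text \<open>The summand \<open>1\<close> of the constant covers \<open>\<alpha> = 1\<close>, where \<open>1 / (1 - \<alpha>) = 0\<close>. For \<open>\<alpha> < 1\<close> the range
  is split at \<open>s = (m / W) powr (1 / n)\<close>, where the two terms of the minimum agree.\<close>

lemma nn_integral_min_powr_le:
  fixes n \<alpha> D W m :: real
  assumes \<alpha>: "0 \<le> \<alpha>" "\<alpha> \<le> 1" "1 - \<alpha> < n" and n: "n \<ge> 1" and D: "D \<ge> 0" and W: "W \<ge> 0" and m: "m > 0"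
  shows "(\<integral>\<^sup>+s. indicator {0<..D} s * ennreal (s powr - n * min m (W * s powr n)) \<partial>lborel)
    \<le> ennreal ((1 + 1 / (1 - \<alpha>) + 1 / (n - 1 + \<alpha>)) * D powr \<alpha> * W powr ((n - 1 + \<alpha>) / n) * m powr ((1 - \<alpha>) / n))"
proof (cases "\<alpha> = 1")
  case True
  have "(\<integral>\<^sup>+s. indicator {0<..D} s * ennreal (s powr - n * min m (W * s powr n)) \<partial>lborel)
      \<le> (\<integral>\<^sup>+s. ennreal W * indicator {0<..D} s \<partial>lborel)"
  proof (rule nn_integral_mono)
    fix s :: real
    have "s powr - n * min m (W * s powr n) \<le> W" if "0 < s"
    proof -
      have "s powr - n * min m (W * s powr n) \<le> s powr - n * (W * s powr n)" by (intro mult_left_mono) auto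
      also have "\<dots> = W" using that by (simp add: powr_minus)
      finally show ?thesis .
    qed
    then show "indicator {0<..D} s * ennreal (s powr - n * min m (W * s powr n)) \<le> ennreal W * indicator {0<..D} s"
      by (auto split: split_indicator intro: ennreal_leI)
  qed
  also have "\<dots> = ennreal (W * D)"
    using D W by (simp add: nn_integral_cmult_indicator ennreal_mult)
  also have "\<dots> \<le> ennreal ((1 + 1 / (1 - \<alpha>) + 1 / (n - 1 + \<alpha>)) * D powr \<alpha> * W powr ((n - 1 + \<alpha>) / n) * m powr ((1 - \<alpha>) / n))"
    using True n D W m by (intro ennreal_leI) (simp add: algebra_simps mult_nonneg_nonneg)
  finally show ?thesis .
next
  case False
  then have a1: "\<alpha> < 1" using \<alpha> by simp
  \<comment> \<open>In the application this is 1 / p with p = n / (n - 1 + \<alpha>).\<close>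
  define \<theta> where "\<theta> = (n - 1 + \<alpha>) / n"
  have \<theta>: "(1 - \<alpha>) / n = 1 - \<theta>" using n by (simp add: \<theta>_def field_simps)
  show ?thesis
  proof (cases "W = 0")
    case True
    then show ?thesis using m by (simp add: min_def)
  next
    case False
    then have W0: "W > 0" using W by simp
    define R where "R = (m / W) powr (1 / n)"
    have R: "R > 0" using m W0 by (simp add: R_def)
    have i1: "((\<lambda>s. if s \<in> {0..R} then s powr - \<alpha> else 0) has_integral (R powr (1 - \<alpha>) / (1 - \<alpha>))) UNIV"
      using has_integral_powr_from_0[of "- \<alpha>" R] a1 R by (subst has_integral_restrict_UNIV) (simp add: add.commute)
    have i2: "((\<lambda>s. if s \<in> {R..} then s powr (- n - \<alpha>) else 0) has_integral (R powr (1 - n - \<alpha>) / (n - 1 + \<alpha>))) UNIV"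
      using has_integral_powr_to_inf[of "- n - \<alpha>" R] \<alpha> R
      by (subst has_integral_restrict_UNIV) (simp add: algebra_simps minus_divide_right)
    have n1: "(\<integral>\<^sup>+s. ennreal (if s \<in> {0..R} then s powr - \<alpha> else 0) \<partial>lborel) = ennreal (R powr (1 - \<alpha>) / (1 - \<alpha>))"
      by (rule nn_integral_has_integral_lborel[OF _ _ i1]) auto
    have n2: "(\<integral>\<^sup>+s. ennreal (if s \<in> {R..} then s powr (- n - \<alpha>) else 0) \<partial>lborel) = ennreal (R powr (1 - n - \<alpha>) / (n - 1 + \<alpha>))"
      by (rule nn_integral_has_integral_lborel[OF _ _ i2]) auto
    have "(\<integral>\<^sup>+s. indicator {0<..D} s * ennreal (s powr - n * min m (W * s powr n)) \<partial>lborel)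
      \<le> (\<integral>\<^sup>+s. ennreal (D powr \<alpha>) * (ennreal W * ennreal (if s \<in> {0..R} then s powr - \<alpha> else 0)
            + ennreal m * ennreal (if s \<in> {R..} then s powr (- n - \<alpha>) else 0)) \<partial>lborel)"
    proof (rule nn_integral_mono)
      fix s :: real
      show "indicator {0<..D} s * ennreal (s powr - n * min m (W * s powr n))
         \<le> ennreal (D powr \<alpha>) * (ennreal W * ennreal (if s \<in> {0..R} then s powr - \<alpha> else 0)
            + ennreal m * ennreal (if s \<in> {R..} then s powr (- n - \<alpha>) else 0))"
      proof (cases "s \<in> {0<..D}")
        case True
        then have s: "0 < s" "s \<le> D" by auto
        \<comment> \<open>The cap \<open>s \<le> D\<close> trades \<open>s powr \<alpha>\<close> for
          \<open>D powr \<alpha>\<close>. What remains is integrable up to \<open>R\<close> because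
          \<alpha> < 1, and beyond \<open>R\<close> because n + \<alpha> > 1.\<close>
        have sn: "s powr - n \<le> D powr \<alpha> * s powr (- n - \<alpha>)"
        proof -
          have "s powr - n = s powr \<alpha> * s powr (- n - \<alpha>)" using s by (simp add: powr_add[symmetric])
          also have "\<dots> \<le> D powr \<alpha> * s powr (- n - \<alpha>)" using s \<alpha> by (intro mult_right_mono powr_mono2) auto
          finally show ?thesis .
        qed
        have "s powr - n * min m (W * s powr n) \<le> D powr \<alpha> * s powr (- n - \<alpha>) * min m (W * s powr n)"
          using sn m W by (intro mult_right_mono) auto
        also have "\<dots> \<le> D powr \<alpha> * (W * (if s \<in> {0..R} then s powr - \<alpha> else 0)
              + m * (if s \<in> {R..} then s powr (- n - \<alpha>) else 0))"
        proof (cases "s \<le> R")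
          case True
          have "s powr (- n - \<alpha>) * min m (W * s powr n) \<le> s powr (- n - \<alpha>) * (W * s powr n)"
            by (intro mult_left_mono) auto
          also have "\<dots> = W * s powr - \<alpha>" using s by (simp add: powr_add[symmetric])
          also have "\<dots> \<le> W * (if s \<in> {0..R} then s powr - \<alpha> else 0)
              + m * (if s \<in> {R..} then s powr (- n - \<alpha>) else 0)" using True s m by simp
          finally show ?thesis by (simp add: mult.assoc mult_left_mono)
        next
          case False
          have "s powr (- n - \<alpha>) * min m (W * s powr n) \<le> s powr (- n - \<alpha>) * m"
            by (intro mult_left_mono) auto
          also have "\<dots> \<le> W * (if s \<in> {0..R} then s powr - \<alpha> else 0)
              + m * (if s \<in> {R..} then s powr (- n - \<alpha>) else 0)" using False s W by simp
          finally show ?thesis by (simp add: mult.assoc mult_left_mono)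
        qed
        finally have "ennreal (s powr - n * min m (W * s powr n))
          \<le> ennreal (D powr \<alpha> * (W * (if s \<in> {0..R} then s powr - \<alpha> else 0)
              + m * (if s \<in> {R..} then s powr (- n - \<alpha>) else 0)))" by (rule ennreal_leI)
        also have "\<dots> = ennreal (D powr \<alpha>) * (ennreal W * ennreal (if s \<in> {0..R} then s powr - \<alpha> else 0)
              + ennreal m * ennreal (if s \<in> {R..} then s powr (- n - \<alpha>) else 0))"
          using W m by (subst ennreal_mult) (auto simp: ennreal_mult)
        finally show ?thesis using True by simp
      qed simp
    qed
    also have "\<dots> = ennreal (D powr \<alpha>) * (ennreal W * ennreal (R powr (1 - \<alpha>) / (1 - \<alpha>))
        + ennreal m * ennreal (R powr (1 - n - \<alpha>) / (n - 1 + \<alpha>)))"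
      by (simp add: nn_integral_cmult nn_integral_add n1[simplified] n2[simplified])
    also have "\<dots> = ennreal (D powr \<alpha> * (W * R powr (1 - \<alpha>) / (1 - \<alpha>) + m * R powr (1 - n - \<alpha>) / (n - 1 + \<alpha>)))"
    proof -
      have "ennreal W * ennreal a + ennreal m * ennreal b = ennreal (W * a + m * b)" if "a \<ge> 0" "b \<ge> 0" for a b
        using W m that by (simp add: ennreal_mult)
      from this[of "R powr (1 - \<alpha>) / (1 - \<alpha>)" "R powr (1 - n - \<alpha>) / (n - 1 + \<alpha>)"]
      show ?thesis using a1 \<alpha> by (simp add: ennreal_mult')
    qed
    also have "W * R powr (1 - \<alpha>) = W powr \<theta> * m powr (1 - \<theta>)"
    proof -
      have "W * R powr (1 - \<alpha>) = W powr 1 * (m / W) powr (1 - \<theta>)"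
        using W0 by (simp add: R_def powr_powr \<theta>[symmetric])
      also have "\<dots> = W powr (1 - (1 - \<theta>)) * m powr (1 - \<theta>)"
        using W0 m by (subst powr_diff) (simp add: powr_divide)
      finally show ?thesis by simp
    qed
    also have "m * R powr (1 - n - \<alpha>) = W powr \<theta> * m powr (1 - \<theta>)"
    proof -
      have "(1 - n - \<alpha>) / n = - \<theta>" using n by (simp add: \<theta>_def field_simps)
      then have "m * R powr (1 - n - \<alpha>) = m powr 1 * (m / W) powr - \<theta>"
        using m by (simp add: R_def powr_powr)
      also have "\<dots> = m powr (1 - \<theta>) * W powr \<theta>"
        using W0 m by (subst powr_diff) (simp add: powr_divide powr_minus field_simps)
      finally show ?thesis by (simp add: mult.commute)
    qed
    finally have le: "(\<integral>\<^sup>+s. indicator {0<..D} s * ennreal (s powr - n * min m (W * s powr n)) \<partial>lborel)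
      \<le> ennreal (D powr \<alpha> * (W powr \<theta> * m powr (1 - \<theta>) / (1 - \<alpha>) + W powr \<theta> * m powr (1 - \<theta>) / (n - 1 + \<alpha>)))" .
    have "D powr \<alpha> * (W powr \<theta> * m powr (1 - \<theta>) / (1 - \<alpha>) + W powr \<theta> * m powr (1 - \<theta>) / (n - 1 + \<alpha>))
      \<le> (1 + 1 / (1 - \<alpha>) + 1 / (n - 1 + \<alpha>)) * D powr \<alpha> * W powr \<theta> * m powr (1 - \<theta>)"
      by (simp add: algebra_simps)
    from order_trans[OF le ennreal_leI[OF this]] show ?thesis unfolding \<theta> \<theta>_def[symmetric] .
  qed
qed

text \<open>Tonelli lets the integration in \<open>y\<close> come first. For fixed \<open>x\<close>
  and \<open>s\<close> it yields \<open>s powr - n\<close> times the mass of \<open>E\<close> near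
  \<open>x\<close>, at most the full mass \<open>m\<close> and at most the ball bound
  \<open>W * s powr n\<close>; the kernel also forces s <= d / r. The integral in \<open>s\<close>
  is then the one-dimensional estimate with D = d / r.\<close>

lemma john_op_weighted_le:
  fixes \<Omega> :: "'a::euclidean_space set" and u G :: "'a \<Rightarrow> ennreal" and w :: "'a \<Rightarrow> real" and \<alpha> m K r :: real
  defines "n \<equiv> real DIM('a)"
  defines "p \<equiv> n / (n - 1 + \<alpha>)"
  assumes \<Omega>: "open \<Omega>" and \<alpha>: "0 \<le> \<alpha>" "\<alpha> \<le> 1" "1 - \<alpha> < n" and K: "K > 0" and r: "r > 0"
    and [measurable]: "u \<in> borel_measurable borel" "G \<in> borel_measurable borel"
      "w \<in> borel_measurable borel" "E \<in> sets borel"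
    and w: "\<And>x. w x \<ge> 0" and C1: "C1 \<ge> 0"
    and ball: "AE x in lborel. x \<in> \<Omega> \<longrightarrow>
      (\<forall>\<rho>>0. (\<integral>\<^sup>+y. u y * indicator (cball x \<rho>) y \<partial>lborel) \<le> ennreal (C1 * w x powr p * \<rho> powr n))"
    and m: "m > 0" "(\<integral>\<^sup>+y. u y * indicator E y \<partial>lborel) = ennreal m"
  shows "(\<integral>\<^sup>+y. john_op K r \<Omega> G y * (u y * indicator E y) \<partial>lborel)
    \<le> ennreal ((1 + 1 / (1 - \<alpha>) + 1 / (n - 1 + \<alpha>)) * (1 / r) powr \<alpha> * (C1 * K powr n) powr (1 / p) * m powr ((1 - \<alpha>) / n))
      * (\<integral>\<^sup>+x\<in>\<Omega>. G x * ennreal (bdry_dist \<Omega> x powr \<alpha> * w x) \<partial>lborel)"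
proof -
  have n: "n \<ge> 1" unfolding n_def using DIM_positive[where 'a = 'a] by linarith
  have p: "p > 0" "1 / p = (n - 1 + \<alpha>) / n" using \<alpha> n by (auto simp: p_def)
  have [measurable]: "\<Omega> \<in> sets borel" using \<Omega> by simp
  have [measurable]: "bdry_dist \<Omega> \<in> borel_measurable borel"
    unfolding bdry_dist_def by (intro borel_measurable_continuous_onI continuous_intros)
  define A where "A = (1 + 1 / (1 - \<alpha>) + 1 / (n - 1 + \<alpha>)) * (1 / r) powr \<alpha> * (C1 * K powr n) powr (1 / p) * m powr ((1 - \<alpha>) / n)"
  have A0: "A \<ge> 0" unfolding A_def using \<alpha> by (intro mult_nonneg_nonneg add_nonneg_nonneg) auto
  define k where "k s x y = john_kernel K r \<Omega> s x y" for s x y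
  define v where "v y = u y * indicator E y" for y
  have [measurable]: "v \<in> borel_measurable borel" unfolding v_def by measurable
  have km[measurable (raw)]: "(\<lambda>z. k (f z) (g z) (h z)) \<in> borel_measurable M"
    if "f \<in> borel_measurable M" "g \<in> borel_measurable M" "h \<in> borel_measurable M" for M :: "'c measure" and f g h
  proof -
    have "(\<lambda>z. (f z, g z, h z)) \<in> M \<rightarrow>\<^sub>M borel \<Otimes>\<^sub>M (borel \<Otimes>\<^sub>M borel)" using that by measurable
    from measurable_compose[OF this john_kernel_measurable(2)[OF \<Omega>]] show ?thesis by (simp add: k_def)
  qed
  have "(\<integral>\<^sup>+y. john_op K r \<Omega> G y * v y \<partial>lborel)
      = (\<integral>\<^sup>+y. (\<integral>\<^sup>+s. (\<integral>\<^sup>+x. k s x y * G x * v y \<partial>lborel) \<partial>lborel) \<partial>lborel)"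
    unfolding john_op_def k_def[symmetric] by (simp add: nn_integral_multc)
  also have "\<dots> = (\<integral>\<^sup>+s. (\<integral>\<^sup>+y. (\<integral>\<^sup>+x. k s x y * G x * v y \<partial>lborel) \<partial>lborel) \<partial>lborel)"
    by (rule lborel_pair.Fubini') measurable
  also have "\<dots> = (\<integral>\<^sup>+s. (\<integral>\<^sup>+x. (\<integral>\<^sup>+y. k s x y * G x * v y \<partial>lborel) \<partial>lborel) \<partial>lborel)"
    by (intro nn_integral_cong lborel_pair.Fubini') measurable
  also have "\<dots> = (\<integral>\<^sup>+x. (\<integral>\<^sup>+s. (\<integral>\<^sup>+y. k s x y * G x * v y \<partial>lborel) \<partial>lborel) \<partial>lborel)"
    by (rule lborel_pair.Fubini') measurable
  also have "\<dots> \<le> (\<integral>\<^sup>+x. ennreal A * (G x * ennreal (bdry_dist \<Omega> x powr \<alpha> * w x) * indicator \<Omega> x) \<partial>lborel)"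
  proof (rule nn_integral_mono_AE)
    show "AE x in lborel. (\<integral>\<^sup>+s. (\<integral>\<^sup>+y. k s x y * G x * v y \<partial>lborel) \<partial>lborel)
        \<le> ennreal A * (G x * ennreal (bdry_dist \<Omega> x powr \<alpha> * w x) * indicator \<Omega> x)"
      using ball
    proof eventually_elim
      case (elim x)
      show ?case
      proof (cases "x \<in> \<Omega>")
        case False
        then show ?thesis by (simp add: k_def john_kernel_def)
      next
        case True
        define d where "d = bdry_dist \<Omega> x"
        have d0: "d \<ge> 0" by (simp add: d_def bdry_dist_def infdist_nonneg)
        \<comment> \<open>The one-dimensional estimate raises this to the power 1 / p, which returns
          \<open>w x\<close> to the first power times a constant.\<close>
        define W where "W = C1 * w x powr p * K powr n"
        have W0: "W \<ge> 0" using C1 by (simp add: W_def)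
        have inner: "(\<integral>\<^sup>+y. k s x y * v y \<partial>lborel)
            \<le> indicator {0<..d / r} s * ennreal (s powr - n * min m (W * s powr n))" for s
        proof (cases "0 < s \<and> s \<le> 1 \<and> r * s \<le> d")
          case c: True
          then have "K * s > 0" using K by simp
          have "(\<integral>\<^sup>+y. k s x y * v y \<partial>lborel) = (\<integral>\<^sup>+y. ennreal (s powr - n) * (v y * indicator (cball x (K * s)) y) \<partial>lborel)"
            using c True by (intro nn_integral_cong) (auto simp: k_def john_kernel_def d_def n_def mult_ac split: split_indicator)
          also have "\<dots> = ennreal (s powr - n) * (\<integral>\<^sup>+y. v y * indicator (cball x (K * s)) y \<partial>lborel)"
            by (intro nn_integral_cmult borel_measurable_times_ennreal borel_measurable_indicator) simp_all
          also have "\<dots> \<le> ennreal (s powr - n) * ennreal (min m (W * s powr n))"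
          proof (rule mult_left_mono)
            have "(\<integral>\<^sup>+y. v y * indicator (cball x (K * s)) y \<partial>lborel) \<le> (\<integral>\<^sup>+y. u y * indicator E y \<partial>lborel)"
              by (intro nn_integral_mono) (auto simp: v_def split: split_indicator)
            then have 1: "(\<integral>\<^sup>+y. v y * indicator (cball x (K * s)) y \<partial>lborel) \<le> ennreal m" by (simp add: m(2))
            have "(\<integral>\<^sup>+y. v y * indicator (cball x (K * s)) y \<partial>lborel) \<le> (\<integral>\<^sup>+y. u y * indicator (cball x (K * s)) y \<partial>lborel)"
              by (intro nn_integral_mono) (auto simp: v_def split: split_indicator)
            also have "\<dots> \<le> ennreal (C1 * w x powr p * (K * s) powr n)"
              using elim True \<open>K * s > 0\<close> by blast
            also have "C1 * w x powr p * (K * s) powr n = W * s powr n"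
              using K c by (simp add: W_def powr_mult)
            finally show "(\<integral>\<^sup>+y. v y * indicator (cball x (K * s)) y \<partial>lborel) \<le> ennreal (min m (W * s powr n))"
              using 1 by (simp add: min_def)
          qed simp
          also have "\<dots> = indicator {0<..d / r} s * ennreal (s powr - n * min m (W * s powr n))"
            using c r by (simp add: ennreal_mult' field_simps)
          finally show ?thesis .
        next
          case False
          then have "k s x y = 0" for y by (auto simp: k_def john_kernel_def d_def[symmetric])
          then show ?thesis by simp
        qed
        have "(\<integral>\<^sup>+s. (\<integral>\<^sup>+y. k s x y * G x * v y \<partial>lborel) \<partial>lborel)
            = (\<integral>\<^sup>+s. G x * (\<integral>\<^sup>+y. k s x y * v y \<partial>lborel) \<partial>lborel)"
          by (intro nn_integral_cong, subst nn_integral_cmult[symmetric]) (auto simp: mult_ac)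
        also have "\<dots> = G x * (\<integral>\<^sup>+s. (\<integral>\<^sup>+y. k s x y * v y \<partial>lborel) \<partial>lborel)"
          by (intro nn_integral_cmult) measurable
        also have "(\<integral>\<^sup>+s. (\<integral>\<^sup>+y. k s x y * v y \<partial>lborel) \<partial>lborel)
            \<le> (\<integral>\<^sup>+s. indicator {0<..d / r} s * ennreal (s powr - n * min m (W * s powr n)) \<partial>lborel)"
          by (intro nn_integral_mono inner)
        also have "\<dots> \<le> ennreal ((1 + 1 / (1 - \<alpha>) + 1 / (n - 1 + \<alpha>)) * (d / r) powr \<alpha> * W powr ((n - 1 + \<alpha>) / n) * m powr ((1 - \<alpha>) / n))"
          using d0 r by (intro nn_integral_min_powr_le \<alpha> n W0 m(1)) simp
        also have "(1 + 1 / (1 - \<alpha>) + 1 / (n - 1 + \<alpha>)) * (d / r) powr \<alpha> * W powr ((n - 1 + \<alpha>) / n) * m powr ((1 - \<alpha>) / n)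
            = A * (d powr \<alpha> * w x)"
        proof -
          have "W powr (1 / p) = (C1 * K powr n) powr (1 / p) * (w x powr p) powr (1 / p)"
            unfolding W_def using C1 by (subst powr_mult[symmetric]) (auto simp: mult_ac)
          also have "(w x powr p) powr (1 / p) = w x" using w[of x] p(1) by (simp add: powr_powr)
          finally have "W powr ((n - 1 + \<alpha>) / n) = (C1 * K powr n) powr (1 / p) * w x" by (simp add: p(2))
          moreover have "(d / r) powr \<alpha> = d powr \<alpha> * (1 / r) powr \<alpha>"
            using d0 r powr_mult[of d "1 / r" \<alpha>] by simp
          ultimately show ?thesis by (simp add: A_def mult_ac)
        qed
        also have "G x * ennreal (A * (d powr \<alpha> * w x)) = ennreal A * (G x * ennreal (bdry_dist \<Omega> x powr \<alpha> * w x) * indicator \<Omega> x)"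
          using True A0 by (simp add: ennreal_mult' d_def mult_ac)
        finally show ?thesis by (simp add: mult_left_mono)
      qed
    qed
  qed
  also have "\<dots> = ennreal A * (\<integral>\<^sup>+x\<in>\<Omega>. G x * ennreal (bdry_dist \<Omega> x powr \<alpha> * w x) \<partial>lborel)"
    by (intro nn_integral_cmult) measurable
  finally show ?thesis unfolding A_def v_def .
qed

section \<open>Truncation\<close>

lemma locally_lipschitz_on_compose:
  fixes \<phi> :: "real \<Rightarrow> real"
  assumes "locally_lipschitz_on \<Omega> f" "M-lipschitz_on UNIV \<phi>"
  shows "locally_lipschitz_on \<Omega> (\<lambda>x. \<phi> (f x))"
  unfolding locally_lipschitz_on_def
proof
  fix x assume "x \<in> \<Omega>"
  then obtain r L where "r > 0" "L-lipschitz_on (cball x r \<inter> \<Omega>) f"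
    using assms(1) unfolding locally_lipschitz_on_def by blast
  moreover from this(2) have "(M * L)-lipschitz_on (cball x r \<inter> \<Omega>) (\<lambda>x. \<phi> (f x))"
    using lipschitz_on_compose2[of L "cball x r \<inter> \<Omega>" f M \<phi>] lipschitz_on_subset[OF assms(2)] by auto
  ultimately show "\<exists>r>0. \<exists>L. L-lipschitz_on (cball x r \<inter> \<Omega>) (\<lambda>x. \<phi> (f x))" by blast
qed

lemma locally_lipschitz_continuous_on:
  fixes f :: "'a::euclidean_space \<Rightarrow> real"
  assumes "open \<Omega>" "locally_lipschitz_on \<Omega> f"
  shows "continuous_on \<Omega> f"
proof (rule continuous_at_imp_continuous_on, rule ballI)
  fix x assume "x \<in> \<Omega>"
  from locally_lipschitz_onE[OF assms this] obtain r L where r: "r > 0" "L-lipschitz_on (cball x r) f" .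
  then have "continuous_on (ball x r) f"
    by (meson ball_subset_cball continuous_on_subset lipschitz_on_continuous_on)
  then show "isCont f x" using r(1) by (simp add: continuous_on_eq_continuous_at)
qed

lemma clamp_lipschitz: "1-lipschitz_on UNIV (\<lambda>t::real. max 0 (min (t - b) \<tau>))"
  by (rule lipschitz_onI) (auto simp: dist_real_def max_def min_def)

text \<open>Where \<open>f\<close> lies strictly between the two levels, the truncation is locally
  \<open>f - b\<close>. Everywhere else it attains its global minimum 0 or maximum \<tau>, so its
  derivative, which exists almost everywhere by Rademacher's theorem, must vanish.\<close>

lemma GDERIV_truncation:
  fixes f :: "'a::euclidean_space \<Rightarrow> real" and G :: "'a \<Rightarrow> ennreal"
  assumes \<Omega>: "open \<Omega>" and f: "locally_lipschitz_on \<Omega> f" and \<tau>: "\<tau> > 0"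
    and grad: "AE x in lborel. x \<in> \<Omega> \<longrightarrow> (\<exists>d. GDERIV f x :> d \<and> ennreal (norm d) \<le> G x)"
  shows "AE x in lborel. x \<in> \<Omega> \<longrightarrow> (\<exists>d. GDERIV (\<lambda>x. max 0 (min (f x - b) \<tau>)) x :> d \<and>
    ennreal (norm d) \<le> G x * indicator {x\<in>\<Omega>. b < f x \<and> f x < b + \<tau>} x)"
proof -
  define g where "g x = max 0 (min (f x - b) \<tau>)" for x
  have cont: "continuous_on \<Omega> f" by (rule locally_lipschitz_continuous_on[OF \<Omega> f])
  have "locally_lipschitz_on \<Omega> g"
    unfolding g_def by (rule locally_lipschitz_on_compose[OF f clamp_lipschitz])
  from locally_lipschitz_AE_GDERIV[OF \<Omega> this] grad
  have "AE x in lborel. x \<in> \<Omega> \<longrightarrow> (\<exists>d. GDERIV g x :> d \<and>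
    ennreal (norm d) \<le> G x * indicator {x\<in>\<Omega>. b < f x \<and> f x < b + \<tau>} x)"
  proof eventually_elim
    case (elim x)
    show ?case
    proof
      assume x: "x \<in> \<Omega>"
      show "\<exists>d. GDERIV g x :> d \<and> ennreal (norm d) \<le> G x * indicator {x\<in>\<Omega>. b < f x \<and> f x < b + \<tau>} x"
      proof (cases "b < f x \<and> f x < b + \<tau>")
        case True
        obtain d where d: "GDERIV f x :> d" "ennreal (norm d) \<le> G x" using elim x by blast
        have "open (\<Omega> \<inter> f -` {b<..<b+\<tau>})" using \<Omega> cont by (intro continuous_open_preimage) auto
        moreover have "((\<lambda>x. f x - b) has_derivative (\<lambda>h. h \<bullet> d)) (at x)"
          using d(1) unfolding gderiv_def by (auto intro!: derivative_eq_intros)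
        ultimately have "(g has_derivative (\<lambda>h. h \<bullet> d)) (at x)"
          using True x by (elim has_derivative_transform_within_open[rotated]) (auto simp: g_def)
        then show ?thesis using d True x by (auto simp: gderiv_def)
      next
        case False
        then have "(\<forall>y\<in>UNIV. g y \<le> g x) \<or> (\<forall>y\<in>UNIV. g x \<le> g y)"
          using \<tau> by (auto simp: g_def)
        moreover have D: "(g has_derivative (\<lambda>h. h \<bullet> gradient g x)) (at x)" using elim x by (simp add: gderiv_def)
        ultimately have "(\<lambda>h. h \<bullet> gradient g x) = (\<lambda>h. 0)"
          using differential_zero_maxmin[of x UNIV g "\<lambda>h. h \<bullet> gradient g x"] by auto
        then have "gradient g x = 0" by (metis inner_eq_zero_iff)
        then show ?thesis using elim x by (intro exI[of _ 0]) auto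
      qed
    qed
  qed
  then show ?thesis by (simp only: g_def[abs_def])
qed

text \<open>The weak bound is applied to the truncations of \<open>f - b\<close> between \<open>\<tau>\<close> and \<open>2 \<tau>\<close> for all dyadic \<open>\<tau>\<close>.
  They vanish on \<open>Z\<close>, and their gradients have disjoint supports.\<close>

lemma weak_to_strong_truncation:
  fixes f :: "'a::euclidean_space \<Rightarrow> real" and u v G :: "'a \<Rightarrow> ennreal"
  assumes \<Omega>: "open \<Omega>" and f: "locally_lipschitz_on \<Omega> f" and p: "p \<ge> 1" and A: "A \<ge> 0" and I: "I \<ge> 0"
    and [measurable]: "u \<in> borel_measurable borel" "v \<in> borel_measurable borel" "G \<in> borel_measurable borel"
    and grad: "AE x in lborel. x \<in> \<Omega> \<longrightarrow> (\<exists>d. GDERIV f x :> d \<and> ennreal (norm d) \<le> G x)"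
    and GI: "(\<integral>\<^sup>+x\<in>\<Omega>. G x * v x \<partial>lborel) \<le> ennreal I"
    and Z: "\<And>z. z \<in> Z \<Longrightarrow> f z \<le> b"
    and weak: "\<And>g G E t I. \<lbrakk>locally_lipschitz_on \<Omega> g; G \<in> borel_measurable borel;
      AE x in lborel. x \<in> \<Omega> \<longrightarrow> (\<exists>d. GDERIV g x :> d \<and> ennreal (norm d) \<le> G x);
      \<And>z. z \<in> Z \<Longrightarrow> g z = 0; E \<in> sets borel; E \<subseteq> \<Omega>; 0 < t; \<And>y. y \<in> E \<Longrightarrow> t \<le> \<bar>g y\<bar>; I \<ge> 0;
      (\<integral>\<^sup>+x\<in>\<Omega>. G x * v x \<partial>lborel) = ennreal I\<rbrakk>
      \<Longrightarrow> ennreal (t powr p) * (\<integral>\<^sup>+y. u y * indicator E y \<partial>lborel) \<le> ennreal (A * I powr p)"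
  shows "(\<integral>\<^sup>+y\<in>\<Omega>. ennreal (max 0 (f y - b) powr p) * u y \<partial>lborel) \<le> ennreal (4 powr p * A * I powr p)"
proof -
  have \<Omega>m[measurable]: "\<Omega> \<in> sets borel" using \<Omega> by simp
  have cont: "continuous_on \<Omega> f" by (rule locally_lipschitz_continuous_on[OF \<Omega> f])
  define f' where "f' x = indicator \<Omega> x *\<^sub>R f x" for x
  have [measurable]: "f' \<in> borel_measurable borel" unfolding f'_def
    using cont by (intro borel_measurable_continuous_on_indicator) auto
  \<comment> \<open>\<open>int_decode\<close> lists all integers, so that the dyadic scales in both
    directions form one series over the natural numbers.\<close>
  define \<tau> where "\<tau> i = 2 powr real_of_int (int_decode i)" for i
  have \<tau>0: "\<tau> i > 0" for i by (simp add: \<tau>_def)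
  \<comment> \<open>The truncation starting at level \<open>b + \<tau> i\<close> has its gradient on
    \<open>F i\<close> and reaches its full height \<open>\<tau> i\<close> on
    \<open>E i\<close>.\<close>
  define F where "F i = {x\<in>\<Omega>. b + \<tau> i < f x \<and> f x < b + \<tau> i + \<tau> i}" for i
  define E where "E i = {x\<in>\<Omega>. b + 2 * \<tau> i \<le> f x}" for i
  have "F i = {x\<in>\<Omega>. b + \<tau> i < f' x \<and> f' x < b + \<tau> i + \<tau> i}" "E i = {x\<in>\<Omega>. b + 2 * \<tau> i \<le> f' x}" for i
    by (auto simp: F_def E_def f'_def)
  then have [measurable]: "F i \<in> sets borel" "E i \<in> sets borel" for i by simp_all
  have Fdisj: "disjoint_family F"
    unfolding disjoint_family_on_def
  proof (intro ballI impI, rule ccontr)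
    fix i j assume ij: "i \<noteq> j" and "F i \<inter> F j \<noteq> {}"
    then obtain x where "x \<in> F i" "x \<in> F j" by auto
    then have lt: "\<tau> i < 2 * \<tau> j" "\<tau> j < 2 * \<tau> i" by (auto simp: F_def)
    have eq: "2 * \<tau> k = 2 powr real_of_int (int_decode k + 1)" for k by (simp add: \<tau>_def powr_add)
    have "int_decode i < int_decode j + 1" "int_decode j < int_decode i + 1"
      using lt unfolding eq unfolding \<tau>_def powr_less_cancel_iff[of "2::real", simplified] of_int_less_iff by auto
    then have "int_decode i = int_decode j" by simp
    then show False using ij by (simp add: int_decode_eq)
  qed
  define J where "J i = (\<integral>\<^sup>+x\<in>\<Omega>. G x * indicator (F i) x * v x \<partial>lborel)" for i
  have Jle: "J i \<le> ennreal I" for i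
    using GI unfolding J_def by (elim order_trans[rotated]) (auto intro!: nn_integral_mono split: split_indicator)
  have weakE: "ennreal ((4 * \<tau> i) powr p) * (\<integral>\<^sup>+y. u y * indicator (E i) y \<partial>lborel)
      \<le> ennreal (4 powr p * A * I powr (p - 1)) * J i" for i
  proof -
    obtain j where j: "J i = ennreal j" "j \<ge> 0" using Jle[of i] by (cases "J i") (auto simp: top_unique)
    have jI: "j \<le> I" using Jle[of i] j I by simp
    have "ennreal (\<tau> i powr p) * (\<integral>\<^sup>+y. u y * indicator (E i) y \<partial>lborel) \<le> ennreal (A * j powr p)"
    proof (rule weak)
      show "locally_lipschitz_on \<Omega> (\<lambda>x. max 0 (min (f x - (b + \<tau> i)) (\<tau> i)))"
        by (rule locally_lipschitz_on_compose[OF f clamp_lipschitz])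
      show "AE x in lborel. x \<in> \<Omega> \<longrightarrow> (\<exists>d. GDERIV (\<lambda>x. max 0 (min (f x - (b + \<tau> i)) (\<tau> i))) x :> d \<and>
          ennreal (norm d) \<le> G x * indicator (F i) x)"
        unfolding F_def by (rule GDERIV_truncation[OF \<Omega> f \<tau>0 grad])
      show "(\<integral>\<^sup>+x\<in>\<Omega>. G x * indicator (F i) x * v x \<partial>lborel) = ennreal j" using j by (simp add: J_def)
      show "max 0 (min (f z - (b + \<tau> i)) (\<tau> i)) = 0" if "z \<in> Z" for z
        using Z[OF that] \<tau>0[of i] by simp
      show "\<tau> i \<le> \<bar>max 0 (min (f y - (b + \<tau> i)) (\<tau> i))\<bar>" if "y \<in> E i" for y
        using that \<tau>0[of i] by (auto simp: E_def)
      show "E i \<in> sets borel" by measurable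
      show "(\<lambda>x. G x * indicator (F i) x) \<in> borel_measurable borel" by measurable
      show "E i \<subseteq> \<Omega>" by (auto simp: E_def)
    qed (use \<tau>0 j in auto)
    then have "ennreal (4 powr p) * (ennreal (\<tau> i powr p) * (\<integral>\<^sup>+y. u y * indicator (E i) y \<partial>lborel))
        \<le> ennreal (4 powr p) * ennreal (A * j powr p)" by (intro mult_left_mono) auto
    \<comment> \<open>From \<open>j \<le> I\<close> and \<open>p \<ge> 1\<close> the bound becomes
      linear in \<open>J i\<close>; in this form the disjointness of the \<open>F i\<close> can be
      summed.\<close>
    also have "\<dots> \<le> ennreal (4 powr p) * ennreal (A * (I powr (p - 1) * j))"
    proof (intro mult_left_mono ennreal_leI A)
      show "j powr p \<le> I powr (p - 1) * j"
      proof (cases "j = 0")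
        case False
        then have "j powr p = j powr (p - 1) * j" using j powr_add[of j "p - 1" 1] by simp
        also have "\<dots> \<le> I powr (p - 1) * j" using j jI p by (intro mult_right_mono powr_mono2) auto
        finally show ?thesis .
      qed simp
    qed simp
    finally show ?thesis
      using \<tau>0[of i] A I by (simp add: j powr_mult ennreal_mult' mult.assoc)
  qed
  have pw: "ennreal (max 0 (f y - b) powr p) * indicator \<Omega> y \<le> (\<Sum>i. ennreal ((4 * \<tau> i) powr p) * indicator (E i) y)" for y
  proof (cases "y \<in> \<Omega> \<and> b < f y")
    case True
    \<comment> \<open>The shift by -1 places \<open>f y - b\<close> between
      \<open>2 * \<tau> i\<close> and \<open>4 * \<tau> i\<close>. The lower bound puts
      \<open>y\<close> into \<open>E i\<close>, the upper one is the source of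
      \<open>4 powr p\<close>.\<close>
    define k where "k = \<lfloor>log 2 (f y - b)\<rfloor> - 1"
    define i where "i = int_encode k"
    have \<tau>i: "\<tau> i = 2 powr real_of_int k" by (simp add: \<tau>_def i_def)
    have "2 powr (real_of_int k + 1) \<le> 2 powr log 2 (f y - b)" unfolding k_def by (intro powr_mono) auto
    then have lo: "2 * \<tau> i \<le> f y - b" using True by (simp add: \<tau>i powr_add)
    have "2 powr log 2 (f y - b) \<le> 2 powr (real_of_int k + 2)"
      unfolding k_def by (intro powr_mono) (auto, linarith)
    then have hi: "f y - b \<le> 4 * \<tau> i" using True by (simp add: \<tau>i powr_add)
    have "ennreal (max 0 (f y - b) powr p) * indicator \<Omega> y \<le> ennreal ((4 * \<tau> i) powr p) * indicator (E i) y"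
      using True lo hi p by (auto simp: E_def intro!: ennreal_leI powr_mono2)
    also have "\<dots> \<le> (\<Sum>i. ennreal ((4 * \<tau> i) powr p) * indicator (E i) y)"
    proof -
      define h where "h j = ennreal ((4 * \<tau> j) powr p) * indicator (E j) y" for j
      have "h i \<le> suminf h" using sum_le_suminf[of h "{i}"] by simp
      then show ?thesis by (simp only: h_def[abs_def])
    qed
    finally show ?thesis .
  qed auto
  have "(\<integral>\<^sup>+y\<in>\<Omega>. ennreal (max 0 (f y - b) powr p) * u y \<partial>lborel)
      \<le> (\<integral>\<^sup>+y. (\<Sum>i. ennreal ((4 * \<tau> i) powr p) * (u y * indicator (E i) y)) \<partial>lborel)"
  proof (rule nn_integral_mono)
    fix y
    have "ennreal (max 0 (f y - b) powr p) * u y * indicator \<Omega> y = (ennreal (max 0 (f y - b) powr p) * indicator \<Omega> y) * u y"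
      by (simp add: mult_ac)
    also have "\<dots> \<le> (\<Sum>i. ennreal ((4 * \<tau> i) powr p) * indicator (E i) y) * u y"
      by (intro mult_right_mono pw) simp
    also have "\<dots> = (\<Sum>i. ennreal ((4 * \<tau> i) powr p) * (u y * indicator (E i) y))"
      by (simp add: ennreal_suminf_multc[symmetric] mult_ac)
    finally show "ennreal (max 0 (f y - b) powr p) * u y * indicator \<Omega> y
      \<le> (\<Sum>i. ennreal ((4 * \<tau> i) powr p) * (u y * indicator (E i) y))" .
  qed
  also have "\<dots> = (\<Sum>i. ennreal ((4 * \<tau> i) powr p) * (\<integral>\<^sup>+y. u y * indicator (E i) y \<partial>lborel))"
    by (subst nn_integral_suminf) (auto simp: nn_integral_cmult)
  also have "\<dots> \<le> (\<Sum>i. ennreal (4 powr p * A * I powr (p - 1)) * J i)"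
    by (intro suminf_le weakE) auto
  also have "\<dots> = ennreal (4 powr p * A * I powr (p - 1)) * (\<Sum>i. J i)"
    by (rule ennreal_suminf_cmult)
  also have "(\<Sum>i. J i) = (\<integral>\<^sup>+x. (\<Sum>i. G x * v x * indicator \<Omega> x * indicator (F i) x) \<partial>lborel)"
    unfolding J_def by (subst nn_integral_suminf) (auto simp: mult_ac)
  also have "\<dots> \<le> (\<integral>\<^sup>+x\<in>\<Omega>. G x * v x \<partial>lborel)"
  proof (rule nn_integral_mono)
    fix x
    have "(\<Sum>i. G x * v x * indicator \<Omega> x * indicator (F i) x) = G x * v x * indicator \<Omega> x * indicator (\<Union>i. F i) x"
      by (simp only: ennreal_suminf_cmult suminf_indicator[OF Fdisj])
    also have "\<dots> \<le> G x * v x * indicator \<Omega> x" by (simp split: split_indicator)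
    finally show "(\<Sum>i. G x * v x * indicator \<Omega> x * indicator (F i) x) \<le> G x * v x * indicator \<Omega> x" .
  qed
  also note GI
  also have "ennreal (4 powr p * A * I powr (p - 1)) * ennreal I = ennreal (4 powr p * A * I powr p)"
  proof -
    have "I powr (p - 1) * I = I powr p"
      using I powr_add[of I "p - 1" 1] by (cases "I = 0") auto
    then show ?thesis using I A by (simp add: ennreal_mult'[symmetric] mult.assoc)
  qed
  finally show ?thesis by (simp add: mult_left_mono)
qed

text \<open>Let \<open>b\<close> be the infimum of the levels whose sublevel set carries at least
  half of the mass. Continuity of the measure from above at \<open>b\<close> gives the first
  inequality; continuity from below along levels under \<open>b\<close> gives the second.\<close>

lemma (in finite_measure) ex_median:
  fixes h :: "'a \<Rightarrow> real"
  assumes [measurable]: "h \<in> borel_measurable M"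
  shows "\<exists>b. measure M (space M) \<le> 2 * measure M {x\<in>space M. h x \<le> b} \<and>
    measure M (space M) \<le> 2 * measure M {x\<in>space M. b \<le> h x}"
proof (cases "measure M (space M) = 0")
  case False
  define m where "m = measure M (space M)"
  have m: "m > 0" using False by (simp add: m_def zero_less_measure_iff)
  define F where "F b = measure M {x\<in>space M. h x \<le> b}" for b
  have Fmono: "F a \<le> F b" if "a \<le> b" for a b
    unfolding F_def using that by (intro finite_measure_mono) auto
  define S where "S = {b. m \<le> 2 * F b}"
  have "(\<lambda>n. F (real n)) \<longlonglongrightarrow> measure M (\<Union>n. {x\<in>space M. h x \<le> real n})"
    unfolding F_def by (intro finite_Lim_measure_incseq) (auto simp: incseq_def)
  also have "(\<Union>n. {x\<in>space M. h x \<le> real n}) = space M" using real_arch_simple by auto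
  finally have "\<forall>\<^sub>F n in sequentially. m / 2 < F (real n)"
    using m unfolding m_def by (intro order_tendstoD(1)) auto
  then obtain n0 where "m / 2 < F (real n0)" using eventually_happens'[OF sequentially_bot] by blast
  then have "real n0 \<in> S" by (simp add: S_def)
  then have "S \<noteq> {}" by blast
  have "(\<lambda>n. F (- real n)) \<longlonglongrightarrow> measure M (\<Inter>n. {x\<in>space M. h x \<le> - real n})"
    unfolding F_def by (intro finite_Lim_measure_decseq) (auto simp: decseq_def)
  also have "(\<Inter>n. {x\<in>space M. h x \<le> - real n}) = {}"
  proof -
    have "\<exists>n. \<not> h x \<le> - real n" for x
    proof -
      obtain n where "- h x < real n" using reals_Archimedean2 by blast
      then show ?thesis by (intro exI[of _ n]) linarith
    qed
    then show ?thesis by auto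
  qed
  finally have "\<forall>\<^sub>F n in sequentially. F (- real n) < m / 2" using m by (intro order_tendstoD(2)) auto
  then obtain n where n: "F (- real n) < m / 2" using eventually_happens'[OF sequentially_bot] by blast
  have bdd: "bdd_below S"
  proof (rule bdd_belowI[of _ "- real n"])
    fix b assume "b \<in> S"
    then show "- real n \<le> b" using n Fmono[of b "- real n"] by (cases "- real n \<le> b") (auto simp: S_def)
  qed
  define b where "b = Inf S"
  define e where "e n = 1 / real (Suc n)" for n
  have e0: "e n > 0" "e \<longlonglongrightarrow> 0" for n
    unfolding e_def using LIMSEQ_inverse_real_of_nat by (auto simp: inverse_eq_divide)
  have emono: "e k \<le> e j" if "j \<le> k" for j k using that by (simp add: e_def field_simps)
  have "(\<lambda>n. F (b + e n)) \<longlonglongrightarrow> measure M (\<Inter>n. {x\<in>space M. h x \<le> b + e n})"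
    unfolding F_def using emono
    by (intro finite_Lim_measure_decseq) (auto simp: decseq_def intro: order_trans)
  also have "(\<Inter>n. {x\<in>space M. h x \<le> b + e n}) = {x\<in>space M. h x \<le> b}"
  proof -
    have "h x \<le> b" if "\<forall>n. h x \<le> b + e n" for x
      using tendsto_add[OF tendsto_const e0(2), of b] that by (intro LIMSEQ_le_const[of _ b]) auto
    moreover have "h x \<le> b + e n" if "h x \<le> b" for x n using that e0(1)[of n] by simp
    ultimately show ?thesis by auto
  qed
  finally have "(\<lambda>n. 2 * F (b + e n)) \<longlonglongrightarrow> 2 * F b" unfolding F_def by (intro tendsto_intros)
  moreover have "m \<le> 2 * F (b + e n)" for n
  proof -
    obtain c where "c \<in> S" "c < b + e n"
      using cInf_lessD[OF \<open>S \<noteq> {}\<close>, of "b + e n"] e0(1)[of n] by (auto simp: b_def)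
    then show ?thesis using Fmono[of c "b + e n"] by (simp add: S_def)
  qed
  ultimately have 1: "m \<le> 2 * F b" using LIMSEQ_le_const[of "\<lambda>n. 2 * F (b + e n)" "2 * F b" m] by blast
  have "(\<lambda>n. F (b - e n)) \<longlonglongrightarrow> measure M (\<Union>n. {x\<in>space M. h x \<le> b - e n})"
    unfolding F_def using emono
    by (intro finite_Lim_measure_incseq) (auto simp: incseq_def intro: order_trans)
  also have "(\<Union>n. {x\<in>space M. h x \<le> b - e n}) = {x\<in>space M. h x < b}"
  proof -
    have "\<exists>n. h x \<le> b - e n" if "h x < b" for x
    proof -
      have "0 < b - h x" using that by simp
      then obtain n where "e n < b - h x" unfolding e_def by (rule nat_approx_posE)
      then show ?thesis by (intro exI[of _ n]) simp
    qed
    moreover have "h x < b" if "h x \<le> b - e n" for x n using that e0(1)[of n] by simp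
    ultimately show ?thesis by auto
  qed
  finally have "(\<lambda>n. 2 * F (b - e n)) \<longlonglongrightarrow> 2 * measure M {x\<in>space M. h x < b}" by (intro tendsto_intros)
  moreover have "2 * F (b - e n) \<le> m" for n
  proof -
    have "b - e n \<notin> S" using cInf_lower[OF _ bdd, of "b - e n"] e0(1)[of n] by (auto simp: b_def)
    then show ?thesis by (simp add: S_def)
  qed
  ultimately have "2 * measure M {x\<in>space M. h x < b} \<le> m"
    using LIMSEQ_le_const2[of "\<lambda>n. 2 * F (b - e n)" "2 * measure M {x\<in>space M. h x < b}" m] by blast
  moreover have "measure M {x\<in>space M. b \<le> h x} = m - measure M {x\<in>space M. h x < b}"
    unfolding m_def by (subst finite_measure_compl[symmetric]) (auto intro!: arg_cong[of _ _ "measure M"])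
  ultimately have "m \<le> 2 * measure M {x\<in>space M. b \<le> h x}" by simp
  with 1 show ?thesis unfolding m_def F_def by blast
qed simp

text \<open>\<open>gradient\<close> is a definite description, from which measurability cannot be
  read off. Limits of difference quotients of \<open>f\<close>, extended by zero, form a Borel
  vector field that agrees with it almost everywhere on \<open>\<Omega>\<close>.\<close>

lemma gradient_norm_borel:
  fixes f :: "'a::euclidean_space \<Rightarrow> real"
  assumes \<Omega>: "open \<Omega>" and f: "locally_lipschitz_on \<Omega> f"
  obtains G :: "'a \<Rightarrow> ennreal" where "G \<in> borel_measurable borel"
    "AE x in lborel. x \<in> \<Omega> \<longrightarrow> GDERIV f x :> gradient f x \<and> G x = ennreal (norm (gradient f x))"
proof
  have cont: "continuous_on \<Omega> f" by (rule locally_lipschitz_continuous_on[OF \<Omega> f])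
  define f' where "f' x = indicator \<Omega> x *\<^sub>R f x" for x
  have [measurable]: "f' \<in> borel_measurable borel" unfolding f'_def
    using cont \<Omega> by (intro borel_measurable_continuous_on_indicator) auto
  define t where "t n = 1 / real (Suc n)" for n
  define D where "D i x = lim (\<lambda>n. (f' (x + t n *\<^sub>R i) - f' x) / t n)" for i x
  have [measurable]: "D i \<in> borel_measurable borel" for i
    unfolding D_def by (rule borel_measurable_lim_metric) measurable
  define G where "G x = ennreal (norm (\<Sum>i\<in>Basis. D i x *\<^sub>R i))" for x
  show "G \<in> borel_measurable borel" unfolding G_def by measurable
  have t0: "filterlim t (at 0) sequentially"
    unfolding filterlim_at t_def using LIMSEQ_inverse_real_of_nat by (auto simp: inverse_eq_divide)
  show "AE x in lborel. x \<in> \<Omega> \<longrightarrow> GDERIV f x :> gradient f x \<and> G x = ennreal (norm (gradient f x))"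
    using locally_lipschitz_AE_GDERIV[OF \<Omega> f]
  proof eventually_elim
    case (elim x)
    show ?case
    proof
      assume x: "x \<in> \<Omega>"
      then have d: "GDERIV f x :> gradient f x" using elim by blast
      have "D i x = gradient f x \<bullet> i" for i
      proof -
        have "((\<lambda>h. f (x + h *\<^sub>R i)) has_derivative (\<lambda>h. (h *\<^sub>R i) \<bullet> gradient f x)) (at 0)"
        proof (rule has_derivative_compose[of "\<lambda>h. x + h *\<^sub>R i" "\<lambda>h. h *\<^sub>R i" _ _ f])
          show "((\<lambda>h. x + h *\<^sub>R i) has_derivative (\<lambda>h. h *\<^sub>R i)) (at 0)"
            by (auto intro!: derivative_eq_intros)
          show "(f has_derivative (\<lambda>h. h \<bullet> gradient f x)) (at (x + 0 *\<^sub>R i))"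
            using d by (simp add: gderiv_def)
        qed
        then have "((\<lambda>h. f (x + h *\<^sub>R i)) has_real_derivative (gradient f x \<bullet> i)) (at 0)"
          unfolding has_field_derivative_def
          by (rule has_derivative_eq_rhs) (auto simp: inner_commute mult.commute)
        then have "((\<lambda>h. (f (x + h *\<^sub>R i) - f x) / h) \<longlongrightarrow> gradient f x \<bullet> i) (at 0)"
          by (simp add: DERIV_def)
        from filterlim_compose[OF this t0]
        have lim: "(\<lambda>n. (f (x + t n *\<^sub>R i) - f x) / t n) \<longlonglongrightarrow> gradient f x \<bullet> i" .
        have "(\<lambda>n. x + t n *\<^sub>R i) \<longlonglongrightarrow> x"
          using t0 by (auto simp: filterlim_at intro!: tendsto_eq_intros)
        then have "\<forall>\<^sub>F n in sequentially. x + t n *\<^sub>R i \<in> \<Omega>"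
          using \<Omega> x by (rule topological_tendstoD)
        then have "\<forall>\<^sub>F n in sequentially. (f (x + t n *\<^sub>R i) - f x) / t n = (f' (x + t n *\<^sub>R i) - f' x) / t n"
          by eventually_elim (use x in \<open>simp add: f'_def\<close>)
        from Lim_transform_eventually[OF lim this] show ?thesis unfolding D_def by (rule limI)
      qed
      then have "G x = ennreal (norm (gradient f x))"
        by (simp add: G_def euclidean_representation)
      with d show "GDERIV f x :> gradient f x \<and> G x = ennreal (norm (gradient f x))" by blast
    qed
  qed
qed

text \<open>On \<open>E\<close> the pointwise bound puts \<open>t\<close> below a multiple of the
  averaging operator. Integration against \<open>u\<close> over \<open>E\<close>, a set of mass
  \<open>m\<close>, gives t m <= c m^(1 - 1/p) I; cancelling the power of \<open>m\<close> and
  raising to the power \<open>p\<close> yields the claim.\<close>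

lemma john_weak_type:
  fixes \<Omega> :: "'a::euclidean_space set" and u G :: "'a \<Rightarrow> ennreal" and w g :: "'a \<Rightarrow> real" and \<alpha> K0 r C1 t I :: real
  defines "n \<equiv> real DIM('a)"
  defines "p \<equiv> n / (n - 1 + \<alpha>)"
  defines "B \<equiv> (1 + 1 / (1 - \<alpha>) + 1 / (n - 1 + \<alpha>)) * (1 / r) powr \<alpha> * (C1 * (K0 + r) powr n) powr (1 / p)"
  assumes \<Omega>: "open \<Omega>" and \<alpha>: "0 \<le> \<alpha>" "\<alpha> \<le> 1" "1 - \<alpha> < n" and K0: "K0 \<ge> 0" and r: "r > 0"
    and um: "u \<in> borel_measurable borel" "w \<in> borel_measurable borel"
    and w: "\<And>x. w x \<ge> 0" and C1: "C1 \<ge> 0"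
    and ball: "AE x in lborel. x \<in> \<Omega> \<longrightarrow>
      (\<forall>\<rho>>0. (\<integral>\<^sup>+y. u y * indicator (cball x \<rho>) y \<partial>lborel) \<le> ennreal (C1 * w x powr p * \<rho> powr n))"
    and fin: "(\<integral>\<^sup>+y\<in>\<Omega>. u y \<partial>lborel) < \<infinity>"
    and curves: "\<And>y. y \<in> \<Omega> \<Longrightarrow> \<exists>\<gamma>. K0-lipschitz_on {0..1} \<gamma> \<and> \<gamma> 0 = y \<and> \<gamma> 1 = x0 \<and>
      (\<forall>s\<in>{0..1}. \<gamma> s \<in> \<Omega> \<and> 2 * r * s \<le> bdry_dist \<Omega> (\<gamma> s))"
    and H: "H \<in> sets borel" "H \<subseteq> ball 0 r" "emeasure lborel (ball (0::'a) r) \<le> 2 * emeasure lborel H"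
    and g: "locally_lipschitz_on \<Omega> g" and G: "G \<in> borel_measurable borel"
    and grad: "AE x in lborel. x \<in> \<Omega> \<longrightarrow> (\<exists>d. GDERIV g x :> d \<and> ennreal (norm d) \<le> G x)"
    and g0: "\<And>z. z \<in> H \<Longrightarrow> g (x0 + z) = 0"
    and E: "E \<in> sets borel" "E \<subseteq> \<Omega>" and t: "0 < t" "\<And>y. y \<in> E \<Longrightarrow> t \<le> \<bar>g y\<bar>"
    and I: "I \<ge> 0" "(\<integral>\<^sup>+x\<in>\<Omega>. G x * ennreal (bdry_dist \<Omega> x powr \<alpha> * w x) \<partial>lborel) = ennreal I"
  shows "ennreal (t powr p) * (\<integral>\<^sup>+y. u y * indicator E y \<partial>lborel)
    \<le> ennreal ((2 * (K0 + r) * B / measure lborel (ball (0::'a) r)) powr p * I powr p)"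
proof -
  note [measurable] = um G E(1) H(1)
  define K where "K = K0 + r"
  have K: "K > 0" using K0 r by (simp add: K_def)
  have n: "n \<ge> 1" unfolding n_def using DIM_positive[where 'a = 'a] by linarith
  have n1: "n - 1 + \<alpha> > 0" using \<alpha> by simp
  have p: "p > 0" "1 / p = (n - 1 + \<alpha>) / n" using n1 n by (auto simp: p_def)
  have pq: "(1 - \<alpha>) / n = 1 - 1 / p" unfolding p(2) using n by (simp add: field_simps)
  have B0: "B \<ge> 0" unfolding B_def using \<alpha> by (intro mult_nonneg_nonneg add_nonneg_nonneg) auto
  define V where "V = measure lborel (ball (0::'a) r)"
  have V: "V > 0" "emeasure lborel (ball (0::'a) r) = ennreal V"
    using r content_ball_pos[of r "0::'a"] emeasure_lborel_ball_finite[of "0::'a" r]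
    by (auto simp: V_def emeasure_eq_ennreal_measure)
  have "(\<integral>\<^sup>+y. u y * indicator E y \<partial>lborel) \<le> (\<integral>\<^sup>+y\<in>\<Omega>. u y \<partial>lborel)"
    using E(2) by (intro nn_integral_mono) (auto split: split_indicator)
  then have "(\<integral>\<^sup>+y. u y * indicator E y \<partial>lborel) < top" using fin by (simp add: order.strict_trans1)
  \<comment> \<open>The mass has to be a finite number because a power of it is cancelled
    below.\<close>
  then obtain m where m: "(\<integral>\<^sup>+y. u y * indicator E y \<partial>lborel) = ennreal m" "m \<ge> 0"
    by (cases "\<integral>\<^sup>+y. u y * indicator E y \<partial>lborel") auto
  show ?thesis
  proof (cases "m = 0")
    case True
    then show ?thesis by (simp add: m)
  next
    case False
    then have m0: "m > 0" using m by simp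
    have low: "ennreal (t * V) \<le> ennreal (2 * K) * john_op K r \<Omega> G y" if y: "y \<in> E" for y
    proof -
      obtain \<gamma> where \<gamma>: "K0-lipschitz_on {0..1} \<gamma>" "\<gamma> 0 = y" "\<gamma> 1 = x0"
        "\<And>s. s \<in> {0..1} \<Longrightarrow> \<gamma> s \<in> \<Omega> \<and> 2 * r * s \<le> bdry_dist \<Omega> (\<gamma> s)"
        using curves y E(2) by (meson subsetD)
      have "ennreal (t * V) \<le> ennreal \<bar>g y\<bar> * emeasure lborel (ball (0::'a) r)"
        unfolding V(2) using t(2)[OF y] t(1) V(1) by (simp add: ennreal_mult'[symmetric] ennreal_leI)
      also have "\<dots> \<le> ennreal (2 * K) * john_op K r \<Omega> G y"
        unfolding K_def by (rule john_op_lower_bound[OF \<Omega> g G grad \<gamma> r H(1,2) g0 H(3)])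
      finally show ?thesis .
    qed
    have jm: "john_op K r \<Omega> G \<in> borel_measurable borel"
    proof -
      have [measurable]: "(\<lambda>q. john_kernel K r \<Omega> (snd (fst q)) (snd q) (fst (fst q))) \<in> borel_measurable ((borel \<Otimes>\<^sub>M borel) \<Otimes>\<^sub>M borel)"
      proof -
        have "(\<lambda>q. (snd (fst q), snd q, fst (fst q))) \<in> (borel \<Otimes>\<^sub>M borel) \<Otimes>\<^sub>M borel \<rightarrow>\<^sub>M borel \<Otimes>\<^sub>M (borel \<Otimes>\<^sub>M borel)"
          by measurable
        from measurable_compose[OF this john_kernel_measurable(2)[OF \<Omega>]] show ?thesis by simp
      qed
      show ?thesis unfolding john_op_def by measurable
    qed
    note [measurable] = jm
    have "ennreal (t * V) * ennreal m = (\<integral>\<^sup>+y. ennreal (t * V) * (u y * indicator E y) \<partial>lborel)"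
      unfolding m(1)[symmetric] by (rule nn_integral_cmult[symmetric]) measurable
    also have "\<dots> \<le> (\<integral>\<^sup>+y. ennreal (2 * K) * (john_op K r \<Omega> G y * (u y * indicator E y)) \<partial>lborel)"
    proof (rule nn_integral_mono)
      fix y
      show "ennreal (t * V) * (u y * indicator E y) \<le> ennreal (2 * K) * (john_op K r \<Omega> G y * (u y * indicator E y))"
        using mult_right_mono[OF low, of y "u y"] by (simp add: mult.assoc split: split_indicator)
    qed
    also have "\<dots> = ennreal (2 * K) * (\<integral>\<^sup>+y. john_op K r \<Omega> G y * (u y * indicator E y) \<partial>lborel)"
      by (rule nn_integral_cmult) measurable
    also have "\<dots> \<le> ennreal (2 * K) * (ennreal (B * m powr ((1 - \<alpha>) / n)) * ennreal I)"
    proof (rule mult_left_mono)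
      have "(\<integral>\<^sup>+y. john_op K r \<Omega> G y * (u y * indicator E y) \<partial>lborel) \<le>
        ennreal (B * m powr ((1 - \<alpha>) / n)) * (\<integral>\<^sup>+x\<in>\<Omega>. G x * ennreal (bdry_dist \<Omega> x powr \<alpha> * w x) \<partial>lborel)"
        unfolding B_def K_def[symmetric] n_def p_def
        by (rule john_op_weighted_le) (use \<Omega> \<alpha> K r um G E w C1 ball m0 m in \<open>auto simp: n_def p_def\<close>)
      then show "(\<integral>\<^sup>+y. john_op K r \<Omega> G y * (u y * indicator E y) \<partial>lborel) \<le>
        ennreal (B * m powr ((1 - \<alpha>) / n)) * ennreal I" by (simp only: I(2))
    qed simp
    also have "\<dots> = ennreal (2 * K * (B * m powr (1 - 1 / p)) * I)"
      using K B0 I by (simp add: pq ennreal_mult' mult.assoc)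
    also have "ennreal (t * V) * ennreal m = ennreal (t * V * m)" using t V m by (simp add: ennreal_mult')
    finally have "t * V * m \<le> 2 * K * (B * m powr (1 - 1 / p)) * I"
      using K B0 I by (simp add: ennreal_le_iff)
    moreover have "m = m powr (1 - 1 / p) * m powr (1 / p)" using m0 by (simp add: powr_add[symmetric])
    ultimately have "m powr (1 - 1 / p) * (t * V * m powr (1 / p)) \<le> m powr (1 - 1 / p) * (2 * K * B * I)"
      by (metis (no_types, opaque_lifting) mult.assoc mult.commute mult.left_commute)
    then have "t * V * m powr (1 / p) \<le> 2 * K * B * I" using m0 by simp
    then have "t * m powr (1 / p) \<le> 2 * K * B / V * I" using V by (simp add: field_simps)
    then have "(t * m powr (1 / p)) powr p \<le> (2 * K * B / V * I) powr p" using t m0 p by (intro powr_mono2) auto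
    moreover have "(t * m powr (1 / p)) powr p = t powr p * m" using t m0 p(1) by (simp add: powr_mult powr_powr)
    moreover have "(2 * K * B / V * I) powr p = (2 * K * B / V) powr p * I powr p"
      by (rule powr_mult)
    ultimately have "t powr p * m \<le> (2 * K * B / V) powr p * I powr p" by simp
    then have "ennreal (t powr p * m) \<le> ennreal ((2 * K * B / V) powr p * I powr p)" by (rule ennreal_leI)
    then show ?thesis by (simp add: m(1) ennreal_mult' K_def V_def)
  qed
qed

text \<open>A median \<open>b\<close> on the ball about \<open>x0\<close> leaves at least half of
  the ball to \<open>f \<le> b\<close> and at least half to \<open>f \<ge> b\<close>. So the
  positive parts of \<open>f - b\<close> and of \<open>b - f\<close> both fall under the truncation
  argument, each with its own set \<open>H\<close>, which explains the factor 2. The constant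
  depends on domain and weight only.\<close>

lemma john_sobolev_poincare_borel:
  fixes \<Omega> :: "'a::euclidean_space set" and u :: "'a \<Rightarrow> ennreal" and w f :: "'a \<Rightarrow> real" and \<alpha> K0 r C1 I :: real
  defines "n \<equiv> real DIM('a)"
  defines "p \<equiv> n / (n - 1 + \<alpha>)"
  defines "B \<equiv> (1 + 1 / (1 - \<alpha>) + 1 / (n - 1 + \<alpha>)) * (1 / r) powr \<alpha> * (C1 * (K0 + r) powr n) powr (1 / p)"
  defines "A \<equiv> (2 * (K0 + r) * B / measure lborel (ball (0::'a) r)) powr p"
  assumes \<Omega>: "open \<Omega>" and \<alpha>: "0 \<le> \<alpha>" "\<alpha> \<le> 1" "1 - \<alpha> < n" and K0: "K0 \<ge> 0" and r: "r > 0"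
    and um: "u \<in> borel_measurable borel" "w \<in> borel_measurable borel"
    and w: "\<And>x. w x \<ge> 0" and C1: "C1 \<ge> 0"
    and ball: "AE x in lborel. x \<in> \<Omega> \<longrightarrow>
      (\<forall>\<rho>>0. (\<integral>\<^sup>+y. u y * indicator (cball x \<rho>) y \<partial>lborel) \<le> ennreal (C1 * w x powr p * \<rho> powr n))"
    and fin: "(\<integral>\<^sup>+y\<in>\<Omega>. u y \<partial>lborel) < \<infinity>"
    and x0: "x0 \<in> \<Omega>"
    and curves: "\<And>y. y \<in> \<Omega> \<Longrightarrow> \<exists>\<gamma>. K0-lipschitz_on {0..1} \<gamma> \<and> \<gamma> 0 = y \<and> \<gamma> 1 = x0 \<and>
      (\<forall>s\<in>{0..1}. \<gamma> s \<in> \<Omega> \<and> 2 * r * s \<le> bdry_dist \<Omega> (\<gamma> s))"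
    and f: "locally_lipschitz_on \<Omega> f"
    and I: "I \<ge> 0" "(\<integral>\<^sup>+x\<in>\<Omega>. ennreal (norm (gradient f x)) * ennreal (bdry_dist \<Omega> x powr \<alpha> * w x) \<partial>lborel) = ennreal I"
  shows "\<exists>b. (\<integral>\<^sup>+y\<in>\<Omega>. ennreal (\<bar>f y - b\<bar> powr p) * u y \<partial>lborel) \<le> ennreal (2 * 4 powr p * A * I powr p)"
proof -
  note [measurable] = um
  have \<Omega>m[measurable]: "\<Omega> \<in> sets borel" using \<Omega> by simp
  have n: "n \<ge> 1" unfolding n_def using DIM_positive[where 'a = 'a] by linarith
  have p: "p \<ge> 1" using n \<alpha> by (simp add: p_def field_simps)
  have A: "A \<ge> 0" by (simp add: A_def)
  have [measurable]: "bdry_dist \<Omega> \<in> borel_measurable borel"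
    unfolding bdry_dist_def by (intro borel_measurable_continuous_onI continuous_intros)
  define v where "v x = ennreal (bdry_dist \<Omega> x powr \<alpha> * w x)" for x
  have vm: "v \<in> borel_measurable borel" unfolding v_def by measurable
  obtain G :: "'a \<Rightarrow> ennreal" where G: "G \<in> borel_measurable borel"
    "AE x in lborel. x \<in> \<Omega> \<longrightarrow> GDERIV f x :> gradient f x \<and> G x = ennreal (norm (gradient f x))"
    using gradient_norm_borel[OF \<Omega> f] .
  have "(\<integral>\<^sup>+x\<in>\<Omega>. G x * v x \<partial>lborel) = (\<integral>\<^sup>+x\<in>\<Omega>. ennreal (norm (gradient f x)) * v x \<partial>lborel)"
    by (intro nn_integral_cong_AE) (use G(2) in eventually_elim, auto split: split_indicator)
  then have GI: "(\<integral>\<^sup>+x\<in>\<Omega>. G x * v x \<partial>lborel) \<le> ennreal I" using I by (simp add: v_def)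
  have cont: "continuous_on \<Omega> f" by (rule locally_lipschitz_continuous_on[OF \<Omega> f])
  define f' where "f' x = indicator \<Omega> x *\<^sub>R f x" for x
  have [measurable]: "f' \<in> borel_measurable borel" unfolding f'_def
    using cont by (intro borel_measurable_continuous_on_indicator) auto
  define S where "S = ball (0::'a) r"
  have Sm[measurable]: "S \<in> sets borel" by (simp add: S_def)
  have Sfin: "emeasure lborel S < \<infinity>" unfolding S_def by (rule emeasure_lborel_ball_finite)
  \<comment> \<open>The curve condition at time 1 says that \<open>x0\<close> has distance at least
    \<open>2 * r\<close> from the boundary.\<close>
  have xz: "x0 + z \<in> \<Omega>" if "z \<in> S" for z
  proof -
    obtain \<gamma> where "\<gamma> 1 = x0" "\<forall>s\<in>{0..1}. \<gamma> s \<in> \<Omega> \<and> 2 * r * s \<le> bdry_dist \<Omega> (\<gamma> s)"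
      using curves[OF x0] by blast
    then have "2 * r * 1 \<le> bdry_dist \<Omega> x0"
      by (metis atLeastAtMost_iff order_refl zero_le_one)
    then have "2 * r \<le> bdry_dist \<Omega> x0" by simp
    then have "ball x0 (2 * r) \<subseteq> \<Omega>" using x0 by (intro ball_subset_if_bdry_dist_ge) auto
    moreover have "x0 + z \<in> ball x0 (2 * r)" using that r by (simp add: S_def dist_norm)
    ultimately show ?thesis by blast
  qed
  define N where "N = restrict_space lborel S"
  interpret N: finite_measure N
    using Sfin by (intro finite_measureI) (simp add: N_def space_restrict_space emeasure_restrict_space)
  have spN: "space N = S" by (simp add: N_def space_restrict_space)
  have mN: "measure N X = measure lborel X" if "X \<subseteq> S" for X
    using that by (simp add: N_def measure_restrict_space)
  have "(\<lambda>z. f' (x0 + z)) \<in> borel_measurable N"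
    unfolding N_def by (rule measurable_restrict_space1) measurable
  from N.ex_median[OF this] obtain b where
    b: "measure N S \<le> 2 * measure N {z\<in>S. f' (x0 + z) \<le> b}" "measure N S \<le> 2 * measure N {z\<in>S. b \<le> f' (x0 + z)}"
    by (auto simp: spN)
  have half: "emeasure lborel S \<le> 2 * emeasure lborel X" if "measure N S \<le> 2 * measure N X" "X \<subseteq> S" "X \<in> sets borel" for X
  proof -
    have "emeasure lborel X < \<infinity>" using emeasure_mono[of X S lborel] that(2) Sfin by (simp add: order.strict_trans1)
    then have "emeasure lborel X = ennreal (measure lborel X)" by (intro emeasure_eq_ennreal_measure) auto
    moreover have "emeasure lborel S = ennreal (measure lborel S)" using Sfin by (intro emeasure_eq_ennreal_measure) auto
    moreover have "ennreal (measure lborel S) \<le> ennreal (2 * measure lborel X)"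
      using that mN by (intro ennreal_leI) auto
    ultimately show ?thesis by (simp add: ennreal_mult')
  qed
  have one_sided: "(\<integral>\<^sup>+y\<in>\<Omega>. ennreal (max 0 (h y - c) powr p) * u y \<partial>lborel) \<le> ennreal (4 powr p * A * I powr p)"
    if h: "locally_lipschitz_on \<Omega> h"
      "AE x in lborel. x \<in> \<Omega> \<longrightarrow> (\<exists>d. GDERIV h x :> d \<and> ennreal (norm d) \<le> G x)"
      and H: "H \<subseteq> S" "H \<in> sets borel" "measure N S \<le> 2 * measure N H" "\<And>z. z \<in> H \<Longrightarrow> h (x0 + z) \<le> c" for h c H
  proof (rule weak_to_strong_truncation[OF \<Omega> h(1) p A I(1) um(1) vm G(1) h(2) GI, where Z = "(\<lambda>z. x0 + z) ` H"])
    show "h z \<le> c" if "z \<in> (\<lambda>z. x0 + z) ` H" for z using that H(4) by auto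
    fix g Ga E t J
    assume *: "locally_lipschitz_on \<Omega> g" "Ga \<in> borel_measurable borel"
      "AE x in lborel. x \<in> \<Omega> \<longrightarrow> (\<exists>d. GDERIV g x :> d \<and> ennreal (norm d) \<le> Ga x)"
      "\<And>z. z \<in> (\<lambda>z. x0 + z) ` H \<Longrightarrow> g z = 0" "E \<in> sets borel" "E \<subseteq> \<Omega>" "0 < t"
      "\<And>y. y \<in> E \<Longrightarrow> t \<le> \<bar>g y\<bar>" "0 \<le> J" "(\<integral>\<^sup>+x\<in>\<Omega>. Ga x * v x \<partial>lborel) = ennreal J"
    have "H \<subseteq> ball 0 r" "emeasure lborel (ball (0::'a) r) \<le> 2 * emeasure lborel H"
      using H(1) half[OF H(3,1,2)] by (auto simp: S_def)
    then show "ennreal (t powr p) * (\<integral>\<^sup>+y. u y * indicator E y \<partial>lborel) \<le> ennreal (A * J powr p)"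
      unfolding A_def B_def p_def n_def
      using * H(2) by (intro john_weak_type[where g = g and G = Ga and t = t, OF \<Omega> \<alpha>[unfolded n_def] K0 r um w C1
            ball[unfolded p_def n_def] fin curves]) (auto simp: v_def)
  qed
  have 1: "(\<integral>\<^sup>+y\<in>\<Omega>. ennreal (max 0 (f y - b) powr p) * u y \<partial>lborel) \<le> ennreal (4 powr p * A * I powr p)"
  proof (rule one_sided[OF f])
    show "AE x in lborel. x \<in> \<Omega> \<longrightarrow> (\<exists>d. GDERIV f x :> d \<and> ennreal (norm d) \<le> G x)"
      using G(2) by eventually_elim auto
    show "measure N S \<le> 2 * measure N {z\<in>S. f' (x0 + z) \<le> b}" by (rule b(1))
    show "f (x0 + z) \<le> b" if "z \<in> {z\<in>S. f' (x0 + z) \<le> b}" for z using that xz by (auto simp: f'_def)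
  qed auto
  have 2: "(\<integral>\<^sup>+y\<in>\<Omega>. ennreal (max 0 (- f y - - b) powr p) * u y \<partial>lborel) \<le> ennreal (4 powr p * A * I powr p)"
  proof (rule one_sided)
    have "1-lipschitz_on UNIV (\<lambda>t::real. - t)" by (rule lipschitz_onI) (auto simp: dist_real_def)
    from locally_lipschitz_on_compose[OF f this] show "locally_lipschitz_on \<Omega> (\<lambda>x. - f x)" .
    show "AE x in lborel. x \<in> \<Omega> \<longrightarrow> (\<exists>d. GDERIV (\<lambda>x. - f x) x :> d \<and> ennreal (norm d) \<le> G x)"
      using G(2)
    proof eventually_elim
      case (elim x)
      then show ?case using GDERIV_minus[of f x "gradient f x"] by (auto intro!: exI[of _ "- gradient f x"])
    qed
    show "measure N S \<le> 2 * measure N {z\<in>S. b \<le> f' (x0 + z)}" by (rule b(2))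
    show "- f (x0 + z) \<le> - b" if "z \<in> {z\<in>S. b \<le> f' (x0 + z)}" for z using that xz by (auto simp: f'_def)
  qed auto
  \<comment> \<open>At every point at most one of the two positive parts is nonzero, and
    \<open>0 powr p = 0\<close>, so the p-th powers add up to that of |f - b|. Writing
    \<open>f'\<close> for \<open>f\<close> makes both summands Borel.\<close>
  have pm: "(\<lambda>y. ennreal (max 0 (f' y - b) powr p) * u y * indicator \<Omega> y) \<in> borel_measurable borel"
    "(\<lambda>y. ennreal (max 0 (- f' y - - b) powr p) * u y * indicator \<Omega> y) \<in> borel_measurable borel"
    by measurable
  have "(\<integral>\<^sup>+y\<in>\<Omega>. ennreal (\<bar>f y - b\<bar> powr p) * u y \<partial>lborel)
      = (\<integral>\<^sup>+y. ennreal (max 0 (f' y - b) powr p) * u y * indicator \<Omega> y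
          + ennreal (max 0 (- f' y - - b) powr p) * u y * indicator \<Omega> y \<partial>lborel)"
    by (intro nn_integral_cong) (auto simp: f'_def max_def abs_if split: split_indicator)
  also have "\<dots> = (\<integral>\<^sup>+y. ennreal (max 0 (f' y - b) powr p) * u y * indicator \<Omega> y \<partial>lborel)
      + (\<integral>\<^sup>+y. ennreal (max 0 (- f' y - - b) powr p) * u y * indicator \<Omega> y \<partial>lborel)"
    using pm by (intro nn_integral_add) auto
  also have "(\<integral>\<^sup>+y. ennreal (max 0 (f' y - b) powr p) * u y * indicator \<Omega> y \<partial>lborel)
      = (\<integral>\<^sup>+y\<in>\<Omega>. ennreal (max 0 (f y - b) powr p) * u y \<partial>lborel)"
    by (intro nn_integral_cong) (auto simp: f'_def split: split_indicator)
  also have "(\<integral>\<^sup>+y. ennreal (max 0 (- f' y - - b) powr p) * u y * indicator \<Omega> y \<partial>lborel)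
      = (\<integral>\<^sup>+y\<in>\<Omega>. ennreal (max 0 (- f y - - b) powr p) * u y \<partial>lborel)"
    by (intro nn_integral_cong) (auto simp: f'_def split: split_indicator)
  finally have "(\<integral>\<^sup>+y\<in>\<Omega>. ennreal (\<bar>f y - b\<bar> powr p) * u y \<partial>lborel)
      \<le> ennreal (4 powr p * A * I powr p) + ennreal (4 powr p * A * I powr p)"
    using add_mono[OF 1 2] by simp
  also have "\<dots> = ennreal (2 * 4 powr p * A * I powr p)"
    using A by (simp add: ennreal_plus[symmetric] del: ennreal_plus)
  finally show ?thesis by blast
qed

text \<open>The increment over [s, t] is the integral of the velocity, whose norm is at most
  \<open>K\<close> off a null set. \<open>max K 0\<close> appears because a Lipschitz constant is
  nonnegative by definition.\<close>

lemma velocity_bounded_by_lipschitz: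
  fixes \<gamma> :: "real \<Rightarrow> 'a::euclidean_space"
  assumes "velocity_bounded_by \<gamma> K"
  shows "(max K 0)-lipschitz_on {0..1} \<gamma>"
proof (rule lipschitz_onI)
  define v where "v s = vector_derivative \<gamma> (at s)" for s
  define N where "N = {s\<in>{0..1}. \<not> norm (v s) \<le> K}"
  have "AE s in lebesgue. s \<notin> N"
    using assms unfolding velocity_bounded_by_def by (auto simp: v_def N_def elim!: eventually_mono)
  then obtain N' where "N' \<in> null_sets lebesgue" "N \<subseteq> N'"
    unfolding eventually_ae_filter by auto
  then have N: "negligible N" by (meson negligible_iff_null_sets negligible_subset)
  have hi: "(v has_integral (\<gamma> t - \<gamma> 0)) {0..t}" if "t \<in> {0..1}" for t
    using assms that unfolding velocity_bounded_by_def v_def by blast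
  have main: "norm (\<gamma> t - \<gamma> s) \<le> max K 0 * (t - s)" if st: "0 \<le> s" "s \<le> t" "t \<le> 1" for s t
  proof -
    have it: "v integrable_on {0..t}" using hi[of t] st by auto
    have iv: "v integrable_on {s..t}" using it st by (auto intro: integrable_on_subinterval)
    have "integral {0..s} v + integral {s..t} v = integral {0..t} v"
      using st it by (intro Henstock_Kurzweil_Integration.integral_combine) auto
    then have "integral {s..t} v = \<gamma> t - \<gamma> s"
      using hi[of s] hi[of t] st by (simp add: integral_unique algebra_simps)
    then have "(v has_integral (\<gamma> t - \<gamma> s)) {s..t}" using iv by (metis integrable_integral)
    \<comment> \<open>The integral ignores null sets: setting the velocity to 0 on \<open>N\<close>
      turns the almost everywhere bound into one at every point.\<close>
    then have "((\<lambda>x. if x \<in> N then 0 else v x) has_integral (\<gamma> t - \<gamma> s)) {s..t}"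
      by (rule has_integral_spike[OF N, rotated]) auto
    then have "norm (\<gamma> t - \<gamma> s) \<le> max K 0 * measure lborel (cbox s t)"
      using st by (intro has_integral_bound[of _ "\<lambda>x. if x \<in> N then 0 else v x"]) (auto simp: N_def)
    then show ?thesis using st by simp
  qed
  fix s t :: real assume "s \<in> {0..1}" "t \<in> {0..1}"
  then show "dist (\<gamma> s) (\<gamma> t) \<le> max K 0 * dist s t"
    using main[of s t] main[of t s] by (cases "s \<le> t") (auto simp: dist_norm norm_minus_commute)
qed simp

section \<open>The weight conditions\<close>

lemma ennreal_le_mult_if_divide_le:
  fixes X Y :: ennreal
  assumes "X / ennreal V \<le> Y" "V > 0"
  shows "X \<le> Y * ennreal V"
proof -
  have "X = ennreal V * X / ennreal V"
    using assms(2) mult_divide_eq_ennreal[of "ennreal V" X] by (simp add: mult.commute)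
  also have "\<dots> = X / ennreal V * ennreal V" by (metis ennreal_times_divide mult.commute)
  also have "\<dots> \<le> Y * ennreal V" by (intro mult_right_mono assms(1)) simp
  finally show ?thesis .
qed

lemma emeasure_lborel_cube:
  fixes a :: "real ^ 'n"
  assumes "l > 0"
  shows "emeasure lborel (cbox a (a + (\<chi> i. l))) = ennreal (l powr real CARD('n))"
proof -
  have b: "(\<chi> i. l) \<bullet> b = l" if "b \<in> Basis" for b :: "real ^ 'n"
    using that by (auto simp: Basis_vec_def inner_axis)
  have "emeasure lborel (cbox a (a + (\<chi> i. l))) = ennreal (\<Prod>b\<in>Basis. (a + (\<chi> i. l) - a) \<bullet> b)"
    using assms b by (intro emeasure_lborel_cbox) (auto simp: inner_add_left)
  also have "(\<Prod>b\<in>(Basis :: (real ^ 'n) set). (a + (\<chi> i. l) - a) \<bullet> b) = l powr real CARD('n)"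
    using assms b by (simp add: powr_realpow)
  finally show ?thesis .
qed

text \<open>For almost every \<open>x\<close> in \<open>Q\<close> the reciprocal of
  \<open>w x\<close> is at most the essential supremum, so the average factor is at most
  \<open>K * w x\<close>. The exceptional set depends on \<open>Q\<close>.\<close>

lemma cube_condition_pointwise:
  fixes w :: "real ^ 'n \<Rightarrow> real"
  assumes w: "\<And>x. w x \<ge> 0" and p: "p > 0" and l: "l > 0"
    and Q: "Q = cbox a (a + (\<chi> i. l))"
    and cond: "epowr (average Q (\<lambda>x. ennreal (w x powr p))) (1 / p) *
      esssup (restrict_space lebesgue Q) (\<lambda>x. 1 / ennreal (w x)) < ennreal K"
  shows "AE x in lebesgue. x \<in> Q \<longrightarrow> (\<integral>\<^sup>+y. ennreal (w y powr p) * indicator Q y \<partial>lebesgue)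
    \<le> ennreal ((K * w x) powr p * l powr real CARD('n))"
proof -
  have Qm: "Q \<in> sets lebesgue" by (simp add: Q)
  \<comment> \<open>\<open>ennreal\<close> sends nonpositive reals to 0, so a strict bound by
    \<open>ennreal K\<close> forces \<open>K > 0\<close>.\<close>
  from le_less_trans[OF zero_le cond] have K: "K > 0" by simp
  define S where "S = esssup (restrict_space lebesgue Q) (\<lambda>x. 1 / ennreal (w x))"
  define av where "av = average Q (\<lambda>x. ennreal (w x powr p))"
  have "AE x in restrict_space lebesgue Q. 1 / ennreal (w x) \<le> S"
    unfolding S_def by (rule esssup_AE)
  then have "AE x in lebesgue. x \<in> Q \<longrightarrow> 1 / ennreal (w x) \<le> S"
    using Qm by (subst (asm) AE_restrict_space_iff) auto
  then show ?thesis
  proof eventually_elim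
    case (elim x)
    show ?case
    proof
      assume "x \<in> Q"
      then have le: "1 / ennreal (w x) \<le> S" using elim by blast
      have c: "epowr av (1 / p) * S < ennreal K" using cond by (simp add: av_def S_def)
      have "epowr av (1 / p) \<le> ennreal (K * w x)"
      proof (cases "w x = 0")
        case True
        \<comment> \<open>Where the weight vanishes, \<open>1 / ennreal 0\<close> is
          \<open>top\<close>. The supremum is then infinite, and a finite product leaves only 0 for
          the other factor.\<close>
        then have "S = top" using le by (simp add: top_unique)
        then have "epowr av (1 / p) = 0" using c by (metis ennreal_mult_eq_top_iff ennreal_less_top not_less_iff_gr_or_eq order_less_asym)
        then show ?thesis by simp
      next
        case False
        then have w0: "w x > 0" using w[of x] by simp
        have "1 = 1 / ennreal (w x) * ennreal (w x)"
          using w0 by (simp add: divide_ennreal_def ennreal_inverse_mult ennreal_mult[symmetric] inverse_ennreal)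
        also have "\<dots> \<le> S * ennreal (w x)" using le by (intro mult_right_mono) auto
        finally have "epowr av (1 / p) * 1 \<le> epowr av (1 / p) * (S * ennreal (w x))" by (rule mult_left_mono) simp
        also have "\<dots> = epowr av (1 / p) * S * ennreal (w x)" by (simp add: mult.assoc)
        also have "\<dots> \<le> ennreal K * ennreal (w x)" using c by (intro mult_right_mono) auto
        also have "\<dots> = ennreal (K * w x)" using K w by (simp add: ennreal_mult)
        finally show ?thesis by simp
      qed
      then have "av \<noteq> top" "ennreal (enn2real av powr (1 / p)) \<le> ennreal (K * w x)"
        by (auto simp: epowr_def top_unique split: if_splits)
      then have "enn2real av powr (1 / p) \<le> K * w x" using K w by simp
      then have "(enn2real av powr (1 / p)) powr p \<le> (K * w x) powr p" using p by (intro powr_mono2) auto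
      then have "enn2real av \<le> (K * w x) powr p" using p by (simp add: powr_powr)
      then have "ennreal (enn2real av) \<le> ennreal ((K * w x) powr p)" by (rule ennreal_leI)
      then have "av \<le> ennreal ((K * w x) powr p)" using \<open>av \<noteq> top\<close> by (metis ennreal_enn2real top.not_eq_extremum)
      moreover have "emeasure lebesgue Q = ennreal (l powr real CARD('n))"
        using emeasure_lborel_cube[OF l, of a] by (simp add: Q)
      ultimately have "(\<integral>\<^sup>+y. ennreal (w y powr p) * indicator Q y \<partial>lebesgue)
          \<le> ennreal ((K * w x) powr p) * ennreal (l powr real CARD('n))"
        using l by (intro ennreal_le_mult_if_divide_le) (auto simp: av_def average_def)
      then show "(\<integral>\<^sup>+y. ennreal (w y powr p) * indicator Q y \<partial>lebesgue)
        \<le> ennreal ((K * w x) powr p * l powr real CARD('n))" by (simp add: ennreal_mult')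
    qed
  qed
qed

text \<open>The null set in the pointwise bound depends on the cube, so only countably many cubes
  are used: those with rational side and lower corner in a countable dense set. A ball of radius
  \<rho> lies in one of them with side below 4 \<rho>, whence
  \<open>4 powr real CARD('n)\<close>.\<close>

lemma cube_condition_ball:
  fixes w :: "real ^ 'n \<Rightarrow> real"
  assumes w: "\<And>x. w x \<ge> 0" and p: "p > 0"
    and cond: "\<And>Q. Q \<in> cubes \<Longrightarrow> epowr (average Q (\<lambda>x. ennreal (w x powr p))) (1 / p) *
      esssup (restrict_space lebesgue Q) (\<lambda>x. 1 / ennreal (w x)) < ennreal K"
  shows "AE x in lebesgue. \<forall>\<rho>>0. (\<integral>\<^sup>+y. ennreal (w y powr p) * indicator (cball x \<rho>) y \<partial>lebesgue)
    \<le> ennreal (\<bar>K\<bar> powr p * 4 powr real CARD('n) * w x powr p * \<rho> powr real CARD('n))"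
proof -
  obtain D :: "(real ^ 'n) set" where D: "countable D" "\<And>S. open S \<Longrightarrow> S \<noteq> {} \<Longrightarrow> \<exists>u\<in>D. u \<in> S"
    using countable_dense_setE by metis
  have "cbox 0 (0 + (\<chi> i. 1)) \<in> (cubes :: (real ^ 'n) set set)" 
    unfolding cubes_def using zero_less_one by blast
  from le_less_trans[OF zero_le cond[OF this]] have K: "K > 0" by simp
  define cube where "cube a l = cbox a (a + (\<chi> i. l))" for a :: "real ^ 'n" and l
  have "AE x in lebesgue. \<forall>a\<in>D. \<forall>l\<in>\<rat> \<inter> {0<..}. x \<in> cube a l \<longrightarrow>
      (\<integral>\<^sup>+y. ennreal (w y powr p) * indicator (cube a l) y \<partial>lebesgue) \<le> ennreal ((K * w x) powr p * l powr real CARD('n))"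
    unfolding AE_ball_countable[OF D(1)] AE_ball_countable[OF countable_Int1[OF countable_rat]]
  proof (intro ballI)
    fix a and l :: real assume "l \<in> \<rat> \<inter> {0<..}"
    then have l: "l > 0" by simp
    then have "cube a l \<in> cubes" by (auto simp: cubes_def cube_def)
    from cond[OF this] show "AE x in lebesgue. x \<in> cube a l \<longrightarrow>
      (\<integral>\<^sup>+y. ennreal (w y powr p) * indicator (cube a l) y \<partial>lebesgue) \<le> ennreal ((K * w x) powr p * l powr real CARD('n))"
      by (intro cube_condition_pointwise[OF w p l cube_def]) 
  qed
  then show ?thesis
  proof eventually_elim
    case (elim x)
    show ?case
    proof (intro allI impI)
      fix \<rho> :: real assume \<rho>: "\<rho> > 0"
      then obtain l where l: "l \<in> \<rat>" "3 * \<rho> < l" "l < 4 * \<rho>" using Rats_dense_in_real[of "3 * \<rho>" "4 * \<rho>"] by auto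
      \<comment> \<open>The admissible lower corners: in each coordinate \<open>a\<close> below x -
        \<rho> and \<open>a + l\<close> above x + \<rho>. They form a nonempty open box because l >
        2 \<rho>.\<close>
      have "box (\<chi> i. x $ i + \<rho> - l) (\<chi> i. x $ i - \<rho>) \<noteq> {}"
        using l \<rho> by (auto simp: interval_ne_empty_cart)
      then obtain a where a: "a \<in> D" "a \<in> box (\<chi> i. x $ i + \<rho> - l) (\<chi> i. x $ i - \<rho>)"
        using D(2) open_box by blast
      have sub: "cball x \<rho> \<subseteq> cube a l"
      proof
        fix y assume "y \<in> cball x \<rho>"
        then have yx: "\<bar>y $ i - x $ i\<bar> \<le> \<rho>" for i
          using component_le_norm_cart[of "y - x" i] by (simp add: dist_norm norm_minus_commute)
        have ax: "x $ i + \<rho> - l < a $ i" "a $ i < x $ i - \<rho>" for i using a(2) by (auto simp: mem_box_cart)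
        have "a $ i \<le> y $ i \<and> y $ i \<le> a $ i + l" for i using yx[of i] ax[of i] by linarith
        then show "y \<in> cube a l" by (simp add: cube_def mem_box_cart)
      qed
      have "(\<integral>\<^sup>+y. ennreal (w y powr p) * indicator (cball x \<rho>) y \<partial>lebesgue)
          \<le> (\<integral>\<^sup>+y. ennreal (w y powr p) * indicator (cube a l) y \<partial>lebesgue)"
        using sub by (intro nn_integral_mono) (auto split: split_indicator)
      also have "\<dots> \<le> ennreal ((K * w x) powr p * l powr real CARD('n))"
        using elim a(1) l \<rho> sub by force
      also have "\<dots> \<le> ennreal ((\<bar>K\<bar> powr p * w x powr p) * (4 powr real CARD('n) * \<rho> powr real CARD('n)))"
      proof (intro ennreal_leI mult_mono)
        show "(K * w x) powr p \<le> \<bar>K\<bar> powr p * w x powr p"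
          using K by (simp add: powr_mult)
        have "l powr real CARD('n) \<le> (4 * \<rho>) powr real CARD('n)" using l \<rho> by (intro powr_mono2) auto
        then show "l powr real CARD('n) \<le> 4 powr real CARD('n) * \<rho> powr real CARD('n)" by (simp add: powr_mult)
      qed auto
      finally show "(\<integral>\<^sup>+y. ennreal (w y powr p) * indicator (cball x \<rho>) y \<partial>lebesgue)
          \<le> ennreal (\<bar>K\<bar> powr p * 4 powr real CARD('n) * w x powr p * \<rho> powr real CARD('n))" by (simp add: mult_ac)
    qed
  qed
qed

text \<open>The closed ball lies in the open ball of twice the radius, whose average is at most the
  maximal function; the doubling costs \<open>2 ^ DIM('a)\<close>. One good point serves all radii
  at once. \<open>\<bar>C0\<bar>\<close> covers a negative \<open>C0\<close>.\<close>

lemma maximal_condition_ball: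
  fixes w :: "'a::euclidean_space \<Rightarrow> real"
  assumes w: "\<And>x. w x \<ge> 0" and M: "hl_maximal w x \<le> ennreal (C0 * w x)" and \<rho>: "\<rho> > 0"
  shows "(\<integral>\<^sup>+y. ennreal (w y) * indicator (cball x \<rho>) y \<partial>lebesgue)
    \<le> ennreal (\<bar>C0\<bar> * 2 ^ DIM('a) * measure lborel (ball (0::'a) 1) * w x * \<rho> powr real DIM('a))"
proof -
  define V where "V = measure lborel (ball x (2 * \<rho>))"
  have V: "V > 0" "emeasure lebesgue (ball x (2 * \<rho>)) = ennreal V"
    using \<rho> content_ball_pos[of "2 * \<rho>" x] emeasure_lborel_ball_finite[of x "2 * \<rho>"]
    by (auto simp: V_def emeasure_eq_ennreal_measure)
  have "average (ball x (2 * \<rho>)) (\<lambda>y. ennreal \<bar>w y\<bar>) \<le> hl_maximal w x"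
    unfolding hl_maximal_def using \<rho> by (intro SUP_upper) auto
  also note M
  finally have "(\<integral>\<^sup>+y. ennreal \<bar>w y\<bar> * indicator (ball x (2 * \<rho>)) y \<partial>lebesgue) / ennreal V \<le> ennreal (C0 * w x)"
    by (simp only: average_def V(2))
  then have a: "(\<integral>\<^sup>+y. ennreal \<bar>w y\<bar> * indicator (ball x (2 * \<rho>)) y \<partial>lebesgue) \<le> ennreal (C0 * w x) * ennreal V"
    using V(1) by (rule ennreal_le_mult_if_divide_le)
  have b: "(\<integral>\<^sup>+y. ennreal (w y) * indicator (cball x \<rho>) y \<partial>lebesgue)
      \<le> (\<integral>\<^sup>+y. ennreal \<bar>w y\<bar> * indicator (ball x (2 * \<rho>)) y \<partial>lebesgue)"
    using w \<rho> by (intro nn_integral_mono) (auto split: split_indicator)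
  have c: "ennreal (C0 * w x) * ennreal V \<le> ennreal (\<bar>C0\<bar> * w x) * ennreal V"
    using w[of x] by (intro mult_right_mono ennreal_leI) auto
  have d: "ennreal (\<bar>C0\<bar> * w x) * ennreal V
      = ennreal (\<bar>C0\<bar> * 2 ^ DIM('a) * measure lborel (ball (0::'a) 1) * w x * \<rho> powr real DIM('a))"
  proof -
    have "V = (2 * \<rho>) ^ DIM('a) * measure lborel (ball (0::'a) 1)"
      unfolding V_def using \<rho> by (intro content_ball_conv_unit_ball) simp
    then show ?thesis using \<rho> V(1) w[of x]
      by (simp add: ennreal_mult'[symmetric] powr_realpow power_mult_distrib mult_ac)
  qed
  show ?thesis using order_trans[OF b order_trans[OF a c]] unfolding d .
qed

theorem theorem3p4:
  fixes \<Omega> :: "(real ^ 'n) set" and w :: "real ^ 'n \<Rightarrow> real" and \<alpha> n p :: real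
  defines "n \<equiv> real CARD('n)"
  defines "p \<equiv> n / (n - 1 + \<alpha>)"
  assumes "bounded_john_domain \<Omega>"
    and "\<alpha> \<in> {0..1}" and "1 - \<alpha> < n"
    and "w \<in> borel_measurable lebesgue" and "\<And>x. w x \<ge> 0"
    and "\<alpha> < 1 \<Longrightarrow> \<exists>K::real. \<forall>Q\<in>cubes.
           epowr (average Q (\<lambda>x. ennreal (w x powr p))) ((n - 1 + \<alpha>) / n) *
           esssup (restrict_space lebesgue Q) (\<lambda>x. 1 / ennreal (w x)) < ennreal K"
    and "\<alpha> = 1 \<Longrightarrow> \<exists>C0::real. AE x in lebesgue. x \<in> \<Omega> \<longrightarrow> hl_maximal w x \<le> ennreal (C0 * w x)"
  shows "\<exists>C>0. \<forall>f :: real ^ 'n \<Rightarrow> real. locally_lipschitz_on \<Omega> f \<longrightarrow>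
           (INF a. Lp_norm p \<Omega> (\<lambda>x. (f x - a) * w x))
           \<le> ennreal C * Lp_norm 1 \<Omega> (\<lambda>x. (bdry_dist \<Omega> x powr \<alpha> * w x) *\<^sub>R gradient f x)"
proof -
  note w0 = assms(7)
  have \<alpha>: "0 \<le> \<alpha>" "\<alpha> \<le> 1" "1 - \<alpha> < n" using assms(4,5) by auto
  have n: "n \<ge> 1" unfolding n_def by (simp add: Suc_leI)
  have nD: "n = real DIM(real ^ 'n)" by (simp add: n_def)
  have n1: "n - 1 + \<alpha> > 0" using \<alpha> by simp
  have p: "p \<ge> 1" "1 / p = (n - 1 + \<alpha>) / n" using n n1 \<alpha> by (auto simp: p_def field_simps)
  obtain x0 \<delta> K0 where \<Omega>: "open \<Omega>" "bounded \<Omega>" and x0: "x0 \<in> \<Omega>" and \<delta>: "\<delta> > 0"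
    and john: "\<And>y. y \<in> \<Omega> \<Longrightarrow> \<exists>\<gamma>. rectifiable_path \<gamma> \<and> path_image \<gamma> \<subseteq> \<Omega> \<and> pathstart \<gamma> = y \<and> pathfinish \<gamma> = x0 \<and>
        (\<forall>s\<in>{0..1}. bdry_dist \<Omega> (\<gamma> s) \<ge> \<delta> * s) \<and> velocity_bounded_by \<gamma> K0"
    using assms(3) unfolding bounded_john_domain_def by blast
  \<comment> \<open>Half of the John constant, so that \<open>2 * r * s\<close> is the guaranteed
    distance.\<close>
  define r where "r = \<delta> / 2"
  have r: "r > 0" using \<delta> by (simp add: r_def)
  have curves: "\<exists>\<gamma>. (max K0 0)-lipschitz_on {0..1} \<gamma> \<and> \<gamma> 0 = y \<and> \<gamma> 1 = x0 \<and>
      (\<forall>s\<in>{0..1}. \<gamma> s \<in> \<Omega> \<and> 2 * r * s \<le> bdry_dist \<Omega> (\<gamma> s))" if y: "y \<in> \<Omega>" for y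
  proof -
    obtain \<gamma> where \<gamma>: "path_image \<gamma> \<subseteq> \<Omega>" "pathstart \<gamma> = y" "pathfinish \<gamma> = x0"
        "\<forall>s\<in>{0..1}. bdry_dist \<Omega> (\<gamma> s) \<ge> \<delta> * s" "velocity_bounded_by \<gamma> K0"
      using john[OF y] by blast
    then show ?thesis using velocity_bounded_by_lipschitz[OF \<gamma>(5)]
      by (intro exI[of _ \<gamma>]) (auto simp: path_image_def pathstart_def pathfinish_def r_def)
  qed
  \<comment> \<open>The Tonelli arguments work with Borel functions, so \<open>w\<close> is replaced
    by one that equals it almost everywhere; the maximum with 0 restores nonnegativity at every
    point.\<close>
  obtain w1 where w1: "w1 \<in> borel_measurable lborel" "AE x in lborel. w x = w1 x"
    using completion_ex_borel_measurable_real[OF assms(6)] by blast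
  define w' where "w' x = max 0 (w1 x)" for x
  have w'm[measurable]: "w' \<in> borel_measurable borel" using w1(1) unfolding w'_def by simp
  have w'0: "w' x \<ge> 0" for x by (simp add: w'_def)
  have ww': "AE x in lborel. w x = w' x"
    using w1(2) by eventually_elim (metis w'_def max.absorb2 w0)
  define u where "u x = ennreal (w' x powr p)" for x
  have um: "u \<in> borel_measurable borel" unfolding u_def by measurable
  have conv: "(\<integral>\<^sup>+y. ennreal (w y powr p) * indicator S y \<partial>lebesgue) = (\<integral>\<^sup>+y. u y * indicator S y \<partial>lborel)" for S
    unfolding nn_integral_completion by (intro nn_integral_cong_AE) (use ww' in eventually_elim, simp add: u_def)
  obtain C1 where C1: "C1 \<ge> 0" and ball0: "AE x in lborel. x \<in> \<Omega> \<longrightarrow>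
      (\<forall>\<rho>>0. (\<integral>\<^sup>+y. ennreal (w y powr p) * indicator (cball x \<rho>) y \<partial>lebesgue) \<le> ennreal (C1 * w x powr p * \<rho> powr n))"
  proof (cases "\<alpha> = 1")
    case True
    \<comment> \<open>At \<alpha> = 1 the weight \<open>w powr p\<close> is \<open>w\<close> itself,
      so the maximal function controls the same measure.\<close>
    then have p1: "p = 1" using n by (simp add: p_def)
    obtain C0 where C0: "AE x in lborel. x \<in> \<Omega> \<longrightarrow> hl_maximal w x \<le> ennreal (C0 * w x)"
      using assms(9)[OF True] unfolding AE_completion_iff by blast
    show ?thesis
    proof
      show "AE x in lborel. x \<in> \<Omega> \<longrightarrow> (\<forall>\<rho>>0. (\<integral>\<^sup>+y. ennreal (w y powr p) * indicator (cball x \<rho>) y \<partial>lebesgue)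
        \<le> ennreal (\<bar>C0\<bar> * 2 ^ DIM(real ^ 'n) * measure lborel (ball (0::real ^ 'n) 1) * w x powr p * \<rho> powr n))"
        using C0
      proof eventually_elim
        case (elim x)
        then show ?case using maximal_condition_ball[of w x C0] w0 by (simp add: p1 nD)
      qed
    qed simp
  next
    case False
    then obtain K where "\<forall>Q\<in>cubes. epowr (average Q (\<lambda>x. ennreal (w x powr p))) (1 / p) *
           esssup (restrict_space lebesgue Q) (\<lambda>x. 1 / ennreal (w x)) < ennreal K"
      using assms(8) \<alpha> unfolding p(2) by auto
    then have "AE x in lebesgue. \<forall>\<rho>>0. (\<integral>\<^sup>+y. ennreal (w y powr p) * indicator (cball x \<rho>) y \<partial>lebesgue)
        \<le> ennreal (\<bar>K\<bar> powr p * 4 powr n * w x powr p * \<rho> powr n)"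
      unfolding n_def using p(1) by (intro cube_condition_ball w0) auto
    then have "AE x in lborel. \<forall>\<rho>>0. (\<integral>\<^sup>+y. ennreal (w y powr p) * indicator (cball x \<rho>) y \<partial>lebesgue)
        \<le> ennreal (\<bar>K\<bar> powr p * 4 powr n * w x powr p * \<rho> powr n)" by (simp only: AE_completion_iff)
    then show ?thesis
      by (intro that[of "\<bar>K\<bar> powr p * 4 powr n"]) (auto elim: eventually_mono)
  qed
  have ball: "AE x in lborel. x \<in> \<Omega> \<longrightarrow>
      (\<forall>\<rho>>0. (\<integral>\<^sup>+y. u y * indicator (cball x \<rho>) y \<partial>lborel) \<le> ennreal (C1 * w' x powr p * \<rho> powr n))"
    using ball0 ww' unfolding conv by eventually_elim simp
  have fin: "(\<integral>\<^sup>+y\<in>\<Omega>. u y \<partial>lborel) < \<infinity>"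
  proof -
    \<comment> \<open>A nonempty open set is not null, so the ball bound holds at some point of
      \<open>\<Omega>\<close>; a large ball about that point contains the bounded domain and has
      finite mass.\<close>
    have "\<exists>x\<in>\<Omega>. \<forall>\<rho>>0. (\<integral>\<^sup>+y. u y * indicator (cball x \<rho>) y \<partial>lborel) \<le> ennreal (C1 * w' x powr p * \<rho> powr n)"
    proof (rule ccontr)
      assume "\<not> ?thesis"
      then have "AE x in lborel. x \<notin> \<Omega>" using ball by (auto elim!: eventually_mono)
      then have "\<Omega> \<in> null_sets lborel" using \<Omega>(1) by (simp add: AE_iff_null_sets)
      then have "negligible \<Omega>" using null_sets_completionI negligible_iff_null_sets by blast
      then show False using open_not_negligible[OF \<Omega>(1)] x0 by blast
    qed
    then obtain x where x: "\<forall>\<rho>>0. (\<integral>\<^sup>+y. u y * indicator (cball x \<rho>) y \<partial>lborel) \<le> ennreal (C1 * w' x powr p * \<rho> powr n)"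
      by blast
    obtain R where R: "R > 0" "\<Omega> \<subseteq> cball x R"
    proof -
      obtain e where e: "\<And>y. y \<in> \<Omega> \<Longrightarrow> dist x y \<le> e"
        using \<Omega>(2) unfolding bounded_any_center[where a = x] by blast
      then show thesis by (intro that[of "max e 1"]) (force simp: max_def)+
    qed
    have "(\<integral>\<^sup>+y\<in>\<Omega>. u y \<partial>lborel) \<le> (\<integral>\<^sup>+y. u y * indicator (cball x R) y \<partial>lborel)"
      using R(2) by (intro nn_integral_mono) (auto split: split_indicator)
    also have "\<dots> \<le> ennreal (C1 * w' x powr p * R powr n)" using x R(1) by blast
    also have "\<dots> < \<infinity>" by simp
    finally show ?thesis .
  qed
  define B where "B = (1 + 1 / (1 - \<alpha>) + 1 / (n - 1 + \<alpha>)) * (1 / r) powr \<alpha> * (C1 * (max K0 0 + r) powr n) powr (1 / p)"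
  define A where "A = (2 * (max K0 0 + r) * B / measure lborel (ball (0::real ^ 'n) r)) powr p"
  \<comment> \<open>The summand 1 keeps \<open>C\<close> positive even if \<open>A = 0\<close>, so
    an infinite right-hand side stays infinite after multiplication.\<close>
  define C where "C = (2 * 4 powr p * A) powr (1 / p) + 1"
  have A: "A \<ge> 0" by (simp add: A_def)
  have C: "C > 0" by (simp add: C_def add_nonneg_pos)
  show ?thesis
  proof (intro exI[of _ C] conjI C allI impI)
    fix f :: "real ^ 'n \<Rightarrow> real" assume f: "locally_lipschitz_on \<Omega> f"
    define X where "X = (\<integral>\<^sup>+x\<in>\<Omega>. ennreal (norm (gradient f x)) * ennreal (bdry_dist \<Omega> x powr \<alpha> * w' x) \<partial>lborel)"
    have epowr1: "epowr x 1 = x" for x by (auto simp: epowr_def top.not_eq_extremum)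
    have rhs: "Lp_norm 1 \<Omega> (\<lambda>x. (bdry_dist \<Omega> x powr \<alpha> * w x) *\<^sub>R gradient f x) = X"
    proof -
      have "Lp_norm 1 \<Omega> (\<lambda>x. (bdry_dist \<Omega> x powr \<alpha> * w x) *\<^sub>R gradient f x)
        = (\<integral>\<^sup>+x\<in>\<Omega>. ennreal (norm ((bdry_dist \<Omega> x powr \<alpha> * w x) *\<^sub>R gradient f x)) \<partial>lborel)"
        by (simp add: Lp_norm_def epowr1 nn_integral_completion)
      also have "\<dots> = X" unfolding X_def
      proof (intro nn_integral_cong_AE)
        show "AE x in lborel. ennreal (norm ((bdry_dist \<Omega> x powr \<alpha> * w x) *\<^sub>R gradient f x)) * indicator \<Omega> x
          = ennreal (norm (gradient f x)) * ennreal (bdry_dist \<Omega> x powr \<alpha> * w' x) * indicator \<Omega> x"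
          using ww' by eventually_elim (use w'0 in \<open>simp add: ennreal_mult'[symmetric] abs_mult mult_ac\<close>)
      qed
      finally show ?thesis .
    qed
    show "(INF a. Lp_norm p \<Omega> (\<lambda>x. (f x - a) * w x))
        \<le> ennreal C * Lp_norm 1 \<Omega> (\<lambda>x. (bdry_dist \<Omega> x powr \<alpha> * w x) *\<^sub>R gradient f x)"
    proof (cases X)
      case top
      then show ?thesis using C unfolding rhs by (simp add: ennreal_mult_top)
    next
      case (real I)
      obtain b where b: "(\<integral>\<^sup>+y\<in>\<Omega>. ennreal (\<bar>f y - b\<bar> powr p) * u y \<partial>lborel) \<le> ennreal (2 * 4 powr p * A * I powr p)"
        using john_sobolev_poincare_borel[OF \<Omega>(1) \<alpha>[unfolded nD] _ r um w'm w'0 C1 ball[unfolded p_def nD]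
            fin x0 curves f real(1) real(2)[unfolded X_def]]
        unfolding A_def B_def p_def nD by auto
      have "Lp_norm p \<Omega> (\<lambda>x. (f x - b) * w x)
        = epowr (\<integral>\<^sup>+y\<in>\<Omega>. ennreal (\<bar>f y - b\<bar> powr p) * u y \<partial>lborel) (1 / p)"
        unfolding Lp_norm_def nn_integral_completion
      proof (intro arg_cong2[where f = epowr] refl nn_integral_cong_AE)
        show "AE x in lborel. ennreal (norm ((f x - b) * w x) powr p) * indicator \<Omega> x
          = ennreal (\<bar>f x - b\<bar> powr p) * u x * indicator \<Omega> x"
          using ww' by eventually_elim (use w'0 in \<open>simp add: u_def ennreal_mult'[symmetric] abs_mult powr_mult\<close>)
      qed
      also have "\<dots> \<le> ennreal ((2 * 4 powr p * A * I powr p) powr (1 / p))"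
      proof -
        define Y where "Y = (\<integral>\<^sup>+y\<in>\<Omega>. ennreal (\<bar>f y - b\<bar> powr p) * u y \<partial>lborel)"
        have Y: "Y \<noteq> top" "enn2real Y \<le> 2 * 4 powr p * A * I powr p"
          using b A by (auto simp: Y_def top_unique intro!: enn2real_leI)
        then show ?thesis using p(1)
          by (auto simp: epowr_def Y_def[symmetric] intro!: ennreal_leI powr_mono2)
      qed
      also have "(2 * 4 powr p * A * I powr p) powr (1 / p) = (2 * 4 powr p * A) powr (1 / p) * I"
        using A real(1) p(1) by (subst powr_mult) (simp add: powr_powr)
      also have "ennreal ((2 * 4 powr p * A) powr (1 / p) * I) \<le> ennreal (C * I)"
        using real(1) by (intro ennreal_leI mult_right_mono) (auto simp: C_def)
      also have "\<dots> = ennreal C * X" using C real by (simp add: ennreal_mult')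
      finally show ?thesis unfolding rhs by (intro INF_lower2[of b]) auto
    qed
  qed
qed

end
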